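(* Let $\pi$ be the natural unitary representation of $\mathfrak{G}_3=r\mathrm{Spin}(3)+\mathbb{R}^3$ on $L^2(\mathbb{R}^3,S_2)$. Then $\pi$ decomposes as the direct sum of two sub-representations $\pi^\pm$ on ${}^q\!H^\pm_1$ respectively, i.e. $\pi=\pi^+\oplus\pi^-$, where $\pi^\pm$ is the representation on ${}^q\!H_1^\pm$ corresponding to $\tilde\pi^\pm$ under the Fourier transformation.
   Context: $\mathbb{H}$ denotes the quaternions with units $e_1,e_2,e_3$, $e_j^2=-1$, $e_3=e_1e_2$, $e_je_k=-e_ke_j$ for $j\ne k$; all function values are in $\mathbb{H}\otimes_{\mathbb{R}}\mathbb{C}$ with $i$ commuting with the $e_j$. $x\in\mathbb{R}^3$ is identified with $\underline{x}=x_1e_1+x_2e_2+x_3e_3$. $\mathrm{Spin}(3)$ is the group of unit quaternions. $\mathfrak{G}_3$ is the group of triples $(r,s,b)$, $r>0$, $s\in\mathrm{Spin}(3)$, $b\in\mathbb{R}^3$, with product $(r,s,b)(r',s',b')=(rr',ss',rsb's^{-1}+b)$. Natural representation: $(\pi(r,s,b)f)(\underline{x})=r^{-3/2}sf(\frac1r s^{-1}(\underline{x}-b)s)$. $S_2=\mathbb{C}(1-ie_3)\oplus\mathbb{C}(e_1+ie_2)$, a left ideal. $\gamma:S^2\to\mathrm{Spin}(3)$ is a fixed (measurable) choice with $\gamma(\omega)e_3\gamma(\omega)^{-1}=\omega$. $\tilde H^-_1=\{\gamma(\underline{y}/|\underline{y}|)\alpha(\underline{y})(1-ie_3):\alpha\in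 L^2(\mathbb{R}^3)\}$, $\tilde H_1^+=\{\gamma(\underline{y}/|\underline{y}|)\beta(\underline{y})(e_1+ie_2):\beta\in L^2(\mathbb{R}^3)\}$, with $L^2(\mathbb{R}^3)$ complex-valued. On $\tilde H_1^\pm$ the group acts by the irreducible representation $\tilde\pi^\pm_{(r,s,b)}g(\underline{y})=e^{i2\pi b\cdot\underline{y}}r^{3/2}sg(rs^{-1}\underline{y}s)$. Fourier transformation: $\mathfrak{F}f(\underline{\xi})=\int_{\mathbb{R}^3}e^{-i2\pi\langle\underline{x},\underline{\xi}\rangle}f(\underline{x})\,d\underline{x}$, extended to $L^2$. Set ${}^q\!H_1^\pm=\mathfrak{F}\tilde H_1^\pm$; the representation corresponding to $\tilde\pi^\pm$ is $\mathfrak{F}\tilde\pi^\pm\mathfrak{F}^{-1}$. *)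

theory Defs
  imports "HOL-Analysis.Analysis" "HOL-Algebra.Group"
begin

section \<open>The algebra of complexified quaternions\<close>

text \<open>
  An element of \<open>\<bbbH> \<otimes> \<complex>\<close> is the vector of its complex coordinates with respect to \<open>1, e\<^sub>1, e\<^sub>2, e\<^sub>3\<close>,
  indexed by \<open>0, 1, 2, 3\<close> (in the numeral type \<open>4\<close>, the index \<open>0\<close> is the index \<open>4\<close>).
  The Euclidean norm and the complex scalar multiplication \<open>*s\<close> are those of \<open>complex ^ 4\<close>.  The
  product \<open>*\<close> of \<open>complex ^ 4\<close> is componentwise and is not the product of quaternions.
\<close>

type_synonym biquat = "complex ^ 4"

definition qone :: biquat where "qone = axis 0 1"
definition e1 :: biquat where "e1 = axis 1 1"
definition e2 :: biquat where "e2 = axis 2 1"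
definition e3 :: biquat where "e3 = axis 3 1"

definition qmult :: "biquat \<Rightarrow> biquat \<Rightarrow> biquat"  (infixl "\<star>" 70) where
  "p \<star> q =
     (p$0 * q$0 - p$1 * q$1 - p$2 * q$2 - p$3 * q$3) *s qone +
     (p$0 * q$1 + p$1 * q$0 + p$2 * q$3 - p$3 * q$2) *s e1 +
     (p$0 * q$2 - p$1 * q$3 + p$2 * q$0 + p$3 * q$1) *s e2 +
     (p$0 * q$3 + p$1 * q$2 - p$2 * q$1 + p$3 * q$0) *s e3"

text \<open>
  The inverse is computed from the quaternion conjugate \<open>q'\<close> of \<open>q\<close> (which does not conjugate
  the complex coefficients): \<open>q \<star> q'\<close> is the complex number \<open>q\<^sub>0\<^sup>2 + q\<^sub>1\<^sup>2 + q\<^sub>2\<^sup>2 + q\<^sub>3\<^sup>2\<close>.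
\<close>

definition qinv :: "biquat \<Rightarrow> biquat" where
  "qinv q = inverse ((q$0)\<^sup>2 + (q$1)\<^sup>2 + (q$2)\<^sup>2 + (q$3)\<^sup>2) *s
              (q$0 *s qone - q$1 *s e1 - q$2 *s e2 - q$3 *s e3)"

lemma index4_distinct:
  "(0::4) \<noteq> 1" "(0::4) \<noteq> 2" "(0::4) \<noteq> 3" "(1::4) \<noteq> 2" "(1::4) \<noteq> 3" "(2::4) \<noteq> 3"
  "(1::4) \<noteq> 0" "(2::4) \<noteq> 0" "(3::4) \<noteq> 0" "(2::4) \<noteq> 1" "(3::4) \<noteq> 1" "(3::4) \<noteq> 2"
  by simp_all

lemma exhaust_index4: "(k::4) = 0 \<or> k = 1 \<or> k = 2 \<or> k = 3"
  using exhaust_4[of k] by auto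

lemma biquat_eq_iff:
  fixes p q :: biquat
  shows "p = q \<longleftrightarrow> p$0 = q$0 \<and> p$1 = q$1 \<and> p$2 = q$2 \<and> p$3 = q$3"
  unfolding vec_eq_iff using exhaust_index4 by metis

lemma unit_nth [simp]:
  "qone$0 = 1" "qone$1 = 0" "qone$2 = 0" "qone$3 = 0"
  "e1$0 = 0" "e1$1 = 1" "e1$2 = 0" "e1$3 = 0"
  "e2$0 = 0" "e2$1 = 0" "e2$2 = 1" "e2$3 = 0"
  "e3$0 = 0" "e3$1 = 0" "e3$2 = 0" "e3$3 = 1"
  by (simp_all add: qone_def e1_def e2_def e3_def axis_def index4_distinct)

lemma qmult_nth [simp]:
  "(p \<star> q)$0 = p$0 * q$0 - p$1 * q$1 - p$2 * q$2 - p$3 * q$3"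
  "(p \<star> q)$1 = p$0 * q$1 + p$1 * q$0 + p$2 * q$3 - p$3 * q$2"
  "(p \<star> q)$2 = p$0 * q$2 - p$1 * q$3 + p$2 * q$0 + p$3 * q$1"
  "(p \<star> q)$3 = p$0 * q$3 + p$1 * q$2 - p$2 * q$1 + p$3 * q$0"
  by (simp_all add: qmult_def)

lemma qmult_units:
  "e1 \<star> e1 = - qone" "e2 \<star> e2 = - qone" "e3 \<star> e3 = - qone"
  "e1 \<star> e2 = e3" "e2 \<star> e1 = - e3" "e2 \<star> e3 = e1" "e3 \<star> e2 = - e1"
  "e3 \<star> e1 = e2" "e1 \<star> e3 = - e2"
  by (simp_all add: biquat_eq_iff)

lemma qmult_one: "qone \<star> q = q" "q \<star> qone = q"
  by (simp_all add: biquat_eq_iff)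

lemma qmult_assoc: "(p \<star> q) \<star> r = p \<star> (q \<star> r)"
  by (simp add: biquat_eq_iff algebra_simps)

lemma qmult_bilinear:
  "p \<star> (q + r) = p \<star> q + p \<star> r" "(p + q) \<star> r = p \<star> r + q \<star> r"
  "(c *s p) \<star> q = c *s (p \<star> q)" "p \<star> (c *s q) = c *s (p \<star> q)"
  by (simp_all add: biquat_eq_iff algebra_simps)

lemma qmult_qinv:
  assumes "(q$0)\<^sup>2 + (q$1)\<^sup>2 + (q$2)\<^sup>2 + (q$3)\<^sup>2 \<noteq> 0"
  shows "q \<star> qinv q = qone" "qinv q \<star> q = qone"
proof -
  define c where "c = q$0 *s qone - q$1 *s e1 - q$2 *s e2 - q$3 *s e3"
  define N where "N = (q$0)\<^sup>2 + (q$1)\<^sup>2 + (q$2)\<^sup>2 + (q$3)\<^sup>2"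
  have "q \<star> c = N *s qone" "c \<star> q = N *s qone"
    by (simp_all add: biquat_eq_iff c_def N_def power2_eq_square algebra_simps)
  moreover have "qinv q = inverse N *s c"
    by (simp add: qinv_def c_def N_def)
  moreover have "N \<noteq> 0"
    using assms by (simp add: N_def)
  ultimately show "q \<star> qinv q = qone" "qinv q \<star> q = qone"
    by (simp_all add: qmult_bilinear vector_smult_assoc)
qed

definition qvec :: "real ^ 3 \<Rightarrow> biquat" where
  "qvec x = x$1 *\<^sub>R e1 + x$2 *\<^sub>R e2 + x$3 *\<^sub>R e3"

definition Spin3 :: "biquat set" where
  "Spin3 = {s. (\<forall>k. s$k \<in> \<real>) \<and> norm s = 1}"

text \<open>\<open>rot s x\<close> is the vector in \<open>\<real>\<^sup>3\<close> identified with \<open>s x s\<^sup>-\<^sup>1\<close>; see \<open>qvec_rot\<close>.\<close>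

definition rot :: "biquat \<Rightarrow> real ^ 3 \<Rightarrow> real ^ 3" where
  "rot s x = (let q = s \<star> qvec x \<star> qinv s in vector [Re (q$1), Re (q$2), Re (q$3)])"

lemma qvec_nth [simp]:
  "qvec x $ 0 = 0" "qvec x $ 1 = of_real (x$1)" "qvec x $ 2 = of_real (x$2)" "qvec x $ 3 = of_real (x$3)"
  unfolding qvec_def vector_add_component vector_scaleR_component unit_nth
  by (simp_all add: scaleR_conv_of_real)

lemma Spin3_qinv_norm:
  assumes "s \<in> Spin3"
  shows "(s$0)\<^sup>2 + (s$1)\<^sup>2 + (s$2)\<^sup>2 + (s$3)\<^sup>2 = 1"
proof -
  have re: "s$k = of_real (Re (s$k))" for k
    using assms by (simp add: Spin3_def)
  have "(norm s)\<^sup>2 = (\<Sum>k\<in>UNIV. (norm (s$k))\<^sup>2)"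
    by (simp add: norm_vec_def L2_set_def sum_nonneg)
  also have "(UNIV :: 4 set) = {0, 1, 2, 3}"
    using exhaust_index4 by auto
  finally have "1 = (norm (s$0))\<^sup>2 + (norm (s$1))\<^sup>2 + (norm (s$2))\<^sup>2 + (norm (s$3))\<^sup>2"
    using assms by (simp add: Spin3_def)
  moreover have "complex_of_real ((norm (s$k))\<^sup>2) = (s$k)\<^sup>2" for k
    by (subst (1 2) re) simp
  ultimately show ?thesis
    by (metis of_real_1 of_real_add)
qed

lemma Spin3_qinv:
  assumes "s \<in> Spin3"
  shows "s \<star> qinv s = qone" "qinv s \<star> s = qone"
  using qmult_qinv[of s] Spin3_qinv_norm[OF assms] by simp_all

lemma qvec_rot:
  assumes "s \<in> Spin3"
  shows "qvec (rot s x) = s \<star> qvec x \<star> qinv s"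
proof -
  have re: "s$k = of_real (Re (s$k))" for k
    using assms by (simp add: Spin3_def)
  have i: "qinv s = s$0 *s qone - s$1 *s e1 - s$2 *s e2 - s$3 *s e3"
    by (simp add: qinv_def Spin3_qinv_norm[OF assms])
  have im: "Im (s$k) = 0" for k
    by (subst re) simp
  show ?thesis
    unfolding biquat_eq_iff i rot_def Let_def
    by (simp add: complex_eq_iff im algebra_simps)
qed

definition S2 :: "biquat set" where
  "S2 = {a *s (qone - \<i> *s e3) + b *s (e1 + \<i> *s e2) | a b. True}"


section \<open>Square-integrable functions and the space \<open>L\<^sup>2\<close>\<close>

definition sq_integrable :: "('a::euclidean_space \<Rightarrow> 'b::euclidean_space) \<Rightarrow> bool" where
  "sq_integrable f \<longleftrightarrow> f \<in> borel_measurable lborel \<and> integrable lborel (\<lambda>x. (norm (f x))\<^sup>2)"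

lemma sq_integrable_0: "sq_integrable (\<lambda>x. 0)"
  by (simp add: sq_integrable_def)

lemma sq_integrable_scaleR: "sq_integrable f \<Longrightarrow> sq_integrable (\<lambda>x. c *\<^sub>R f x)"
  unfolding sq_integrable_def
  by (auto simp: power_mult_distrib intro: borel_measurable_scaleR)

lemma sq_integrable_uminus: "sq_integrable f \<Longrightarrow> sq_integrable (\<lambda>x. - f x)"
  by (simp add: sq_integrable_def)

lemma sq_integrable_add:
  fixes f g :: "'a::euclidean_space \<Rightarrow> 'b::euclidean_space"
  assumes "sq_integrable f" "sq_integrable g"
  shows "sq_integrable (\<lambda>x. f x + g x)"
proof -
  have [measurable]: "f \<in> borel_measurable lborel" "g \<in> borel_measurable lborel"
    using assms by (auto simp: sq_integrable_def)
  have "integrable lborel (\<lambda>x. 2 * (norm (f x))\<^sup>2 + 2 * (norm (g x))\<^sup>2)"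
    using assms by (auto simp: sq_integrable_def)
  moreover have "(norm (u + v))\<^sup>2 \<le> 2 * (norm u)\<^sup>2 + 2 * (norm v)\<^sup>2" for u v :: 'b
  proof -
    have "(norm (u + v))\<^sup>2 \<le> (norm u + norm v)\<^sup>2"
      by (intro power_mono norm_triangle_ineq norm_ge_zero)
    also have "\<dots> \<le> 2 * (norm u)\<^sup>2 + 2 * (norm v)\<^sup>2"
      using sum_squares_bound[of "norm u" "norm v"] by (simp add: power2_sum)
    finally show ?thesis .
  qed
  ultimately have "integrable lborel (\<lambda>x. (norm (f x + g x))\<^sup>2)"
    by (elim Bochner_Integration.integrable_bound) (auto intro!: AE_I2)
  then show ?thesis by (simp add: sq_integrable_def)
qed

lemma sq_integrable_diff:
  "sq_integrable f \<Longrightarrow> sq_integrable g \<Longrightarrow> sq_integrable (\<lambda>x. f x - g x)"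
  using sq_integrable_add[of f "\<lambda>x. - g x"] sq_integrable_uminus[of g] by simp

lemma integrable_inner_sq_integrable:
  fixes f g :: "'a::euclidean_space \<Rightarrow> 'b::euclidean_space"
  assumes "sq_integrable f" "sq_integrable g"
  shows "integrable lborel (\<lambda>x. f x \<bullet> g x)"
proof -
  have [measurable]: "f \<in> borel_measurable lborel" "g \<in> borel_measurable lborel"
    using assms by (auto simp: sq_integrable_def)
  have "integrable lborel (\<lambda>x. (norm (f x))\<^sup>2 + (norm (g x))\<^sup>2)"
    using assms by (auto simp: sq_integrable_def)
  moreover have "\<bar>u \<bullet> v\<bar> \<le> (norm u)\<^sup>2 + (norm v)\<^sup>2" for u v :: 'b
    using Cauchy_Schwarz_ineq2[of u v] sum_squares_bound[of "norm u" "norm v"]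
      mult_nonneg_nonneg[OF norm_ge_zero[of u] norm_ge_zero[of v]] by linarith
  ultimately show ?thesis
    by (elim Bochner_Integration.integrable_bound) (auto intro!: AE_I2)
qed

definition L2_rel ::
  "('a::euclidean_space \<Rightarrow> 'b::euclidean_space) \<Rightarrow> ('a \<Rightarrow> 'b) \<Rightarrow> bool" where
  "L2_rel f g \<longleftrightarrow> sq_integrable f \<and> sq_integrable g \<and> (AE x in lborel. f x = g x)"

quotient_type (overloaded) ('a, 'b) L2 =
  "'a::euclidean_space \<Rightarrow> 'b::euclidean_space" / partial: L2_rel
proof (rule part_equivpI)
  show "\<exists>f::'a \<Rightarrow> 'b. L2_rel f f"
    by (rule exI[of _ "\<lambda>_. 0"]) (simp add: L2_rel_def sq_integrable_0)
  show "symp (L2_rel :: ('a \<Rightarrow> 'b) \<Rightarrow> _)"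
    by (auto intro!: sympI simp: L2_rel_def)
  show "transp (L2_rel :: ('a \<Rightarrow> 'b) \<Rightarrow> _)"
    by (rule transpI) (auto simp: L2_rel_def)
qed

instantiation L2 :: (euclidean_space, euclidean_space) real_vector
begin

lift_definition zero_L2 :: "('a, 'b) L2" is "\<lambda>x. 0"
  by (simp add: L2_rel_def sq_integrable_0)

lift_definition plus_L2 :: "('a, 'b) L2 \<Rightarrow> ('a, 'b) L2 \<Rightarrow> ('a, 'b) L2" is "\<lambda>f g x. f x + g x"
  by (auto simp: L2_rel_def intro: sq_integrable_add)

lift_definition minus_L2 :: "('a, 'b) L2 \<Rightarrow> ('a, 'b) L2 \<Rightarrow> ('a, 'b) L2" is "\<lambda>f g x. f x - g x"
  by (auto simp: L2_rel_def intro: sq_integrable_diff)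

lift_definition uminus_L2 :: "('a, 'b) L2 \<Rightarrow> ('a, 'b) L2" is "\<lambda>f x. - f x"
  by (auto simp: L2_rel_def intro: sq_integrable_uminus)

lift_definition scaleR_L2 :: "real \<Rightarrow> ('a, 'b) L2 \<Rightarrow> ('a, 'b) L2" is "\<lambda>c f x. c *\<^sub>R f x"
  by (auto simp: L2_rel_def intro: sq_integrable_scaleR)

instance
proof
  fix f g h :: "('a, 'b) L2" and a b :: real
  show "f + g + h = f + (g + h)"
    by transfer (auto simp: L2_rel_def add.assoc intro!: sq_integrable_add)
  show "f + g = g + f"
    by transfer (auto simp: L2_rel_def add.commute intro!: sq_integrable_add)
  show "0 + f = f"
    by transfer (auto simp: L2_rel_def)
  show "- f + f = 0"
    by transfer (auto simp: L2_rel_def sq_integrable_0)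
  show "f - g = f + - g"
    by transfer (auto simp: L2_rel_def intro!: sq_integrable_add sq_integrable_diff)
  show "a *\<^sub>R (f + g) = a *\<^sub>R f + a *\<^sub>R g"
    by transfer
      (auto simp: L2_rel_def scaleR_add_right intro!: sq_integrable_add sq_integrable_scaleR)
  show "(a + b) *\<^sub>R f = a *\<^sub>R f + b *\<^sub>R f"
    by transfer
      (auto simp: L2_rel_def scaleR_add_left intro!: sq_integrable_add sq_integrable_scaleR)
  show "a *\<^sub>R b *\<^sub>R f = (a * b) *\<^sub>R f"
    by transfer (auto simp: L2_rel_def intro!: sq_integrable_scaleR)
  show "1 *\<^sub>R f = f"
    by transfer (auto simp: L2_rel_def)
qed

end

instantiation L2 :: (euclidean_space, euclidean_space) real_inner
begin

lift_definition inner_L2 :: "('a, 'b) L2 \<Rightarrow> ('a, 'b) L2 \<Rightarrow> real" is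
  "\<lambda>f g. \<integral>x. f x \<bullet> g x \<partial>lborel"
proof -
  fix f f' g g' :: "'a \<Rightarrow> 'b"
  assume *: "L2_rel f f'" "L2_rel g g'"
  then have [measurable]: "f \<in> borel_measurable lborel" "f' \<in> borel_measurable lborel"
    "g \<in> borel_measurable lborel" "g' \<in> borel_measurable lborel"
    by (auto simp: L2_rel_def sq_integrable_def)
  show "(\<integral>x. f x \<bullet> g x \<partial>lborel) = (\<integral>x. f' x \<bullet> g' x \<partial>lborel)"
    using * by (intro integral_cong_AE) (auto simp: L2_rel_def)
qed

definition norm_L2 :: "('a, 'b) L2 \<Rightarrow> real" where "norm_L2 f = sqrt (f \<bullet> f)"
definition dist_L2 :: "('a, 'b) L2 \<Rightarrow> ('a, 'b) L2 \<Rightarrow> real" where "dist_L2 f g = norm (f - g)"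
definition sgn_L2 :: "('a, 'b) L2 \<Rightarrow> ('a, 'b) L2" where "sgn_L2 f = f /\<^sub>R norm f"
definition uniformity_L2 :: "(('a, 'b) L2 \<times> ('a, 'b) L2) filter" where
  "uniformity_L2 = (INF e\<in>{0<..}. principal {(x, y). dist x y < e})"
definition open_L2 :: "('a, 'b) L2 set \<Rightarrow> bool" where
  "open_L2 U \<longleftrightarrow> (\<forall>x\<in>U. eventually (\<lambda>(x', y). x' = x \<longrightarrow> y \<in> U) uniformity)"

instance
proof
  fix f g h :: "('a, 'b) L2" and a :: real
  show "dist f g = norm (f - g)" by (rule dist_L2_def)
  show "sgn f = f /\<^sub>R norm f" by (rule sgn_L2_def)
  show "(uniformity :: (('a, 'b) L2 \<times> ('a, 'b) L2) filter) =
      (INF e\<in>{0<..}. principal {(x, y). dist x y < e})"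
    by (rule uniformity_L2_def)
  show "open U \<longleftrightarrow> (\<forall>x\<in>U. eventually (\<lambda>(x', y). x' = x \<longrightarrow> y \<in> U) uniformity)"
    for U :: "('a, 'b) L2 set"
    by (rule open_L2_def)
  show "f \<bullet> g = g \<bullet> f"
    by transfer (simp add: inner_commute)
  show "(f + g) \<bullet> h = f \<bullet> h + g \<bullet> h"
    by transfer (simp add: inner_add_left L2_rel_def integrable_inner_sq_integrable)
  show "a *\<^sub>R f \<bullet> g = a * (f \<bullet> g)"
    by transfer simp
  show "0 \<le> f \<bullet> f"
    by transfer simp
  show "f \<bullet> f = 0 \<longleftrightarrow> f = 0"
  proof transfer
    fix f :: "'a \<Rightarrow> 'b"
    assume f: "L2_rel f f"
    then have "integrable lborel (\<lambda>x. f x \<bullet> f x)"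
      by (simp add: L2_rel_def integrable_inner_sq_integrable)
    then have "(\<integral>x. f x \<bullet> f x \<partial>lborel) = 0 \<longleftrightarrow> (AE x in lborel. f x \<bullet> f x = 0)"
      by (subst integral_nonneg_eq_0_iff_AE) auto
    then show "(\<integral>x. f x \<bullet> f x \<partial>lborel) = 0 \<longleftrightarrow> L2_rel f (\<lambda>x. 0)"
      using f by (simp add: L2_rel_def sq_integrable_0)
  qed
  show "norm f = sqrt (f \<bullet> f)" by (rule norm_L2_def)
qed

end

text \<open>The class of a square-integrable function; unspecified for other functions.\<close>

abbreviation L2_class :: "('a::euclidean_space \<Rightarrow> 'b::euclidean_space) \<Rightarrow> ('a, 'b) L2" where
  "L2_class \<equiv> abs_L2"

abbreviation L2_fun :: "('a::euclidean_space, 'b::euclidean_space) L2 \<Rightarrow> 'a \<Rightarrow> 'b" where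
  "L2_fun \<equiv> rep_L2"

lemma L2_fun_class:
  assumes "sq_integrable f"
  shows "AE x in lborel. L2_fun (L2_class f) x = f x"
  using rep_abs_rsp[OF Quotient3_L2, of f f] assms
  by (auto simp: L2_rel_def)

lemma sq_integrable_L2_fun: "sq_integrable (L2_fun f)"
  using Quotient3_rep_reflp[OF Quotient3_L2, of f] by (simp add: L2_rel_def)

lemma L2_class_fun: "L2_class (L2_fun f) = f"
  by (rule Quotient3_abs_rep[OF Quotient3_L2])

text \<open>
  Complex scalar multiplication and the Hermitian inner product of functions with values in
  \<open>\<bbbH> \<otimes> \<complex>\<close>.  The real inner product of the class \<open>real_inner\<close> is the real part of \<open>L2_hinner\<close>.
\<close>

type_synonym L2q = "(real ^ 3, biquat) L2"

definition L2_scale :: "complex \<Rightarrow> L2q \<Rightarrow> L2q" where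
  "L2_scale c f = L2_class (\<lambda>x. c *s L2_fun f x)"

definition L2_hinner :: "L2q \<Rightarrow> L2q \<Rightarrow> complex" where
  "L2_hinner f g = (\<integral>x. (\<Sum>k\<in>UNIV. L2_fun f x $ k * cnj (L2_fun g x $ k)) \<partial>lborel)"

definition L2_S2 :: "L2q set" where
  "L2_S2 = {f. AE x in lborel. L2_fun f x \<in> S2}"


section \<open>The Fourier transformation\<close>

definition fourier_integral :: "(real ^ 3 \<Rightarrow> biquat) \<Rightarrow> real ^ 3 \<Rightarrow> biquat" where
  "fourier_integral f \<xi> = (\<integral>x. exp (- \<i> * of_real (2 * pi * (x \<bullet> \<xi>))) *s f x \<partial>lborel)"

text \<open>
  The extension to \<open>L\<^sup>2\<close>: the continuous map on \<open>L\<^sup>2\<close> that agrees with the Fourier integral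
  on \<open>L\<^sup>1 \<inter> L\<^sup>2\<close>.
\<close>

definition fourier :: "L2q \<Rightarrow> L2q" where
  "fourier = (THE T. continuous_on UNIV T \<and>
     (\<forall>f. sq_integrable f \<and> integrable lborel f \<longrightarrow>
        (AE \<xi> in lborel. L2_fun (T (L2_class f)) \<xi> = fourier_integral f \<xi>)))"


section \<open>Unitary representations\<close>

definition closed_csubspace :: "L2q set \<Rightarrow> bool" where
  "closed_csubspace H \<longleftrightarrow> closed H \<and> 0 \<in> H \<and> (\<forall>f\<in>H. \<forall>g\<in>H. f + g \<in> H) \<and>
     (\<forall>c. \<forall>f\<in>H. L2_scale c f \<in> H)"

text \<open>
  A strongly continuous unitary representation of a group on a closed subspace \<open>H\<close> of \<open>L\<^sup>2\<close>.
  The topology of the group is the subspace topology of the ambient type.  The values of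
  \<open>\<rho> g\<close> outside \<open>H\<close> are irrelevant.
\<close>

definition unitary_rep ::
  "('g::topological_space, 'z) monoid_scheme \<Rightarrow> L2q set \<Rightarrow> ('g \<Rightarrow> L2q \<Rightarrow> L2q) \<Rightarrow> bool" where
  "unitary_rep G H \<rho> \<longleftrightarrow>
     group G \<and> closed_csubspace H \<and>
     (\<forall>g\<in>carrier G.
        \<rho> g ` H = H \<and>
        (\<forall>u\<in>H. \<forall>v\<in>H. \<rho> g (u + v) = \<rho> g u + \<rho> g v) \<and>
        (\<forall>c. \<forall>u\<in>H. \<rho> g (L2_scale c u) = L2_scale c (\<rho> g u)) \<and>
        (\<forall>u\<in>H. \<forall>v\<in>H. L2_hinner (\<rho> g u) (\<rho> g v) = L2_hinner u v)) \<and>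
     (\<forall>g\<in>carrier G. \<forall>h\<in>carrier G. \<forall>u\<in>H. \<rho> (g \<otimes>\<^bsub>G\<^esub> h) u = \<rho> g (\<rho> h u)) \<and>
     (\<forall>u\<in>H. continuous_on (carrier G) (\<lambda>g. \<rho> g u))"

definition subrep ::
  "('g::topological_space, 'z) monoid_scheme \<Rightarrow> L2q set \<Rightarrow> ('g \<Rightarrow> L2q \<Rightarrow> L2q) \<Rightarrow>
     L2q set \<Rightarrow> ('g \<Rightarrow> L2q \<Rightarrow> L2q) \<Rightarrow> bool" where
  "subrep G K \<sigma> H \<rho> \<longleftrightarrow> unitary_rep G K \<sigma> \<and> unitary_rep G H \<rho> \<and> K \<subseteq> H \<and>
     (\<forall>g\<in>carrier G. \<forall>u\<in>K. \<sigma> g u = \<rho> g u)"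

text \<open>\<open>(H, \<rho>)\<close> is the (orthogonal) direct sum of its sub-representations \<open>(K, \<sigma>)\<close> and \<open>(L, \<tau>)\<close>.\<close>

definition direct_sum_rep ::
  "('g::topological_space, 'z) monoid_scheme \<Rightarrow> L2q set \<Rightarrow> ('g \<Rightarrow> L2q \<Rightarrow> L2q) \<Rightarrow>
     L2q set \<Rightarrow> ('g \<Rightarrow> L2q \<Rightarrow> L2q) \<Rightarrow> L2q set \<Rightarrow> ('g \<Rightarrow> L2q \<Rightarrow> L2q) \<Rightarrow> bool" where
  "direct_sum_rep G H \<rho> K \<sigma> L \<tau> \<longleftrightarrow>
     subrep G K \<sigma> H \<rho> \<and> subrep G L \<tau> H \<rho> \<and>
     (\<forall>u\<in>K. \<forall>v\<in>L. L2_hinner u v = 0) \<and> H = {u + v | u v. u \<in> K \<and> v \<in> L} \<and>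
     (\<forall>g\<in>carrier G. \<forall>u\<in>K. \<forall>v\<in>L. \<rho> g (u + v) = \<sigma> g u + \<tau> g v)"


section \<open>The group \<open>r Spin(3) + \<real>\<^sup>3\<close> and its representations\<close>

definition G3 :: "(real \<times> biquat \<times> (real ^ 3)) monoid" where
  "G3 = \<lparr>carrier = {(r, s, b). r > 0 \<and> s \<in> Spin3},
         mult = (\<lambda>(r, s, b) (r', s', b'). (r * r', s \<star> s', r *\<^sub>R rot s b' + b)),
         one = (1, qone, 0)\<rparr>"

definition nat_rep :: "real \<times> biquat \<times> (real ^ 3) \<Rightarrow> L2q \<Rightarrow> L2q" where
  "nat_rep = (\<lambda>(r, s, b) f.
     L2_class (\<lambda>x. r powr (- (3/2)) *\<^sub>R (s \<star> L2_fun f ((1/r) *\<^sub>R rot (qinv s) (x - b)))))"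

definition tilde_rep :: "real \<times> biquat \<times> (real ^ 3) \<Rightarrow> L2q \<Rightarrow> L2q" where
  "tilde_rep = (\<lambda>(r, s, b) g.
     L2_class (\<lambda>y. exp (\<i> * of_real (2 * pi * (b \<bullet> y))) *s
       (r powr (3/2) *\<^sub>R (s \<star> L2_fun g (r *\<^sub>R rot (qinv s) y)))))"

text \<open>
  In the following, \<open>\<gamma>\<close> is only relevant on the unit sphere; \<open>y /\<^sub>R norm y\<close> is \<open>0\<close> for \<open>y = 0\<close>,
  a null set.
\<close>

definition spin_choice :: "(real ^ 3 \<Rightarrow> biquat) \<Rightarrow> bool" where
  "spin_choice \<gamma> \<longleftrightarrow> \<gamma> \<in> borel_measurable (restrict_space borel (sphere 0 1)) \<and>
     (\<forall>\<omega>\<in>sphere 0 1. \<gamma> \<omega> \<in> Spin3 \<and> \<gamma> \<omega> \<star> e3 \<star> qinv (\<gamma> \<omega>) = qvec \<omega>)"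

definition H_tilde_minus :: "(real ^ 3 \<Rightarrow> biquat) \<Rightarrow> L2q set" where
  "H_tilde_minus \<gamma> = {L2_class (\<lambda>y. \<gamma> (y /\<^sub>R norm y) \<star> (\<alpha> y *s (qone - \<i> *s e3))) | \<alpha>.
     sq_integrable (\<alpha> :: real ^ 3 \<Rightarrow> complex)}"

definition H_tilde_plus :: "(real ^ 3 \<Rightarrow> biquat) \<Rightarrow> L2q set" where
  "H_tilde_plus \<gamma> = {L2_class (\<lambda>y. \<gamma> (y /\<^sub>R norm y) \<star> (\<beta> y *s (e1 + \<i> *s e2))) | \<beta>.
     sq_integrable (\<beta> :: real ^ 3 \<Rightarrow> complex)}"

definition qH_minus :: "(real ^ 3 \<Rightarrow> biquat) \<Rightarrow> L2q set" where
  "qH_minus \<gamma> = fourier ` H_tilde_minus \<gamma>"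

definition qH_plus :: "(real ^ 3 \<Rightarrow> biquat) \<Rightarrow> L2q set" where
  "qH_plus \<gamma> = fourier ` H_tilde_plus \<gamma>"

definition rep_minus :: "(real ^ 3 \<Rightarrow> biquat) \<Rightarrow> real \<times> biquat \<times> (real ^ 3) \<Rightarrow> L2q \<Rightarrow> L2q" where
  "rep_minus \<gamma> g = fourier \<circ> tilde_rep g \<circ> inv_into (H_tilde_minus \<gamma>) fourier"

definition rep_plus :: "(real ^ 3 \<Rightarrow> biquat) \<Rightarrow> real \<times> biquat \<times> (real ^ 3) \<Rightarrow> L2q \<Rightarrow> L2q" where
  "rep_plus \<gamma> g = fourier \<circ> tilde_rep g \<circ> inv_into (H_tilde_plus \<gamma>) fourier"

end

theory Submission
  imports Defs "HOL-Probability.Characteristic_Functions"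
begin

text \<open>
  The Fourier transformation intertwines \<open>tilde_rep\<close> with \<open>nat_rep\<close> (a change of variables on
  integrable functions, extended by density), so everything reduces to the decomposition of
  \<open>L\<^sup>2(\<real>\<^sup>3, S\<^sub>2)\<close> on the Fourier side.  There \<open>H_tilde_minus \<gamma>\<close> and \<open>H_tilde_plus \<gamma>\<close> are the
  eigenspaces, for the eigenvalues \<open>i\<close> and \<open>-i\<close>, of left multiplication by the unit vector \<open>y/\<bar>y\<bar>\<close>; as
  this quaternion squares to \<open>-1\<close>, they are orthogonal and span, and as conjugation by \<open>s\<close> rotates
  \<open>y/\<bar>y\<bar>\<close>, they are invariant.  The Plancherel theorem is obtained by regularising
  \<open>\<integral>\<bar>F f\<bar>\<^sup>2\<close> with Gaussian weights, which turns it into an average of the inner products of \<open>f\<close> with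
  its translates; it converges to \<open>\<parallel>f\<parallel>\<^sup>2\<close> by the strong continuity of \<open>nat_rep\<close>.
\<close>

text \<open>\<open>fourier\<close> is a definite description, so nothing can be said of it before
  existence and uniqueness are settled. Uniqueness is density of the \<open>nice\<close> functions;
  existence is extension of an isometry, defined on the classes of integrable functions, into a
  complete space. Later identities are closed conditions on a class, checked on \<open>nice\<close>
  functions where the transform is an actual integral. The obstacle in Plancherel's theorem is that
  the Fourier integral of an integrable function need not be integrable, so Fubini cannot be applied
  directly to the double integral; the Gaussian weight restores integrability. Unitarity and
  orthogonality are argued with the real inner product, and complex linearity recovers the Hermitian
  one. \<open>tilde_rep (r, s, b)\<close> is multiplication by a phase after
  \<open>nat_rep (1/r, s, 0)\<close>, which gives its measurability and norm. The exponents 3/2 and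
  -3/2 of the two representations differ by the Jacobian of the dilation.\<close>

no_notation convolution (infixr "\<star>" 70)

subsection \<open>Quaternions, rotations and the group\<close>

lemma all_index4: "(\<forall>k::4. P k) \<longleftrightarrow> P 0 \<and> P 1 \<and> P 2 \<and> P 3"
  using exhaust_index4 by metis

lemma scaleR_biquat: "c *\<^sub>R (q :: biquat) = complex_of_real c *s q"
  unfolding vec_eq_iff vector_scaleR_component vector_smult_component
  by (simp add: scaleR_conv_of_real[where 'a=complex])

lemma inner_biquat:
  fixes p q :: biquat
  shows "p \<bullet> q = p$0 \<bullet> q$0 + p$1 \<bullet> q$1 + p$2 \<bullet> q$2 + p$3 \<bullet> q$3"
proof -
  \<comment> \<open>\<open>sum_4\<close> lists the indices as 1, 2, 3, 4, while the coordinates are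
    named from 0.\<close>
  have 4: "(4::4) = 0" by simp
  show ?thesis
    unfolding inner_vec_def sum_4 4 by (simp add: ac_simps)
qed

interpretation qmult: bounded_bilinear qmult
proof -
  have "bilinear qmult"
    unfolding bilinear_def
    by (auto intro!: linearI simp: qmult_bilinear scaleR_biquat)
  then show "bounded_bilinear qmult"
    by (simp add: bilinear_conv_bounded_bilinear)
qed

lemma bounded_linear_smult: "bounded_linear (\<lambda>q. c *s (q :: biquat))"
  by (rule linear_conv_bounded_linear[THEN iffD1], rule linearI)
    (simp_all add: scaleR_biquat vector_add_ldistrib vector_smult_assoc mult.commute)

text \<open>On \<open>Spin3\<close> the denominator in \<open>qinv\<close> is 1, so there this
  linear map can replace \<open>qinv\<close>; unlike a quotient it is visibly continuous and
  measurable on the whole space.\<close>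

definition qconj :: "biquat \<Rightarrow> biquat" where
  "qconj q = q$0 *s qone - q$1 *s e1 - q$2 *s e2 - q$3 *s e3"

lemma qconj_nth [simp]:
  "qconj q $ 0 = q$0" "qconj q $ 1 = - q$1" "qconj q $ 2 = - q$2" "qconj q $ 3 = - q$3"
  by (simp_all add: qconj_def)

lemma Spin3_Im: "s \<in> Spin3 \<Longrightarrow> Im (s$k) = 0"
  by (simp add: Spin3_def complex_is_Real_iff)

lemma qinv_Spin3: "s \<in> Spin3 \<Longrightarrow> qinv s = qconj s"
  by (simp add: qinv_def Spin3_qinv_norm qconj_def)

text \<open>In general the adjoint of multiplication by \<open>s\<close> also conjugates the complex
  coefficients of \<open>s\<close>; for real coordinates only the quaternion conjugate
  remains.\<close>

lemma inner_qmult_left: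
  assumes "\<And>k. Im (s$k) = 0"
  shows "(s \<star> p) \<bullet> q = p \<bullet> (qconj s \<star> q)"
  by (simp add: inner_biquat inner_complex_def assms algebra_simps)

lemma inner_qmult_right:
  assumes "\<And>k. Im (s$k) = 0"
  shows "(p \<star> s) \<bullet> q = p \<bullet> (q \<star> qconj s)"
  by (simp add: inner_biquat inner_complex_def assms algebra_simps)

lemma inner_smult: "(c *s p) \<bullet> q = p \<bullet> (cnj c *s (q :: biquat))"
  by (simp add: inner_biquat inner_complex_def algebra_simps)

lemma norm_smult: "norm (c *s (q :: biquat)) = cmod c * norm q"
proof -
  have "(c *s q) \<bullet> (c *s q) = (cmod c)\<^sup>2 * (q \<bullet> q)"
    unfolding cmod_power2
    by (simp add: inner_biquat inner_complex_def power2_eq_square algebra_simps)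
  then show ?thesis
    by (simp add: norm_eq_sqrt_inner real_sqrt_mult)
qed

lemma inner_Spin3_left: "s \<in> Spin3 \<Longrightarrow> (s \<star> p) \<bullet> (s \<star> q) = p \<bullet> q"
  using Spin3_qinv(2)[of s]
  by (simp add: inner_qmult_left Spin3_Im qmult_assoc[symmetric] qinv_Spin3 qmult_one)

lemma norm_Spin3_left: "s \<in> Spin3 \<Longrightarrow> norm (s \<star> p) = norm p"
  by (simp add: norm_eq_sqrt_inner inner_Spin3_left)

lemma inner_Spin3_right: "s \<in> Spin3 \<Longrightarrow> (p \<star> s) \<bullet> (q \<star> s) = p \<bullet> q"
  using Spin3_qinv(1)[of s]
  by (simp add: inner_qmult_right Spin3_Im qmult_assoc qinv_Spin3 qmult_one)

lemma Spin3_iff: "s \<in> Spin3 \<longleftrightarrow> (\<forall>k. Im (s$k) = 0) \<and> norm s = 1"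
  by (simp add: Spin3_def complex_is_Real_iff)

lemma qone_Spin3: "qone \<in> Spin3"
proof -
  have "\<forall>k. Im (qone $ k) = 0"
    unfolding all_index4 by simp
  moreover have "norm qone = 1"
    by (simp add: norm_eq_sqrt_inner inner_biquat)
  ultimately show ?thesis by (simp add: Spin3_iff)
qed

lemma qmult_Spin3:
  assumes "s \<in> Spin3" "t \<in> Spin3"
  shows "s \<star> t \<in> Spin3"
proof -
  have "\<forall>k. Im ((s \<star> t) $ k) = 0"
    unfolding all_index4 by (simp add: assms[THEN Spin3_Im])
  then show ?thesis
    using assms by (simp add: Spin3_iff norm_Spin3_left)
qed

lemma qinv_in_Spin3:
  assumes "s \<in> Spin3"
  shows "qinv s \<in> Spin3"
proof -
  have "\<forall>k. Im (qconj s $ k) = 0"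
    unfolding all_index4 by (simp add: assms[THEN Spin3_Im])
  moreover have "norm (qconj s) = norm s"
    by (simp add: norm_eq_sqrt_inner inner_biquat)
  ultimately show ?thesis
    using assms by (simp add: Spin3_iff qinv_Spin3)
qed

lemma qinv_qone: "qinv qone = qone"
  by (simp add: qinv_Spin3 qone_Spin3 biquat_eq_iff)

lemma qinv_qinv: "s \<in> Spin3 \<Longrightarrow> qinv (qinv s) = s"
  using qinv_Spin3[OF qinv_in_Spin3[of s]] by (simp add: qinv_Spin3[of s] biquat_eq_iff)

lemma qinv_qmult: "s \<in> Spin3 \<Longrightarrow> t \<in> Spin3 \<Longrightarrow> qinv (s \<star> t) = qinv t \<star> qinv s"
  by (simp add: qinv_Spin3 qmult_Spin3 biquat_eq_iff algebra_simps)

lemma qinv_cancel: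
  "s \<in> Spin3 \<Longrightarrow> qinv s \<star> (s \<star> q) = q" "s \<in> Spin3 \<Longrightarrow> s \<star> (qinv s \<star> q) = q"
  by (simp_all add: qmult_assoc[symmetric] Spin3_qinv qmult_one)

text \<open>The device for identities between rotated vectors: embed both sides by
  \<open>qvec\<close>, where \<open>rot\<close> becomes conjugation, and calculate in the
  algebra.\<close>

lemma qvec_inject: "qvec x = qvec y \<longleftrightarrow> x = y"
  by (auto simp: biquat_eq_iff vec_eq_iff forall_3)

lemma qvec_linear: "qvec (x + y) = qvec x + qvec y" "qvec (c *\<^sub>R x) = c *\<^sub>R qvec x"
  by (simp_all add: qvec_def algebra_simps)

lemma qvec_bounded_linear: "bounded_linear qvec"
  by (rule linear_conv_bounded_linear[THEN iffD1], rule linearI) (simp_all add: qvec_linear)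

lemma inner_qvec: "qvec x \<bullet> qvec y = x \<bullet> y"
  by (simp add: inner_complex_def inner_biquat inner_vec_def sum_3)

lemma norm_qvec: "norm (qvec x) = norm x"
  by (simp add: norm_eq_sqrt_inner inner_qvec)

lemma rot_linear: assumes "s \<in> Spin3"
  shows "rot s (x + y) = rot s x + rot s y" "rot s (c *\<^sub>R x) = c *\<^sub>R rot s x"
  unfolding qvec_inject[symmetric]
  by (simp_all add: qvec_rot assms qvec_linear qmult_bilinear scaleR_biquat)

lemma rot_diff: "s \<in> Spin3 \<Longrightarrow> rot s (x - y) = rot s x - rot s y"
  using rot_linear(1)[of s "x - y" y] by simp

lemma linear_rot: "s \<in> Spin3 \<Longrightarrow> linear (rot s)"
  by (rule linearI) (simp_all add: rot_linear)

lemma inner_rot: assumes "s \<in> Spin3" shows "rot s x \<bullet> rot s y = x \<bullet> y"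
  using assms
  by (simp add: inner_qvec[symmetric] qvec_rot inner_Spin3_left inner_Spin3_right qinv_in_Spin3 qmult_assoc)

lemma norm_rot: "s \<in> Spin3 \<Longrightarrow> norm (rot s x) = norm x"
  by (simp add: norm_eq_sqrt_inner inner_rot)

lemma orthogonal_transformation_rot: "s \<in> Spin3 \<Longrightarrow> orthogonal_transformation (rot s)"
  by (simp add: orthogonal_transformation_def linear_rot inner_rot)

lemma rot_qmult: assumes "s \<in> Spin3" "t \<in> Spin3" shows "rot (s \<star> t) x = rot s (rot t x)"
  unfolding qvec_inject[symmetric]
  by (simp add: qvec_rot assms qmult_Spin3 qinv_qmult qmult_assoc)

lemma rot_qone: "rot qone x = x"
  unfolding qvec_inject[symmetric]
  by (simp add: qvec_rot qone_Spin3 qmult_one qinv_qone)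

lemma rot_qinv: assumes "s \<in> Spin3"
  shows "rot s (rot (qinv s) x) = x" "rot (qinv s) (rot s x) = x"
  using assms
  by (simp_all add: rot_qmult[symmetric] Spin3_qinv qinv_in_Spin3 rot_qone)

lemma tendsto_qinv:
  assumes "(f \<longlongrightarrow> s) F" "\<forall>\<^sub>F x in F. f x \<in> Spin3" "s \<in> Spin3"
  shows "((\<lambda>x. qinv (f x)) \<longlongrightarrow> qinv s) F"
proof -
  have "((\<lambda>x. qconj (f x)) \<longlongrightarrow> qconj s) F"
  proof -
    have "\<forall>i. ((\<lambda>x. qconj (f x) $ i) \<longlongrightarrow> qconj s $ i) F"
      unfolding all_index4 by (auto intro!: tendsto_intros assms)
    then show ?thesis by (auto intro: vec_tendstoI)
  qed
  moreover have "\<forall>\<^sub>F x in F. qconj (f x) = qinv (f x)"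
    using assms(2) by eventually_elim (simp add: qinv_Spin3)
  ultimately show ?thesis
    using assms(3) by (simp add: qinv_Spin3 tendsto_cong)
qed

lemma tendsto_rot:
  assumes "(f \<longlongrightarrow> s) F" "\<forall>\<^sub>F x in F. f x \<in> Spin3" "s \<in> Spin3" "(g \<longlongrightarrow> y) F"
  shows "((\<lambda>x. rot (f x) (g x)) \<longlongrightarrow> rot s y) F"
proof -
  let ?q = "\<lambda>x. f x \<star> qvec (g x) \<star> qinv (f x)"
  have q: "(?q \<longlongrightarrow> s \<star> qvec y \<star> qinv s) F"
    by (intro qmult.tendsto tendsto_qinv bounded_linear.tendsto[OF qvec_bounded_linear] assms)
  show ?thesis
  proof (rule vec_tendstoI)
    have "\<forall>i. ((\<lambda>x. rot (f x) (g x) $ i) \<longlongrightarrow> rot s y $ i) F"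
      unfolding forall_3 rot_def Let_def vector_3 by (intro conjI tendsto_intros q)
    then show "((\<lambda>x. rot (f x) (g x) $ i) \<longlongrightarrow> rot s y $ i) F" for i
      by blast
  qed
qed

lemma group_G3: "group G3"
proof (rule groupI)
  fix x y assume "x \<in> carrier G3" "y \<in> carrier G3"
  then show "x \<otimes>\<^bsub>G3\<^esub> y \<in> carrier G3"
    by (auto simp: G3_def qmult_Spin3)
next
  show "\<one>\<^bsub>G3\<^esub> \<in> carrier G3"
    by (simp add: G3_def qone_Spin3)
next
  fix x y z assume "x \<in> carrier G3" "y \<in> carrier G3" "z \<in> carrier G3"
  then show "x \<otimes>\<^bsub>G3\<^esub> y \<otimes>\<^bsub>G3\<^esub> z = x \<otimes>\<^bsub>G3\<^esub> (y \<otimes>\<^bsub>G3\<^esub> z)"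
    by (auto simp: G3_def qmult_assoc rot_qmult rot_linear algebra_simps)
next
  fix x assume "x \<in> carrier G3"
  then show "\<one>\<^bsub>G3\<^esub> \<otimes>\<^bsub>G3\<^esub> x = x"
    by (auto simp: G3_def qmult_one rot_qone)
next
  fix x assume x: "x \<in> carrier G3"
  then obtain r s b where *: "x = (r, s, b)" "r > 0" "s \<in> Spin3"
    by (auto simp: G3_def)
  \<comment> \<open>The translation part solves
    \<open>(1/r) *\<^sub>R rot (qinv s) b + b' = 0\<close> for \<open>b'\<close>.\<close>
  have "(1 / r, qinv s, - ((1 / r) *\<^sub>R rot (qinv s) b)) \<in> carrier G3"
    "(1 / r, qinv s, - ((1 / r) *\<^sub>R rot (qinv s) b)) \<otimes>\<^bsub>G3\<^esub> x = \<one>\<^bsub>G3\<^esub>"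
    using * by (auto simp: G3_def qinv_in_Spin3 Spin3_qinv)
  then show "\<exists>y\<in>carrier G3. y \<otimes>\<^bsub>G3\<^esub> x = \<one>\<^bsub>G3\<^esub>" by blast
qed

subsection \<open>The Hilbert space of square-integrable functions\<close>

lemma L2_rel_self: "L2_rel f f \<longleftrightarrow> sq_integrable f"
  by (simp add: L2_rel_def)

lemma sq_integrable_measurable: "sq_integrable f \<Longrightarrow> f \<in> borel_measurable borel"
  by (simp add: sq_integrable_def)

lemma sq_integrable_integrable: "sq_integrable f \<Longrightarrow> integrable lborel (\<lambda>x. (norm (f x))\<^sup>2)"
  by (simp add: sq_integrable_def)

lemma L2_class_eqI:
  assumes "sq_integrable f" "sq_integrable g" "AE x in lborel. f x = g x"
  shows "L2_class f = L2_class g"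
  using assms by (intro Quotient3_rel_abs[OF Quotient3_L2]) (simp add: L2_rel_def)

lemma L2_eqI: "(AE x in lborel. L2_fun u x = L2_fun v x) \<Longrightarrow> u = v"
  using L2_class_eqI[of "L2_fun u" "L2_fun v"] by (simp add: sq_integrable_L2_fun L2_class_fun)

lemma L2_cases: obtains f where "sq_integrable f" "u = L2_class f"
  using sq_integrable_L2_fun L2_class_fun by metis

lemma L2_class_add:
  "sq_integrable f \<Longrightarrow> sq_integrable g \<Longrightarrow> L2_class f + L2_class g = L2_class (\<lambda>x. f x + g x)"
  by (simp add: plus_L2.abs_eq L2_rel_self)

lemma L2_class_diff:
  "sq_integrable f \<Longrightarrow> sq_integrable g \<Longrightarrow> L2_class f - L2_class g = L2_class (\<lambda>x. f x - g x)"
  by (simp add: minus_L2.abs_eq L2_rel_self)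

lemma inner_L2_class:
  "sq_integrable f \<Longrightarrow> sq_integrable g \<Longrightarrow> L2_class f \<bullet> L2_class g = (\<integral>x. f x \<bullet> g x \<partial>lborel)"
  by (simp add: inner_L2.abs_eq L2_rel_self)

lemma norm_L2_class: "sq_integrable f \<Longrightarrow> (norm (L2_class f))\<^sup>2 = (\<integral>x. (norm (f x))\<^sup>2 \<partial>lborel)"
  by (simp add: power2_norm_eq_inner inner_L2_class)

lemma inner_L2_fun: "u \<bullet> v = (\<integral>x. L2_fun u x \<bullet> L2_fun v x \<partial>lborel)"
  using inner_L2_class[of "L2_fun u" "L2_fun v"] by (simp add: sq_integrable_L2_fun L2_class_fun)

lemma L2_fun_add: "AE x in lborel. L2_fun (u + v) x = L2_fun u x + L2_fun v x"
  using L2_fun_class[of "\<lambda>x. L2_fun u x + L2_fun v x"]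
  by (simp add: L2_class_add[symmetric] sq_integrable_L2_fun sq_integrable_add L2_class_fun)

lemma L2_fun_zero: "AE x in lborel. L2_fun 0 x = 0"
  using L2_fun_class[of "\<lambda>x. 0"] by (simp add: zero_L2.abs_eq sq_integrable_0)

lemma sq_integrable_bound:
  fixes f :: "'a::euclidean_space \<Rightarrow> 'b::euclidean_space" and g :: "'a \<Rightarrow> 'c::euclidean_space"
  assumes "sq_integrable g" "f \<in> borel_measurable borel"
    and "AE x in lborel. norm (f x) \<le> C * norm (g x)"
  shows "sq_integrable f"
proof -
  have "integrable lborel (\<lambda>x. C\<^sup>2 * (norm (g x))\<^sup>2)"
    using assms by (simp add: sq_integrable_def)
  then have "integrable lborel (\<lambda>x. (norm (f x))\<^sup>2)"
  proof (rule Bochner_Integration.integrable_bound)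
    show "AE x in lborel. norm ((norm (f x))\<^sup>2) \<le> norm (C\<^sup>2 * (norm (g x))\<^sup>2)"
      using assms(3)
    proof eventually_elim
      case (elim x)
      then have "(norm (f x))\<^sup>2 \<le> (C * norm (g x))\<^sup>2"
        by (intro power_mono) auto
      then show ?case by (simp add: power_mult_distrib)
    qed
  qed (use assms(2) in simp)
  with assms(2) show ?thesis by (simp add: sq_integrable_def)
qed

text \<open>The limit inherits the bound by \<open>g\<close>, so \<open>norm (f n x - h x)\<close>
  is at most twice \<open>norm (g x)\<close>; scalar dominated convergence applies to its square
  with the majorant \<open>4 * (norm (g x))\<^sup>2\<close>.\<close>

lemma L2_tendstoI_dominated:
  fixes f :: "nat \<Rightarrow> 'a::euclidean_space \<Rightarrow> 'b::euclidean_space" and g :: "'a \<Rightarrow> 'c::euclidean_space"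
  assumes f: "\<And>n. f n \<in> borel_measurable borel" "h \<in> borel_measurable borel"
    and lim: "AE x in lborel. (\<lambda>n. f n x) \<longlonglongrightarrow> h x"
    and g: "sq_integrable g" and bound: "\<And>n. AE x in lborel. norm (f n x) \<le> norm (g x)"
  shows "sq_integrable h" "(\<lambda>n. L2_class (f n)) \<longlonglongrightarrow> L2_class h"
proof -
  have bounds: "AE x in lborel. \<forall>n. norm (f n x) \<le> norm (g x)"
    using bound by (simp add: AE_all_countable)
  have hbound: "AE x in lborel. norm (h x) \<le> norm (g x)"
    using bounds lim
  proof eventually_elim
    case (elim x)
    then show ?case
      by (intro tendsto_upperbound[OF tendsto_norm]) auto
  qed
  show h: "sq_integrable h"
    by (rule sq_integrable_bound[OF g f(2), of 1]) (use hbound in simp)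
  have fn: "sq_integrable (f n)" for n
    by (rule sq_integrable_bound[OF g f(1), where C = 1]) (use bound in simp)
  have "(\<lambda>n. \<integral>x. (norm (f n x - h x))\<^sup>2 \<partial>lborel) \<longlonglongrightarrow> (\<integral>x. 0 \<partial>(lborel :: 'a measure))"
  proof (rule integral_dominated_convergence[where w = "\<lambda>x. 4 * (norm (g x))\<^sup>2"])
    show "integrable lborel (\<lambda>x. 4 * (norm (g x))\<^sup>2)"
      using g by (simp add: sq_integrable_def)
    show "AE x in lborel. (\<lambda>n. (norm (f n x - h x))\<^sup>2) \<longlonglongrightarrow> 0"
      using lim
    proof eventually_elim
      case (elim x)
      have "(\<lambda>n. (norm (f n x - h x))\<^sup>2) \<longlonglongrightarrow> (norm (h x - h x))\<^sup>2"
        by (intro tendsto_intros elim)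
      then show ?case by simp
    qed
    fix n
    show "AE x in lborel. norm ((norm (f n x - h x))\<^sup>2) \<le> 4 * (norm (g x))\<^sup>2"
      using bounds hbound
    proof eventually_elim
      case (elim x)
      have "norm (f n x - h x) \<le> 2 * norm (g x)"
        using norm_triangle_ineq4[of "f n x" "h x"] elim(1)[rule_format, of n] elim(2) by linarith
      then have "(norm (f n x - h x))\<^sup>2 \<le> (2 * norm (g x))\<^sup>2"
        by (intro power_mono) auto
      then show ?case by (simp add: power_mult_distrib)
    qed
  qed (use f in measurable)
  then have "(\<lambda>n. (norm (L2_class (f n) - L2_class h))\<^sup>2) \<longlonglongrightarrow> 0"
    by (simp add: L2_class_diff fn h norm_L2_class sq_integrable_diff)
  then have "(\<lambda>n. norm (L2_class (f n) - L2_class h)) \<longlonglongrightarrow> 0"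
    by simp
  then show "(\<lambda>n. L2_class (f n)) \<longlonglongrightarrow> L2_class h"
    by (rule LIM_zero_cancel[OF tendsto_norm_zero_cancel])
qed

text \<open>Convergence in norm says that the squared pointwise distances tend to 0 in mean, and
  such a sequence has a subsequence tending to 0 almost everywhere.\<close>

lemma L2_tendsto_AE_subseq:
  fixes X :: "nat \<Rightarrow> ('a::euclidean_space, 'b::euclidean_space) L2"
  assumes "X \<longlonglongrightarrow> u"
  obtains r :: "nat \<Rightarrow> nat" where "strict_mono r"
    "AE x in lborel. (\<lambda>n. L2_fun (X (r n)) x) \<longlonglongrightarrow> L2_fun u x"
proof -
  define d where "d n x = (norm (L2_fun (X n) x - L2_fun u x))\<^sup>2" for n x
  have sq: "sq_integrable (\<lambda>x. L2_fun (X n) x - L2_fun u x)" for n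
    by (intro sq_integrable_diff sq_integrable_L2_fun)
  have "(norm (X n - u))\<^sup>2 = (\<integral>x. d n x \<partial>lborel)" for n
    using norm_L2_class[OF sq[of n]]
    by (simp add: L2_class_diff[symmetric] sq_integrable_L2_fun L2_class_fun d_def)
  moreover have "(\<lambda>n. (norm (X n - u))\<^sup>2) \<longlonglongrightarrow> (norm (u - u))\<^sup>2"
    by (intro tendsto_intros assms)
  ultimately have "(\<lambda>n. \<integral>x. norm (d n x) \<partial>lborel) \<longlonglongrightarrow> 0"
    by (simp add: d_def)
  moreover have "integrable lborel (d n)" for n
    using sq[of n] by (simp add: d_def[abs_def] sq_integrable_def)
  ultimately obtain r :: "nat \<Rightarrow> nat" where r: "strict_mono r" "AE x in lborel. (\<lambda>n. d (r n) x) \<longlonglongrightarrow> 0"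
    using tendsto_L1_AE_subseq[of lborel d] by blast
  show ?thesis
  proof (rule that[OF r(1)])
    show "AE x in lborel. (\<lambda>n. L2_fun (X (r n)) x) \<longlonglongrightarrow> L2_fun u x"
      using r(2)
      by eventually_elim (simp add: d_def LIM_zero_iff tendsto_norm_zero_iff)
  qed
qed

text \<open>Along an almost everywhere convergent subsequence the pointwise condition passes to the
  limit. The set may vary with the point, as it does for \<open>dir_eigen\<close>.\<close>

lemma closed_AE_L2:
  fixes S :: "'a::euclidean_space \<Rightarrow> 'b::euclidean_space set"
  assumes "\<And>x. closed (S x)"
  shows "closed {u. AE x in lborel. L2_fun u x \<in> S x}"
  unfolding closed_sequential_limits
proof (intro allI impI, elim conjE)
  fix X :: "nat \<Rightarrow> ('a, 'b) L2" and u
  assume X: "\<forall>n. X n \<in> {u. AE x in lborel. L2_fun u x \<in> S x}" and "X \<longlonglongrightarrow> u"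
  then obtain r :: "nat \<Rightarrow> nat" where "AE x in lborel. (\<lambda>n. L2_fun (X (r n)) x) \<longlonglongrightarrow> L2_fun u x"
    by (elim L2_tendsto_AE_subseq)
  moreover have "AE x in lborel. \<forall>n. L2_fun (X (r n)) x \<in> S x"
    using X by (simp add: AE_all_countable)
  ultimately have "AE x in lborel. L2_fun u x \<in> S x"
    by eventually_elim (rule closed_sequentially[OF assms], auto)
  then show "u \<in> {u. AE x in lborel. L2_fun u x \<in> S x}" by simp
qed

text \<open>
  Riesz--Fischer: along a subsequence with \<open>\<parallel>X (r (k + 1)) - X (r k)\<parallel> \<le> 2\<^sup>-\<^sup>k\<close> the functions
  converge almost everywhere because \<open>\<Sum>k. 2\<^sup>k \<bar>X (r (k + 1)) - X (r k)\<bar>\<^sup>2\<close> is integrable.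
\<close>

lemma L2_Cauchy_convergent:
  fixes X :: "nat \<Rightarrow> ('a::euclidean_space, 'b::euclidean_space) L2"
  assumes "Cauchy X"
  shows "convergent X"
proof -
  have "\<exists>N. \<forall>m\<ge>N. \<forall>n\<ge>N. norm (X m - X n) < (1/2)^k" for k
    using assms by (intro CauchyD) auto
  then obtain N where N: "\<And>k m n. m \<ge> N k \<Longrightarrow> n \<ge> N k \<Longrightarrow> norm (X m - X n) < (1/2)^k"
    by metis
  \<comment> \<open>A partial sum dominates each of its terms, so \<open>r k\<close> exceeds
    \<open>N j\<close> for every \<open>j \<le> k\<close> although \<open>N\<close> itself need not
    be monotone.\<close>
  define r where "r k = (\<Sum>j\<le>k. N j)" for k
  have rN: "N j \<le> r k" if "j \<le> k" for j k
    using that unfolding r_def by (intro member_le_sum) auto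
  define f where "f n = L2_fun (X n)" for n
  have f: "sq_integrable (f n)" for n
    by (simp add: f_def sq_integrable_L2_fun)
  have [measurable]: "f n \<in> borel_measurable borel" for n
    using f[of n] by (rule sq_integrable_measurable)
  have Xf: "X n = L2_class (f n)" for n
    by (simp add: f_def L2_class_fun)
  have nf: "(\<integral>\<^sup>+x. ennreal ((norm (f m x - f n x))\<^sup>2) \<partial>lborel) = ennreal ((norm (X m - X n))\<^sup>2)" for m n
    using sq_integrable_integrable[OF sq_integrable_diff[OF f[of m] f[of n]]]
    by (simp add: Xf L2_class_diff f norm_L2_class sq_integrable_diff nn_integral_eq_integral)
  define d where "d k x = norm (f (r (Suc k)) x - f (r k) x)" for k x
  have [measurable]: "d k \<in> borel_measurable borel" for k
    unfolding d_def by measurable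
  have "(\<integral>\<^sup>+x. (\<Sum>k. ennreal (2^k * (d k x)\<^sup>2)) \<partial>lborel) = (\<Sum>k. \<integral>\<^sup>+x. ennreal (2^k * (d k x)\<^sup>2) \<partial>lborel)"
    by (rule nn_integral_suminf) simp
  also have "\<dots> \<le> (\<Sum>k. ennreal ((1/2)^k))"
  proof (rule suminf_le)
    fix k
    have "(\<integral>\<^sup>+x. ennreal (2^k * (d k x)\<^sup>2) \<partial>lborel) = ennreal (2^k) * ennreal ((norm (X (r (Suc k)) - X (r k)))\<^sup>2)"
      by (simp add: d_def nf[symmetric] ennreal_mult nn_integral_cmult)
    also have "\<dots> \<le> ennreal (2^k) * ennreal (((1/2)^k)\<^sup>2)"
      using N[of k "r (Suc k)" "r k"] rN[of k k] rN[of k "Suc k"]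
      by (intro mult_left_mono ennreal_leI power_mono) auto
    also have "\<dots> = ennreal ((1/2)^k)"
      by (simp add: ennreal_mult[symmetric] power2_eq_square power_mult_distrib[symmetric] field_simps)
    finally show "(\<integral>\<^sup>+x. ennreal (2^k * (d k x)\<^sup>2) \<partial>lborel) \<le> ennreal ((1/2)^k)" .
  qed auto
  also have "\<dots> = ennreal (\<Sum>k. (1/2)^k)"
    by (intro suminf_ennreal2) auto
  finally have "AE x in lborel. (\<Sum>k. ennreal (2^k * (d k x)\<^sup>2)) \<noteq> \<infinity>"
    by (intro nn_integral_noteq_infinite) (auto simp: top_unique)
  then have conv: "AE x in lborel. convergent (\<lambda>k. f (r k) x)"
  proof eventually_elim
    case (elim x)
    then have s: "summable (\<lambda>k. 2^k * (d k x)\<^sup>2)"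
      by (intro summable_suminf_not_top) auto
    have "summable (\<lambda>k. d k x)"
    proof (rule summable_comparison_test')
      show "summable (\<lambda>k. 2^k * (d k x)\<^sup>2 + (1/2)^k)"
        by (intro summable_add s) auto
      fix k :: nat
      \<comment> \<open>The arithmetic-geometric inequality for \<open>2^k * (d k x)\<^sup>2\<close>
        and \<open>(1/2)^k\<close>, written as a square: it trades the summability of weighted
        squares for that of \<open>d k x\<close>.\<close>
      have "0 \<le> 2^k * (d k x - (1/2)^k)\<^sup>2 + 2^k * (d k x)\<^sup>2 + (1/2)^k"
        by simp
      also have "\<dots> = 2 * (2^k * (d k x)\<^sup>2 + (1/2)^k - d k x)"
        by (simp add: power2_diff algebra_simps power2_eq_square power_one_over)
      finally show "norm (d k x) \<le> 2^k * (d k x)\<^sup>2 + (1/2)^k"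
        by (simp add: d_def)
    qed
    then have "summable (\<lambda>k. f (r (Suc k)) x - f (r k) x)"
      unfolding d_def by (rule summable_norm_cancel)
    then have "convergent (\<lambda>n. f (r n) x - f (r 0) x)"
      by (simp add: summable_iff_convergent sum_lessThan_telescope[of "\<lambda>n. f (r n) x"])
    then show ?case
      using convergent_add[OF _ convergent_const[of "f (r 0) x"]] by fastforce
  qed
  define h where "h x = lim (\<lambda>k. f (r k) x)" for x
  have [measurable]: "h \<in> borel_measurable borel"
    unfolding h_def by (rule borel_measurable_lim_metric) simp
  \<comment> \<open>Fatou's lemma carries the Cauchy estimate to the limit. It yields both the
    square integrability of \<open>h - f m\<close> and the rate of convergence of the whole
    sequence.\<close>
  have fatou: "(\<integral>\<^sup>+x. ennreal ((norm (h x - f m x))\<^sup>2) \<partial>lborel) \<le> ennreal (((1/2)^k)\<^sup>2)"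
    if m: "m \<ge> N k" for m k
  proof -
    have "(\<integral>\<^sup>+x. ennreal ((norm (h x - f m x))\<^sup>2) \<partial>lborel)
        = (\<integral>\<^sup>+x. liminf (\<lambda>n. ennreal ((norm (f (r n) x - f m x))\<^sup>2)) \<partial>lborel)"
    proof (rule nn_integral_cong_AE)
      show "AE x in lborel. ennreal ((norm (h x - f m x))\<^sup>2) = liminf (\<lambda>n. ennreal ((norm (f (r n) x - f m x))\<^sup>2))"
        using conv
      proof eventually_elim
        case (elim x)
        then have "(\<lambda>n. f (r n) x) \<longlonglongrightarrow> h x"
          by (simp add: h_def convergent_LIMSEQ_iff)
        then have "(\<lambda>n. ennreal ((norm (f (r n) x - f m x))\<^sup>2)) \<longlonglongrightarrow> ennreal ((norm (h x - f m x))\<^sup>2)"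
          by (intro tendsto_ennrealI tendsto_intros)
        then show ?case
          by (intro lim_imp_Liminf[symmetric]) auto
      qed
    qed
    also have "\<dots> \<le> liminf (\<lambda>n. \<integral>\<^sup>+x. ennreal ((norm (f (r n) x - f m x))\<^sup>2) \<partial>lborel)"
      by (rule nn_integral_liminf) simp
    also have "\<dots> = liminf (\<lambda>n. ennreal ((norm (X (r n) - X m))\<^sup>2))"
      by (simp add: nf)
    also have "\<dots> \<le> ennreal (((1/2)^k)\<^sup>2)"
    proof (rule Liminf_le)
      show "\<forall>\<^sub>F n in sequentially. ennreal ((norm (X (r n) - X m))\<^sup>2) \<le> ennreal (((1/2)^k)\<^sup>2)"
        using eventually_ge_at_top[of k]
      proof eventually_elim
        case (elim n)
        then show ?case
          using N[of k "r n" m] rN[of k n] m by (intro ennreal_leI power_mono) auto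
      qed
    qed simp
    finally show ?thesis .
  qed
  have sqd: "sq_integrable (\<lambda>x. h x - f m x)" if "m \<ge> N k" for m k
  proof -
    have "integrable lborel (\<lambda>x. (norm (h x - f m x))\<^sup>2)"
      using le_less_trans[OF fatou[OF that] ennreal_less_top]
      by (intro integrableI_nonneg) auto
    then show ?thesis by (simp add: sq_integrable_def)
  qed
  then have h: "sq_integrable h"
    using sq_integrable_add[OF sqd[of 0 "N 0"] f[of "N 0"]] by simp
  have "norm (X m - L2_class h) \<le> (1/2)^k" if m: "m \<ge> N k" for m k
  proof -
    have "ennreal ((norm (L2_class h - X m))\<^sup>2) \<le> ennreal (((1/2)^k)\<^sup>2)"
      using fatou[OF m] sq_integrable_integrable[OF sqd[OF m]]
      by (simp add: Xf L2_class_diff f h norm_L2_class sqd[OF m] nn_integral_eq_integral)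
    then have "(norm (L2_class h - X m))\<^sup>2 \<le> ((1/2)^k)\<^sup>2"
      by (simp add: ennreal_le_iff)
    then show ?thesis
      by (simp add: norm_minus_commute power2_le_iff_abs_le)
  qed
  moreover have "\<exists>k. (1/2)^k < e" if "0 < e" for e :: real
    using that by (intro real_arch_pow_inv) auto
  ultimately have "X \<longlonglongrightarrow> L2_class h"
    by (intro LIMSEQ_I) (meson le_less_trans)
  then show ?thesis by (rule convergentI)
qed

text \<open>Completeness is used to extend the Fourier integral by uniform continuity and to see
  that an isometry maps closed sets to closed sets.\<close>

instance L2 :: (euclidean_space, euclidean_space) complete_space
  by standard (rule L2_Cauchy_convergent)

section \<open>Density of bounded continuous integrable functions\<close>

lemma bounded_support_integrable:
  fixes h :: "'a::euclidean_space \<Rightarrow> 'b::{banach, second_countable_topology}"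
  assumes "h \<in> borel_measurable borel" "\<And>x. norm (h x) \<le> C" "\<And>x. norm x > R \<Longrightarrow> h x = 0"
  shows "integrable lborel h"
proof (rule Bochner_Integration.integrable_bound)
  show "integrable lborel (\<lambda>x. C * indicator (cball (0::'a) R) x :: real)"
    by (intro integrable_mult_right integrable_real_indicator) (use emeasure_bounded_finite[of "cball (0::'a) R"] in auto)
  show "AE x in lborel. norm (h x) \<le> norm (C * indicator (cball (0::'a) R) x :: real)"
    using assms(2,3) order_trans[OF norm_ge_zero assms(2)]
    by (intro AE_I2) (auto simp: indicator_def dist_norm abs_if not_le not_less)
qed (use assms(1) in simp)

lemma bounded_support_sq_integrable:
  fixes h :: "'a::euclidean_space \<Rightarrow> 'b::euclidean_space"
  assumes "h \<in> borel_measurable borel" "\<And>x. norm (h x) \<le> C" "\<And>x. norm x > R \<Longrightarrow> h x = 0"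
  shows "sq_integrable h"
proof -
  have "integrable lborel (\<lambda>x. (norm (h x))\<^sup>2)"
    using assms by (intro bounded_support_integrable[of _ "C\<^sup>2" R]) (auto intro: power_mono)
  then show ?thesis using assms(1) by (simp add: sq_integrable_def)
qed

text \<open>Each condition serves one limit argument: continuity gives pointwise convergence under a
  moving group element, boundedness and integrability a majorant for it, and integrability also
  makes the Fourier integral available.\<close>

definition nice :: "('a::euclidean_space \<Rightarrow> 'b::euclidean_space) \<Rightarrow> bool" where
  "nice f \<longleftrightarrow> continuous_on UNIV f \<and> bounded (range f) \<and> integrable lborel f \<and> sq_integrable f"

text \<open>A measurable function is an almost everywhere limit of continuous ones. Projecting their
  values to a ball and cutting off their support gives \<open>nice\<close> functions with a common
  majorant, without changing the limit.\<close>

lemma closure_nice_bounded: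
  fixes f :: "'a::euclidean_space \<Rightarrow> 'b::euclidean_space"
  assumes f: "f \<in> borel_measurable borel"
    and C: "0 < C" "\<And>x. norm (f x) \<le> C" and R: "\<And>x. norm x > R \<Longrightarrow> f x = 0"
  shows "L2_class f \<in> closure {L2_class g | g. nice g}"
proof -
  have "f \<in> borel_measurable lebesgue"
    using f by (simp add: measurable_completion)
  then have "f measurable_on UNIV"
    by (intro lebesgue_measurable_imp_measurable_on) auto
  then obtain N g where N: "negligible N" and g: "\<And>n. continuous_on UNIV (g n)"
    and lim: "\<And>x. x \<notin> N \<Longrightarrow> (\<lambda>n. g n x) \<longlonglongrightarrow> f x"
    by (auto simp: measurable_on_def)
  define cut where "cut x = max 0 (min 1 (R + 1 - norm x))" for x :: 'a
  define p where "p = closest_point (cball (0::'b) C)"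
  define h where "h n x = cut x *\<^sub>R p (g n x)" for n x
  have p: "continuous_on UNIV p" "norm (p v) \<le> C" "norm v \<le> C \<Longrightarrow> p v = v" for v
    using C(1) closest_point_in_set[of "cball (0::'b) C" v]
    by (auto simp: p_def intro!: continuous_on_closest_point closest_point_self)
  have pg: "continuous_on UNIV (\<lambda>x. p (g n x))" for n
    using continuous_on_compose2[OF p(1) g[of n]] by simp
  have cut: "0 \<le> cut x" "cut x \<le> 1" "norm x > R + 1 \<Longrightarrow> cut x = 0" "norm x \<le> R \<Longrightarrow> cut x = 1" for x
    by (auto simp: cut_def)
  have h_cont: "continuous_on UNIV (h n)" for n
    unfolding h_def cut_def by (intro continuous_intros pg)
  have hle: "norm (h n x) \<le> cut x * C" for n x
    using cut[of x] p(2)[of "g n x"] by (simp add: h_def mult_left_mono)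
  have hC: "norm (h n x) \<le> C" for n x
    using hle[of n x] mult_right_mono[OF cut(2)[of x], of C] C(1) by linarith
  have h0: "norm x > R + 1 \<Longrightarrow> h n x = 0" for n x
    by (simp add: h_def cut)
  have h_meas: "h n \<in> borel_measurable borel" for n
    using h_cont by (rule borel_measurable_continuous_onI)
  have nice: "nice (h n)" for n
    unfolding nice_def
    using h_cont hC bounded_support_integrable[OF h_meas hC h0]
      bounded_support_sq_integrable[OF h_meas hC h0]
    by (auto simp: bounded_iff)
  have "(\<lambda>n. L2_class (h n)) \<longlonglongrightarrow> L2_class f"
  proof (rule L2_tendstoI_dominated)
    have "continuous_on UNIV cut"
      unfolding cut_def by (intro continuous_intros)
    then show "sq_integrable (\<lambda>x. C * cut x)"
      using cut C(1)
      by (intro bounded_support_sq_integrable[of _ C "R + 1"] borel_measurable_continuous_onI continuous_intros)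
         (auto simp: mult_le_cancel_left1)
    show "AE x in lborel. norm (h n x) \<le> norm (C * cut x)" for n
      using hle C(1) cut(1) by (auto simp: mult.commute)
    have "AE x in lebesgue. x \<notin> N"
      using N by (intro AE_not_in) (simp add: negligible_iff_null_sets)
    then have "AE x in lborel. x \<notin> N"
      by (simp add: AE_completion_iff)
    then show "AE x in lborel. (\<lambda>n. h n x) \<longlonglongrightarrow> f x"
    proof eventually_elim
      case (elim x)
      have "(\<lambda>n. p (g n x)) \<longlonglongrightarrow> p (f x)"
        using p(1) lim[OF elim]
        by (intro isCont_tendsto_compose[of _ p]) (simp_all add: continuous_on_eq_continuous_at)
      then have "(\<lambda>n. h n x) \<longlonglongrightarrow> cut x *\<^sub>R p (f x)"
        unfolding h_def by (intro tendsto_intros)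
      \<comment> \<open>Beyond radius \<open>R\<close> both sides vanish, since \<open>p\<close>
        fixes 0; inside, \<open>cut\<close> is 1 and \<open>f x\<close> already lies in the
        ball.\<close>
      also have "cut x *\<^sub>R p (f x) = f x"
        using R[of x] C(2)[of x] p(3)[of "f x"] p(3)[of 0] C(1) cut(4)[of x]
        by (cases "norm x > R") auto
      finally show ?case .
    qed
  qed (use h_meas f in auto)
  then show ?thesis
    using nice by (auto simp: closure_sequential intro!: exI[of _ "\<lambda>n. L2_class (h n)"])
qed

lemma closure_nice: "closure {L2_class g | g :: 'a::euclidean_space \<Rightarrow> 'b::euclidean_space. nice g} = UNIV"
proof -
  let ?D = "{L2_class g | g :: 'a \<Rightarrow> 'b. nice g}"
  have "u \<in> closure ?D" for u
  proof -
    obtain f where f: "sq_integrable f" "u = L2_class f" by (rule L2_cases)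
    have [measurable]: "f \<in> borel_measurable borel" using f by (simp add: sq_integrable_def)
    define t where "t n x = (if norm x \<le> real n \<and> norm (f x) \<le> real n then f x else 0)" for n x
    have t [measurable]: "t n \<in> borel_measurable borel" for n
      unfolding t_def by measurable
    \<comment> \<open>The bound is \<open>real n + 1\<close> because a positive one is required,
      also for \<open>n = 0\<close>.\<close>
    have tn: "L2_class (t n) \<in> closure ?D" for n
      by (rule closure_nice_bounded[of _ "real n + 1" "real n"]) (auto simp: t_def)
    have "(\<lambda>n. L2_class (t n)) \<longlonglongrightarrow> L2_class f"
    proof (rule L2_tendstoI_dominated[OF t _ _ f(1)])
      show "AE x in lborel. (\<lambda>n. t n x) \<longlonglongrightarrow> f x"
      proof (rule AE_I2, rule tendsto_eventually)
        fix x
        obtain m :: nat where "norm x + norm (f x) \<le> real m"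
          using real_arch_simple by blast
        then have "t n x = f x" if "n \<ge> m" for n
        proof -
          have "norm x \<le> real n \<and> norm (f x) \<le> real n"
            using that \<open>norm x + norm (f x) \<le> real m\<close> norm_ge_zero[of x] norm_ge_zero[of "f x"]
            by linarith
          then show ?thesis by (simp add: t_def)
        qed
        then show "\<forall>\<^sub>F n in sequentially. t n x = f x"
          by (auto simp: eventually_sequentially)
      qed
    qed (auto simp: t_def)
    then show ?thesis
      using tn closed_sequentially[OF closed_closure, of "\<lambda>n. L2_class (t n)" ?D] f(2) by simp
  qed
  then show ?thesis by blast
qed

text \<open>Density packaged as an induction rule: a closed property of classes, such as equality of
  two continuous maps, need only be verified on \<open>nice\<close> functions.\<close>

lemma L2_dense_induct [case_names closed nice]:
  fixes u :: "('a::euclidean_space, 'b::euclidean_space) L2"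
  assumes "closed {u. P u}" "\<And>g. nice g \<Longrightarrow> P (L2_class g)"
  shows "P u"
proof -
  have "closure {L2_class g | g :: 'a \<Rightarrow> 'b. nice g} \<subseteq> {u. P u}"
    using assms by (intro closure_minimal) auto
  then show ?thesis by (auto simp: closure_nice)
qed

subsection \<open>Similarities of \<open>\<real>\<^sup>3\<close>\<close>

lemma borel_measurable_rot [measurable]: "s \<in> Spin3 \<Longrightarrow> rot s \<in> borel_measurable borel"
  by (intro borel_measurable_continuous_onI linear_continuous_on) (simp add: linear_conv_bounded_linear[symmetric] linear_rot)

text \<open>It suffices to measure boxes. The preimage of a box under \<open>rot s\<close> is its
  image under the inverse rotation, and orthogonal maps preserve the measure of such images.\<close>

lemma distr_rot:
  assumes s: "s \<in> Spin3"
  shows "distr lborel borel (rot s) = lborel"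
proof (rule lborel_eqI[symmetric])
  have [measurable]: "rot s \<in> borel_measurable borel"
    using s by (rule borel_measurable_rot)
  fix l u :: "real ^ 3" assume le: "\<And>b. b \<in> Basis \<Longrightarrow> l \<bullet> b \<le> u \<bullet> b"
  have im: "rot s -` box l u = rot (qinv s) ` box l u"
    using s by (force simp: rot_qinv intro!: image_eqI[where x = "rot s _"])
  have lm: "rot (qinv s) ` box l u \<in> lmeasurable"
    by (intro measurable_orthogonal_image orthogonal_transformation_rot qinv_in_Spin3 s lmeasurable_box)
  have "emeasure (distr lborel borel (rot s)) (box l u) = emeasure lborel (rot s -` box l u)"
    by (subst emeasure_distr) auto
  also have "\<dots> = emeasure lebesgue (rot s -` box l u)"
    using measurable_sets[OF borel_measurable_rot[OF s], of "box l u"] by simp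
  also have "\<dots> = ennreal (measure lebesgue (rot (qinv s) ` box l u))"
    unfolding im using lm by (simp add: emeasure_eq_measure2)
  also have "measure lebesgue (rot (qinv s) ` box l u) = measure lebesgue (box l u)"
    by (intro measure_orthogonal_image orthogonal_transformation_rot qinv_in_Spin3 s lmeasurable_box)
  also have "\<dots> = (\<Prod>b\<in>Basis. (u - l) \<bullet> b)"
    using le by (simp add: measure_lborel_box_eq)
  finally show "emeasure (distr lborel borel (rot s)) (box l u) = ennreal (\<Prod>b\<in>Basis. (u - l) \<bullet> b)" .
qed simp

text \<open>The inverse of the map by which \<open>(r, s, b)\<close> acts on space, \<open>x\<close>
  to \<open>r *\<^sub>R rot s x + b\<close>. \<open>nat_rep\<close> composes with it;
  \<open>tilde_rep\<close> composes with \<open>simil (1/r) s 0\<close>.\<close>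

definition simil :: "real \<Rightarrow> biquat \<Rightarrow> real ^ 3 \<Rightarrow> real ^ 3 \<Rightarrow> real ^ 3" where
  "simil r s b x = (1/r) *\<^sub>R rot (qinv s) (x - b)"

lemma borel_measurable_simil [measurable]: "s \<in> Spin3 \<Longrightarrow> simil r s b \<in> borel_measurable borel"
  using borel_measurable_rot[OF qinv_in_Spin3, of s] unfolding simil_def by measurable

text \<open>\<open>simil\<close> contracts lengths by \<open>r\<close>, so a preimage has
  \<open>r^3\<close> times the volume of the set; the density compensates for this.\<close>

lemma lborel_simil:
  assumes r: "r > 0" and s: "s \<in> Spin3"
  shows "density (distr lborel borel (simil r s b)) (\<lambda>_. ennreal (1 / r^3)) = lborel"
proof -
  let ?t = "- ((1/r) *\<^sub>R rot (qinv s) b)"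
  have s': "qinv s \<in> Spin3" using s by (rule qinv_in_Spin3)
  have "simil r s b = (\<lambda>x. ?t + (1/r) *\<^sub>R x) \<circ> rot (qinv s)"
    by (auto simp: simil_def fun_eq_iff rot_diff[OF s'] algebra_simps)
  then have "distr lborel borel (simil r s b)
      = distr (distr lborel borel (rot (qinv s))) borel (\<lambda>x. ?t + (1/r) *\<^sub>R x)"
    using borel_measurable_rot[OF s'] by (subst distr_distr) auto
  also have "\<dots> = distr lborel borel (\<lambda>x. ?t + (1/r) *\<^sub>R x)"
    by (simp add: distr_rot s')
  finally show ?thesis
    using lborel_affine[of "1/r" ?t] r by (simp add: power_divide)
qed

text \<open>Similarities respect null sets, so both actions are independent of the representative of
  a class.\<close>

lemma AE_simil:
  assumes "r > 0" "s \<in> Spin3" "AE x in lborel. P x"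
  shows "AE x in lborel. P (simil r s b x)"
proof -
  have "AE x in density (distr lborel borel (simil r s b)) (\<lambda>_. ennreal (1 / r^3)). P x"
    unfolding lborel_simil[OF assms(1,2)] by (rule assms(3))
  then have "AE x in distr lborel borel (simil r s b). P x"
    using assms(1) by (simp add: AE_density)
  moreover have "simil r s b \<in> measurable lborel borel"
    using borel_measurable_simil[OF assms(2)] by simp
  ultimately show ?thesis
    by (rule AE_distrD[rotated])
qed

lemma
  fixes f :: "real ^ 3 \<Rightarrow> 'a::{banach, second_countable_topology}"
  assumes r: "r > 0" and s: "s \<in> Spin3" and f [measurable]: "f \<in> borel_measurable borel"
  shows integrable_simil: "integrable lborel (\<lambda>x. f (simil r s b x)) \<longleftrightarrow> integrable lborel f"
    and integral_simil: "(\<integral>x. f (simil r s b x) \<partial>lborel) = r^3 *\<^sub>R (\<integral>x. f x \<partial>lborel)"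
proof -
  let ?D = "distr lborel borel (simil r s b)"
  have [measurable]: "simil r s b \<in> borel_measurable borel"
    using s by (rule borel_measurable_simil)
  have D: "integrable ?D f \<longleftrightarrow> integrable lborel (\<lambda>x. f (simil r s b x))"
    by (rule integrable_distr_eq) auto
  have "integrable lborel f \<longleftrightarrow> integrable ?D (\<lambda>x. (1 / r^3) *\<^sub>R f x)"
    using r by (subst lborel_simil[OF r s, of b, symmetric], subst integrable_density) auto
  also have "\<dots> \<longleftrightarrow> integrable ?D f"
    using r integrable_scaleR_right[of "r^3" ?D "\<lambda>x. (1 / r^3) *\<^sub>R f x"] by auto
  finally show "integrable lborel (\<lambda>x. f (simil r s b x)) \<longleftrightarrow> integrable lborel f"
    using D by simp
  have "(\<integral>x. f x \<partial>lborel) = (\<integral>x. (1 / r^3) *\<^sub>R f x \<partial>?D)"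
    using r by (subst lborel_simil[OF r s, of b, symmetric], subst integral_density) auto
  also have "\<dots> = (1 / r^3) *\<^sub>R (\<integral>x. f x \<partial>?D)"
    by simp
  also have "(\<integral>x. f x \<partial>?D) = (\<integral>x. f (simil r s b x) \<partial>lborel)"
    by (rule integral_distr) auto
  finally show "(\<integral>x. f (simil r s b x) \<partial>lborel) = r^3 *\<^sub>R (\<integral>x. f x \<partial>lborel)"
    using r by simp
qed

subsection \<open>Complex structure and isometries of \<open>L\<^sup>2\<close>\<close>

interpretation smult: bounded_bilinear "(*s) :: complex \<Rightarrow> biquat \<Rightarrow> biquat"
proof -
  have "bilinear ((*s) :: complex \<Rightarrow> biquat \<Rightarrow> biquat)"
    unfolding bilinear_def
    by (auto intro!: linearI
        simp: scaleR_biquat vector_add_ldistrib vector_sadd_rdistrib vector_smult_assoc scaleR_conv_of_real mult.commute)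
  then show "bounded_bilinear ((*s) :: complex \<Rightarrow> biquat \<Rightarrow> biquat)"
    by (simp add: bilinear_conv_bounded_bilinear)
qed

lemma borel_measurable_smult [measurable (raw)]:
  fixes f :: "'a \<Rightarrow> complex" and g :: "'a \<Rightarrow> biquat"
  assumes "f \<in> borel_measurable M" "g \<in> borel_measurable M"
  shows "(\<lambda>x. f x *s g x) \<in> borel_measurable M"
  by (rule borel_measurable_continuous_Pair[OF assms]) (intro smult.continuous_on continuous_intros)

lemma borel_measurable_qmult [measurable (raw)]:
  assumes "f \<in> borel_measurable M" "g \<in> borel_measurable M"
  shows "(\<lambda>x. f x \<star> g x) \<in> borel_measurable M"
  by (rule borel_measurable_continuous_Pair[OF assms]) (intro qmult.continuous_on continuous_intros)

lemma sq_integrable_smult: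
  fixes f :: "real ^ 3 \<Rightarrow> biquat"
  shows "sq_integrable f \<Longrightarrow> sq_integrable (\<lambda>x. c *s f x)"
  by (rule sq_integrable_bound[of f _ "cmod c"])
    (auto simp: sq_integrable_def norm_smult)

lemma L2_scale_class:
  assumes "sq_integrable f"
  shows "L2_scale c (L2_class f) = L2_class (\<lambda>x. c *s f x)"
  unfolding L2_scale_def
proof (rule L2_class_eqI)
  show "AE x in lborel. c *s L2_fun (L2_class f) x = c *s f x"
    using L2_fun_class[OF assms] by eventually_elim simp
qed (intro sq_integrable_smult sq_integrable_L2_fun assms)+

lemma L2_fun_scale: "AE x in lborel. L2_fun (L2_scale c u) x = c *s L2_fun u x"
  unfolding L2_scale_def by (intro L2_fun_class sq_integrable_smult sq_integrable_L2_fun)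

lemma L2_scale_add: "L2_scale c (u + v) = L2_scale c u + L2_scale c v"
proof -
  obtain f g where "sq_integrable f" "u = L2_class f" "sq_integrable g" "v = L2_class g"
    by (metis L2_cases)
  then show ?thesis
    by (simp add: L2_scale_class L2_class_add sq_integrable_smult sq_integrable_add vector_add_ldistrib)
qed

lemma norm_L2_scale: "norm (L2_scale c u) = cmod c * norm u"
proof -
  obtain f where f: "sq_integrable f" "u = L2_class f"
    by (metis L2_cases)
  then have "(norm (L2_scale c u))\<^sup>2 = (cmod c * norm u)\<^sup>2"
    by (simp add: L2_scale_class norm_L2_class sq_integrable_smult norm_smult power_mult_distrib)
  then show ?thesis
    by (metis abs_norm_cancel abs_mult power2_eq_iff_nonneg norm_ge_zero mult_nonneg_nonneg)
qed

text \<open>The imaginary part of \<open>z * cnj w\<close> is the real part of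
  \<open>z * cnj (\<i> * w)\<close>. Hence a complex linear map that preserves the real inner
  product preserves the Hermitian one.\<close>

lemma L2_hinner_eq: "L2_hinner u v = Complex (u \<bullet> v) (u \<bullet> L2_scale \<i> v)"
proof -
  obtain g where g: "sq_integrable g" "v = L2_class g" by (rule L2_cases)
  define f where "f = L2_fun u"
  have f: "sq_integrable f" "u = L2_class f"
    by (simp_all add: f_def sq_integrable_L2_fun L2_class_fun)
  have *: "(\<Sum>k\<in>UNIV. p $ k * cnj (q $ k)) = of_real (p \<bullet> q) + \<i> * of_real (p \<bullet> (\<i> *s q))" for p q :: biquat
  proof -
    have 4: "(4::4) = 0" by simp
    show ?thesis
      unfolding inner_biquat sum_4 4 by (simp add: complex_eq_iff inner_complex_def algebra_simps)
  qed
  have "L2_hinner u v = (\<integral>x. of_real (f x \<bullet> L2_fun v x) + \<i> * of_real (f x \<bullet> (\<i> *s L2_fun v x)) \<partial>lborel)"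
    unfolding L2_hinner_def * f_def ..
  also have "\<dots> = of_real (\<integral>x. f x \<bullet> L2_fun v x \<partial>lborel) + \<i> * of_real (\<integral>x. f x \<bullet> (\<i> *s L2_fun v x) \<partial>lborel)"
    by (subst Bochner_Integration.integral_add)
      (auto intro!: integrable_inner_sq_integrable sq_integrable_L2_fun sq_integrable_smult f)
  also have "(\<integral>x. f x \<bullet> L2_fun v x \<partial>lborel) = u \<bullet> v"
    by (simp add: f_def inner_L2_fun)
  also have "(\<integral>x. f x \<bullet> (\<i> *s L2_fun v x) \<partial>lborel) = u \<bullet> L2_scale \<i> v"
    by (simp add: f L2_scale_def inner_L2_class sq_integrable_smult sq_integrable_L2_fun)
  finally show ?thesis
    by (simp add: complex_eq_iff)
qed

definition cisometry :: "(L2q \<Rightarrow> L2q) \<Rightarrow> bool" where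
  "cisometry U \<longleftrightarrow> (\<forall>u v. U (u + v) = U u + U v) \<and> (\<forall>c u. U (L2_scale c u) = L2_scale c (U u)) \<and>
     (\<forall>u v. U u \<bullet> U v = u \<bullet> v)"

lemma cisometryD:
  assumes "cisometry U"
  shows "U (u + v) = U u + U v" "U (L2_scale c u) = L2_scale c (U u)" "U u \<bullet> U v = u \<bullet> v"
    and "L2_hinner (U u) (U v) = L2_hinner u v"
    and "U (u - v) = U u - U v" "norm (U u) = norm u" "dist (U u) (U v) = dist u v"
    and "continuous_on A U" "inj U" "U 0 = 0"
proof -
  show add: "U (u + v) = U u + U v" and scale: "U (L2_scale c u) = L2_scale c (U u)"
    and inner: "U u \<bullet> U v = u \<bullet> v" for u v c
    using assms unfolding cisometry_def by blast+
  show "L2_hinner (U u) (U v) = L2_hinner u v"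
    by (simp add: L2_hinner_eq inner scale[symmetric])
  show diff: "U (u - v) = U u - U v" for u v
    using add[of "u - v" v] by simp
  show norm: "norm (U u) = norm u" for u
    by (simp add: norm_eq_sqrt_inner inner)
  show dist: "dist (U u) (U v) = dist u v" for u v
    by (simp add: dist_norm diff[symmetric] norm)
  show "continuous_on A U"
    by (auto simp: continuous_on_iff dist)
  show "inj U"
    by (rule injI) (metis dist dist_eq_0_iff)
  show "U 0 = 0"
    using diff[of 0 0] by simp
qed

subsection \<open>The natural representation\<close>

text \<open>The action on functions instead of classes, where it can be evaluated at points;
  \<open>nat_rep_class\<close> transfers the results.\<close>

definition nat_fun :: "real \<Rightarrow> biquat \<Rightarrow> real ^ 3 \<Rightarrow> (real ^ 3 \<Rightarrow> biquat) \<Rightarrow> real ^ 3 \<Rightarrow> biquat" where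
  "nat_fun r s b f x = r powr (- (3/2)) *\<^sub>R (s \<star> f (simil r s b x))"

context
  fixes r s assumes r: "r > (0::real)" and s: "s \<in> Spin3"
begin

lemma borel_measurable_nat_fun [measurable]:
  assumes [measurable]: "f \<in> borel_measurable borel"
  shows "nat_fun r s b f \<in> borel_measurable borel"
  unfolding nat_fun_def[abs_def] using borel_measurable_simil[OF s, of r b] by measurable

lemma inner_nat_fun:
  "nat_fun r s b f x \<bullet> nat_fun r s b g x = r powr (- 3) * (f (simil r s b x) \<bullet> g (simil r s b x))"
  by (simp add: nat_fun_def inner_Spin3_left s powr_add[symmetric])

lemma norm_nat_fun: "norm (nat_fun r s b f x) = r powr (- (3/2)) * norm (f (simil r s b x))"
  by (simp add: nat_fun_def norm_Spin3_left s)

lemma integrable_nat_fun: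
  assumes "integrable lborel f"
  shows "integrable lborel (nat_fun r s b f)"
proof -
  have "integrable lborel (\<lambda>x. f (simil r s b x))"
    using assms by (subst integrable_simil[OF r s]) auto
  then show ?thesis
    unfolding nat_fun_def[abs_def]
    by (intro integrable_scaleR_right integrable_bounded_linear[OF qmult.bounded_linear_right])
qed

lemma sq_integrable_nat_fun:
  assumes "sq_integrable f"
  shows "sq_integrable (nat_fun r s b f)"
proof -
  have "integrable lborel (\<lambda>x. (norm (f (simil r s b x)))\<^sup>2)"
    using assms by (subst integrable_simil[OF r s, of "\<lambda>x. (norm (f x))\<^sup>2"]) (auto simp: sq_integrable_def)
  then show ?thesis
    using borel_measurable_nat_fun[OF sq_integrable_measurable[OF assms], of b]
    by (simp add: sq_integrable_def norm_nat_fun power_mult_distrib)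
qed

lemma nat_rep_class:
  assumes f: "sq_integrable f"
  shows "nat_rep (r, s, b) (L2_class f) = L2_class (nat_fun r s b f)"
proof -
  have "nat_rep (r, s, b) (L2_class f) = L2_class (nat_fun r s b (L2_fun (L2_class f)))"
    by (simp add: nat_rep_def nat_fun_def[abs_def] simil_def)
  also have "\<dots> = L2_class (nat_fun r s b f)"
  proof (rule L2_class_eqI)
    show "AE x in lborel. nat_fun r s b (L2_fun (L2_class f)) x = nat_fun r s b f x"
      using AE_simil[OF r s L2_fun_class[OF f], of b] by eventually_elim (simp add: nat_fun_def)
  qed (intro sq_integrable_nat_fun sq_integrable_L2_fun f)+
  finally show ?thesis .
qed

lemma cisometry_nat_rep: "cisometry (nat_rep (r, s, b))"
  unfolding cisometry_def
proof (intro conjI allI)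
  fix u v :: L2q and c :: complex
  obtain f where f: "sq_integrable f" "u = L2_class f" by (rule L2_cases)
  obtain g where g: "sq_integrable g" "v = L2_class g" by (rule L2_cases)
  have "nat_fun r s b (\<lambda>x. f x + g x) = (\<lambda>x. nat_fun r s b f x + nat_fun r s b g x)"
    by (simp add: nat_fun_def[abs_def] qmult.add_right scaleR_add_right)
  then show "nat_rep (r, s, b) (u + v) = nat_rep (r, s, b) u + nat_rep (r, s, b) v"
    by (simp add: f g L2_class_add nat_rep_class sq_integrable_add sq_integrable_nat_fun)
  have "nat_fun r s b (\<lambda>x. c *s f x) = (\<lambda>x. c *s nat_fun r s b f x)"
    by (simp add: nat_fun_def[abs_def] qmult_bilinear scaleR_biquat vector_smult_assoc mult.commute)
  then show "nat_rep (r, s, b) (L2_scale c u) = L2_scale c (nat_rep (r, s, b) u)"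
    by (simp add: f L2_scale_class nat_rep_class sq_integrable_smult sq_integrable_nat_fun)
  have "(\<integral>x. f (simil r s b x) \<bullet> g (simil r s b x) \<partial>lborel) = r ^ 3 *\<^sub>R (\<integral>x. f x \<bullet> g x \<partial>lborel)"
    by (rule integral_simil[OF r s, of "\<lambda>x. f x \<bullet> g x"])
      (use f g in \<open>auto simp: sq_integrable_def\<close>)
  \<comment> \<open>The two factors \<open>r powr (- (3/2))\<close> in the inner product cancel the
    Jacobian \<open>r^3\<close>.\<close>
  moreover have "r powr (- 3) * r ^ 3 = 1"
    using r by (simp add: powr_minus powr_numeral)
  ultimately show "nat_rep (r, s, b) u \<bullet> nat_rep (r, s, b) v = u \<bullet> v"
    by (simp add: f g nat_rep_class inner_L2_class sq_integrable_nat_fun inner_nat_fun mult.assoc[symmetric])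
qed

end

text \<open>The product in the group is composition of the motions of space, and
  \<open>simil\<close> is the inverse motion, so the similarities compose in the opposite order, as
  precomposition demands.\<close>

lemma nat_rep_mult:
  assumes "r > 0" "s \<in> Spin3" "r' > 0" "s' \<in> Spin3"
  shows "nat_rep (r * r', s \<star> s', r *\<^sub>R rot s b' + b) u = nat_rep (r, s, b) (nat_rep (r', s', b') u)"
proof -
  obtain f where f: "sq_integrable f" "u = L2_class f" by (rule L2_cases)
  have "simil (r * r') (s \<star> s') (r *\<^sub>R rot s b' + b) x = simil r' s' b' (simil r s b x)" for x
    using assms
    by (simp add: simil_def qinv_qmult rot_qmult qinv_in_Spin3 rot_linear rot_diff rot_qinv algebra_simps)
  then have "nat_fun (r * r') (s \<star> s') (r *\<^sub>R rot s b' + b) f = nat_fun r s b (nat_fun r' s' b' f)"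
    using assms
    by (simp add: nat_fun_def[abs_def] powr_mult qmult.scaleR_right qmult_assoc mult.commute)
  then show ?thesis
    using assms by (simp add: f nat_rep_class sq_integrable_nat_fun qmult_Spin3)
qed

lemma nat_rep_mult_G3:
  "g \<in> carrier G3 \<Longrightarrow> h \<in> carrier G3 \<Longrightarrow> nat_rep (g \<otimes>\<^bsub>G3\<^esub> h) u = nat_rep g (nat_rep h u)"
  by (auto simp: G3_def nat_rep_mult)

lemma nat_rep_one: "nat_rep \<one>\<^bsub>G3\<^esub> u = u"
proof -
  obtain f where f: "sq_integrable f" "u = L2_class f" by (rule L2_cases)
  have "nat_fun 1 qone 0 f = f"
    by (simp add: nat_fun_def[abs_def] simil_def rot_qone qinv_qone qmult_one)
  then show ?thesis
    by (simp add: f G3_def nat_rep_class qone_Spin3)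
qed

lemma cisometry_nat_rep_G3: "g \<in> carrier G3 \<Longrightarrow> cisometry (nat_rep g)"
  by (auto simp: G3_def cisometry_nat_rep)

lemma nat_rep_inv:
  assumes "g \<in> carrier G3"
  shows "nat_rep g (nat_rep (inv\<^bsub>G3\<^esub> g) u) = u"
  using assms group_G3
  by (simp add: nat_rep_mult_G3[symmetric] group.inv_closed group.r_inv nat_rep_one)

lemma tendsto_nat_fun:
  assumes "continuous_on UNIV f" "(\<lambda>n. r n) \<longlonglongrightarrow> r0" "(\<lambda>n. s n) \<longlonglongrightarrow> s0" "(\<lambda>n. b n) \<longlonglongrightarrow> b0"
    and "\<And>n. s n \<in> Spin3" "r0 > 0" "s0 \<in> Spin3"
  shows "(\<lambda>n. nat_fun (r n) (s n) (b n) f x) \<longlonglongrightarrow> nat_fun r0 s0 b0 f x"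
proof -
  have "(\<lambda>n. simil (r n) (s n) (b n) x) \<longlonglongrightarrow> simil r0 s0 b0 x"
    unfolding simil_def
    using assms by (intro tendsto_intros tendsto_rot tendsto_qinv) (auto simp: qinv_in_Spin3)
  then have "(\<lambda>n. f (simil (r n) (s n) (b n) x)) \<longlonglongrightarrow> f (simil r0 s0 b0 x)"
    using assms(1) by (intro isCont_tendsto_compose[of _ f]) (simp_all add: continuous_on_eq_continuous_at)
  then show ?thesis
    unfolding nat_fun_def using assms by (intro tendsto_intros qmult.tendsto) auto
qed

text \<open>All operators are isometric, so convergence of vectors makes the orbit maps converge
  uniformly, and the property is closed. For a \<open>nice\<close> vector, convergence of the inner
  products suffices because the norms are constant.\<close>

lemma continuous_nat_rep: "continuous_on (carrier G3) (\<lambda>g. nat_rep g u)"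
proof (induction u rule: L2_dense_induct)
  case closed
  show ?case
    unfolding closed_sequential_limits
  proof (intro allI impI, elim conjE)
    fix X :: "nat \<Rightarrow> L2q" and u
    assume X: "\<forall>n. X n \<in> {u. continuous_on (carrier G3) (\<lambda>g. nat_rep g u)}" and "X \<longlonglongrightarrow> u"
    have "uniform_limit (carrier G3) (\<lambda>n g. nat_rep g (X n)) (\<lambda>g. nat_rep g u) sequentially"
    proof (rule uniform_limitI)
      fix e :: real assume "0 < e"
      then have "\<forall>\<^sub>F n in sequentially. dist (X n) u < e"
        using \<open>X \<longlonglongrightarrow> u\<close> by (simp add: tendsto_iff)
      then show "\<forall>\<^sub>F n in sequentially. \<forall>g\<in>carrier G3. dist (nat_rep g (X n)) (nat_rep g u) < e"
        by eventually_elim (simp add: cisometryD(7)[OF cisometry_nat_rep_G3])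
    qed
    then show "u \<in> {u. continuous_on (carrier G3) (\<lambda>g. nat_rep g u)}"
      using X by (auto intro!: uniform_limit_theorem[OF _ _ sequentially_bot])
  qed
next
  case (nice f)
  then have f: "continuous_on UNIV f" "bounded (range f)" "integrable lborel f" "sq_integrable f"
    by (auto simp: nice_def)
  obtain B where B: "\<And>x. norm (f x) \<le> B"
    using f(2) by (auto simp: bounded_iff)
  let ?u = "L2_class f"
  show ?case
  proof (rule continuous_on_sequentiallyI)
    fix G g0 assume G: "\<forall>n. G n \<in> carrier G3" "g0 \<in> carrier G3" and lim: "G \<longlonglongrightarrow> g0"
    define r s b where "r n = fst (G n)" and "s n = fst (snd (G n))" and "b n = snd (snd (G n))" for n
    obtain r0 s0 b0 where g0: "g0 = (r0, s0, b0)" by (cases g0)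
    have Gn: "G n = (r n, s n, b n)" for n
      by (simp add: r_def s_def b_def)
    have r: "r n > 0" "s n \<in> Spin3" "r0 > 0" "s0 \<in> Spin3" for n
      using G(1)[rule_format, of n] G(2) by (auto simp: Gn g0 G3_def)
    have lims: "r \<longlonglongrightarrow> r0" "s \<longlonglongrightarrow> s0" "b \<longlonglongrightarrow> b0"
      using tendsto_fst[OF lim] tendsto_fst[OF tendsto_snd[OF lim]] tendsto_snd[OF tendsto_snd[OF lim]]
      by (simp_all add: r_def[abs_def] s_def[abs_def] b_def[abs_def] g0)
    define F where "F n = nat_fun (r n) (s n) (b n) f" for n
    define F0 where "F0 = nat_fun r0 s0 b0 f"
    have sq: "sq_integrable (F n)" "sq_integrable F0" for n
      using r f by (auto simp: F_def F0_def intro: sq_integrable_nat_fun)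
    have "(\<lambda>n. r n powr (- (3/2))) \<longlonglongrightarrow> r0 powr (- (3/2))"
      using lims r by (intro tendsto_intros) auto
    from convergent_imp_bounded[OF this] obtain K where K: "\<And>n. norm (r n powr (- (3/2))) \<le> K"
      by (auto simp: bounded_iff)
    \<comment> \<open>Testing against the fixed integrable function \<open>F0\<close> allows a
      majorant from the uniform bound \<open>K * B\<close> on \<open>F n\<close>; a common
      square-integrable bound for the moving functions is avoided.\<close>
    have "(\<lambda>n. \<integral>x. F n x \<bullet> F0 x \<partial>lborel) \<longlonglongrightarrow> (\<integral>x. F0 x \<bullet> F0 x \<partial>lborel)"
    proof (rule integral_dominated_convergence[where w = "\<lambda>x. K * B * norm (F0 x)"])
      show "integrable lborel (\<lambda>x. K * B * norm (F0 x))"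
        unfolding F0_def using r f by (intro integrable_mult_right integrable_norm integrable_nat_fun) auto
      show "AE x in lborel. (\<lambda>n. F n x \<bullet> F0 x) \<longlonglongrightarrow> F0 x \<bullet> F0 x"
        unfolding F_def F0_def by (intro AE_I2 tendsto_inner tendsto_nat_fun tendsto_const f lims r)
      fix n
      show "AE x in lborel. norm (F n x \<bullet> F0 x) \<le> K * B * norm (F0 x)"
      proof (rule AE_I2)
        fix x
        have "norm (F n x) \<le> K * B"
          using K[of n] B[of "simil (r n) (s n) (b n) x"]
          by (auto simp: F_def norm_nat_fun r intro!: mult_mono')
        then have "norm (F n x) * norm (F0 x) \<le> K * B * norm (F0 x)"
          by (rule mult_right_mono) simp
        then show "norm (F n x \<bullet> F0 x) \<le> K * B * norm (F0 x)"
          using Cauchy_Schwarz_ineq2[of "F n x" "F0 x"] by simp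
      qed
    qed (use sq[THEN sq_integrable_measurable] in simp_all)
    then have inner: "(\<lambda>n. nat_rep (G n) ?u \<bullet> nat_rep g0 ?u) \<longlonglongrightarrow> ?u \<bullet> ?u"
      using cisometryD(3)[OF cisometry_nat_rep[OF r(3,4), of b0], of ?u ?u]
      by (simp add: Gn g0 nat_rep_class f r inner_L2_class sq F_def[symmetric] F0_def[symmetric])
    \<comment> \<open>Expanding the square turns convergence of the inner products into norm
      convergence.\<close>
    have eq: "(norm (nat_rep (G n) ?u - nat_rep g0 ?u))\<^sup>2 = 2 * (?u \<bullet> ?u) - 2 * (nat_rep (G n) ?u \<bullet> nat_rep g0 ?u)" for n
      using cisometryD(3)[OF cisometry_nat_rep_G3[OF G(1)[rule_format, of n]], of ?u ?u]
        cisometryD(3)[OF cisometry_nat_rep_G3[OF G(2)], of ?u ?u]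
      by (simp add: power2_norm_eq_inner inner_diff_left inner_diff_right inner_commute)
    have "(\<lambda>n. (norm (nat_rep (G n) ?u - nat_rep g0 ?u))\<^sup>2) \<longlonglongrightarrow> 2 * (?u \<bullet> ?u) - 2 * (?u \<bullet> ?u)"
      unfolding eq by (intro tendsto_intros inner)
    then have "(\<lambda>n. norm (nat_rep (G n) ?u - nat_rep g0 ?u)) \<longlonglongrightarrow> 0"
      by simp
    then show "(\<lambda>n. nat_rep (G n) ?u) \<longlonglongrightarrow> nat_rep g0 ?u"
      by (rule LIM_zero_cancel[OF tendsto_norm_zero_cancel])
  qed
qed

subsection \<open>Gaussian integrals\<close>

text \<open>\<open>lborel\<close> is the image of the product over \<open>Basis\<close> of the
  one-dimensional measures, so Fubini's theorem for finite products applies coordinatewise.\<close>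

lemma
  fixes f :: "'a::euclidean_space \<Rightarrow> real \<Rightarrow> 'b::{real_normed_field, banach, second_countable_topology}"
  assumes f: "\<And>b. b \<in> Basis \<Longrightarrow> integrable lborel (f b)"
  shows integrable_prod_Basis: "integrable lborel (\<lambda>x. \<Prod>b\<in>Basis. f b (x \<bullet> b))"
    and integral_prod_Basis: "(\<integral>x. (\<Prod>b\<in>Basis. f b (x \<bullet> b)) \<partial>lborel) = (\<Prod>b\<in>Basis. \<integral>t. f b t \<partial>lborel)"
proof -
  interpret product_sigma_finite "\<lambda>_::'a. lborel :: real measure" ..
  let ?P = "\<Pi>\<^sub>M b\<in>(Basis :: 'a set). (lborel :: real measure)"
  let ?T = "\<lambda>y. \<Sum>b\<in>(Basis :: 'a set). y b *\<^sub>R b"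
  have [measurable]: "f b \<in> borel_measurable borel" if "b \<in> Basis" for b
    using f[OF that] by auto
  have L: "(lborel :: 'a measure) = distr ?P borel ?T"
    by (rule lborel_eq)
  have T: "?T \<in> measurable ?P borel"
    by measurable
  have m: "(\<lambda>x. \<Prod>b\<in>Basis. f b (x \<bullet> b)) \<in> borel_measurable borel"
    by measurable
  have eq: "(\<Prod>b\<in>Basis. f b (?T y \<bullet> b)) = (\<Prod>b\<in>Basis. f b (y b))" for y
    by (intro prod.cong refl) (simp add: inner_sum_left inner_Basis if_distrib sum.delta cong: if_cong)
  show "integrable lborel (\<lambda>x. \<Prod>b\<in>Basis. f b (x \<bullet> b))"
    unfolding L integrable_distr_eq[OF T m] eq
    by (rule product_integrable_prod) (simp_all add: f)
  show "(\<integral>x. (\<Prod>b\<in>Basis. f b (x \<bullet> b)) \<partial>lborel) = (\<Prod>b\<in>Basis. \<integral>t. f b t \<partial>lborel)"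
    unfolding L integral_distr[OF T m] eq
    by (rule product_integral_prod) (simp_all add: f)
qed

text \<open>The standard normal density on space, in product form so that its integrals and its
  characteristic function factor into one-dimensional ones.\<close>

definition gauss :: "real ^ 3 \<Rightarrow> real" where
  "gauss z = (\<Prod>b\<in>Basis. std_normal_density (z \<bullet> b))"

lemma gauss_nonneg: "0 \<le> gauss z"
  unfolding gauss_def by (intro prod_nonneg) auto

lemma borel_measurable_gauss [measurable]: "gauss \<in> borel_measurable borel"
  unfolding gauss_def[abs_def] by measurable

lemma gauss_eq: "gauss z = (1 / sqrt (2 * pi))^3 * exp (- (norm z)\<^sup>2 / 2)"
proof -
  have "(norm z)\<^sup>2 = (\<Sum>b\<in>Basis. (z \<bullet> b)\<^sup>2)"
    unfolding power2_norm_eq_inner by (subst euclidean_inner) (simp add: power2_eq_square)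
  then show ?thesis
    unfolding gauss_def std_normal_density_def prod.distrib exp_sum[OF finite_Basis, symmetric]
    by (simp add: sum_negf sum_divide_distrib)
qed

lemma integrable_std_normal_density: "integrable lborel std_normal_density"
  using std_normal_moment_even[of 0] by (simp add: has_bochner_integral_iff)

lemma integrable_iexp_normal: "integrable lborel (\<lambda>x. iexp (t * x) * complex_of_real (std_normal_density x))"
proof (rule Bochner_Integration.integrable_bound[OF integrable_std_normal_density])
  show "AE x in lborel. norm (iexp (t * x) * complex_of_real (std_normal_density x)) \<le> norm (std_normal_density x)"
    by (auto simp: norm_mult)
qed simp

lemma integral_iexp_normal:
  "(\<integral>x. iexp (t * x) * complex_of_real (std_normal_density x) \<partial>lborel) = complex_of_real (exp (- (t\<^sup>2) / 2))"
proof -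
  have "char std_normal_distribution t = (\<integral>x. std_normal_density x *\<^sub>R iexp (t * x) \<partial>lborel)"
    unfolding char_def by (rule integral_density) auto
  then show ?thesis
    by (simp add: char_std_normal_distribution scaleR_conv_of_real mult.commute)
qed

lemma
  shows integrable_iexp_gauss: "integrable lborel (\<lambda>z. iexp (t \<bullet> z) * complex_of_real (gauss z))"
    and integral_iexp_gauss:
      "(\<integral>z. iexp (t \<bullet> z) * complex_of_real (gauss z) \<partial>lborel) = complex_of_real (exp (- (norm t)\<^sup>2 / 2))"
proof -
  have "iexp (t \<bullet> z) = (\<Prod>b\<in>Basis. iexp ((t \<bullet> b) * (z \<bullet> b)))" for z
    by (subst euclidean_inner) (simp add: exp_sum[symmetric] sum_distrib_left)
  then have eq: "iexp (t \<bullet> z) * complex_of_real (gauss z)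
      = (\<Prod>b\<in>Basis. iexp ((t \<bullet> b) * (z \<bullet> b)) * complex_of_real (std_normal_density (z \<bullet> b)))" for z
    by (simp add: gauss_def prod.distrib)
  have "(norm t)\<^sup>2 = (\<Sum>b\<in>Basis. (t \<bullet> b)\<^sup>2)"
    unfolding power2_norm_eq_inner by (subst euclidean_inner) (simp add: power2_eq_square)
  then have "(\<Prod>b\<in>Basis. complex_of_real (exp (- ((t \<bullet> b)\<^sup>2) / 2))) = complex_of_real (exp (- (norm t)\<^sup>2 / 2))"
    by (simp add: of_real_prod[symmetric] exp_sum[symmetric] sum_negf sum_divide_distrib del: of_real_prod)
  then show "(\<integral>z. iexp (t \<bullet> z) * complex_of_real (gauss z) \<partial>lborel) = complex_of_real (exp (- (norm t)\<^sup>2 / 2))"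
    unfolding eq
    by (subst integral_prod_Basis[of "\<lambda>b x. iexp ((t \<bullet> b) * x) * complex_of_real (std_normal_density x)"])
      (simp_all only: integrable_iexp_normal integral_iexp_normal)
  show "integrable lborel (\<lambda>z. iexp (t \<bullet> z) * complex_of_real (gauss z))"
    unfolding eq
    by (rule integrable_prod_Basis[of "\<lambda>b x. iexp ((t \<bullet> b) * x) * complex_of_real (std_normal_density x)"])
      (rule integrable_iexp_normal)
qed

lemma integrable_gauss: "integrable lborel gauss"
  unfolding gauss_def[abs_def] by (intro integrable_prod_Basis integrable_std_normal_density)

lemma integral_gauss: "(\<integral>z. gauss z \<partial>lborel) = 1"
  unfolding gauss_def
  by (subst integral_prod_Basis[OF integrable_std_normal_density])
    (use integral_std_normal_moment_even[of 0] in simp)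

subsection \<open>The Fourier integral\<close>

definition wave :: "real \<Rightarrow> complex" where
  "wave t = exp (- \<i> * of_real (2 * pi * t))"

lemma norm_wave [simp]: "cmod (wave t) = 1"
  by (simp add: wave_def)

lemma cnj_wave: "cnj (wave t) = wave (- t)"
  by (simp add: wave_def exp_cnj)

lemma wave_add: "wave (s + t) = wave s * wave t"
  by (simp add: wave_def exp_add[symmetric] algebra_simps)

lemma borel_measurable_wave [measurable]: "wave \<in> borel_measurable borel"
  unfolding wave_def[abs_def] by (intro borel_measurable_continuous_onI continuous_intros)

lemma fourier_integral_wave: "fourier_integral f \<xi> = (\<integral>x. wave (x \<bullet> \<xi>) *s f x \<partial>lborel)"
  by (simp add: fourier_integral_def wave_def)

lemma integrable_wave:
  assumes "integrable lborel (f :: real ^ 3 \<Rightarrow> biquat)"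
  shows "integrable lborel (\<lambda>x. wave (x \<bullet> \<xi>) *s f x)"
  by (rule Bochner_Integration.integrable_bound[OF assms])
    (use assms in \<open>auto simp: norm_smult\<close>)

lemma borel_measurable_fourier_integral:
  assumes "integrable lborel f"
  shows "fourier_integral f \<in> borel_measurable borel"
proof -
  have [measurable]: "f \<in> borel_measurable borel" using assms by auto
  show ?thesis
    unfolding fourier_integral_wave[abs_def] by measurable
qed

lemma norm_fourier_integral:
  assumes "integrable lborel f"
  shows "norm (fourier_integral f \<xi>) \<le> (\<integral>x. norm (f x) \<partial>lborel)"
  unfolding fourier_integral_wave
  using integral_norm_bound[of lborel "\<lambda>x. wave (x \<bullet> \<xi>) *s f x"] by (simp add: norm_smult)

text \<open>Covers scalar multiplication as well as left and right multiplication by a fixed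
  quaternion; complex linearity of \<open>T\<close> lets it pass the kernel.\<close>

lemma fourier_integral_linear:
  assumes "integrable lborel f" and T: "bounded_linear T" "\<And>c q. T (c *s q) = c *s T q"
  shows "fourier_integral (\<lambda>x. T (f x)) \<xi> = T (fourier_integral f \<xi>)"
  unfolding fourier_integral_wave
  using integral_bounded_linear[OF T(1) integrable_wave[OF assms(1), of \<xi>]] by (simp add: T(2))

lemma fourier_integral_add:
  assumes "integrable lborel f" "integrable lborel g"
  shows "fourier_integral (\<lambda>x. f x + g x) \<xi> = fourier_integral f \<xi> + fourier_integral g \<xi>"
  using Bochner_Integration.integral_add[OF assms[THEN integrable_wave, of \<xi>]]
  by (simp add: fourier_integral_wave vector_add_ldistrib)

lemma fourier_integral_diff:
  assumes "integrable lborel f" "integrable lborel g"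
  shows "fourier_integral (\<lambda>x. f x - g x) \<xi> = fourier_integral f \<xi> - fourier_integral g \<xi>"
  using fourier_integral_add[of "\<lambda>x. f x - g x" g \<xi>] assms by simp

lemma fourier_integral_cong_AE:
  assumes "f \<in> borel_measurable borel" "g \<in> borel_measurable borel" "AE x in lborel. f x = g x"
  shows "fourier_integral f = fourier_integral g"
  unfolding fourier_integral_wave
  by (intro ext integral_cong_AE) (use assms in auto)

lemma integrable_pair_mult:
  fixes f g :: "'a::euclidean_space \<Rightarrow> real"
  assumes "integrable lborel f" "integrable lborel g"
  shows "integrable (lborel \<Otimes>\<^sub>M lborel) (\<lambda>(x, y). f x * g y)"
proof -
  have [measurable]: "f \<in> borel_measurable borel" "g \<in> borel_measurable borel"
    using assms by auto
  show ?thesis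
  proof (rule lborel_pair.Fubini_integrable)
    show "integrable lborel (\<lambda>x. \<integral>y. norm (case (x, y) of (x, y) \<Rightarrow> f x * g y) \<partial>lborel)"
      using assms by (simp add: abs_mult)
    show "AE x in lborel. integrable lborel (\<lambda>y. case (x, y) of (x, y) \<Rightarrow> f x * g y)"
      using assms by simp
  qed measurable
qed

text \<open>Fubini for the product of two integrable functions, the kernel having modulus 1. Moving
  the kernel to the other factor conjugates it, whence the argument \<open>- x\<close>.\<close>

lemma fourier_integral_adjoint:
  assumes f: "integrable lborel f" and h: "integrable lborel h"
  shows "(\<integral>\<xi>. fourier_integral f \<xi> \<bullet> h \<xi> \<partial>lborel) = (\<integral>x. f x \<bullet> fourier_integral h (- x) \<partial>lborel)"
proof -
  have [measurable]: "f \<in> borel_measurable borel" "h \<in> borel_measurable borel"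
    using f h by auto
  have int: "integrable (lborel \<Otimes>\<^sub>M lborel) (\<lambda>(x, \<xi>). (wave (x \<bullet> \<xi>) *s f x) \<bullet> h \<xi>)"
  proof (rule Bochner_Integration.integrable_bound[OF integrable_pair_mult[OF integrable_norm[OF f] integrable_norm[OF h]]])
    show "AE p in lborel \<Otimes>\<^sub>M lborel. norm (case p of (x, \<xi>) \<Rightarrow> (wave (x \<bullet> \<xi>) *s f x) \<bullet> h \<xi>)
        \<le> norm (case p of (x, y) \<Rightarrow> norm (f x) * norm (h y))"
    proof (rule AE_I2, safe)
      fix x \<xi>
      show "norm ((wave (x \<bullet> \<xi>) *s f x) \<bullet> h \<xi>) \<le> norm (norm (f x) * norm (h \<xi>))"
        using Cauchy_Schwarz_ineq2[of "wave (x \<bullet> \<xi>) *s f x" "h \<xi>"] by (simp add: norm_smult)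
    qed
  qed measurable
  have "(\<integral>\<xi>. fourier_integral f \<xi> \<bullet> h \<xi> \<partial>lborel) = (\<integral>\<xi>. (\<integral>x. (wave (x \<bullet> \<xi>) *s f x) \<bullet> h \<xi> \<partial>lborel) \<partial>lborel)"
    unfolding fourier_integral_wave by (simp add: integrable_wave[OF f])
  also have "\<dots> = (\<integral>x. (\<integral>\<xi>. (wave (x \<bullet> \<xi>) *s f x) \<bullet> h \<xi> \<partial>lborel) \<partial>lborel)"
    by (rule lborel_pair.Fubini_integral[OF int])
  also have "\<dots> = (\<integral>x. (\<integral>\<xi>. f x \<bullet> (wave (\<xi> \<bullet> - x) *s h \<xi>) \<partial>lborel) \<partial>lborel)"
    by (simp add: inner_smult cnj_wave inner_commute[where y = "_ :: real ^ 3"])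
  also have "\<dots> = (\<integral>x. f x \<bullet> fourier_integral h (- x) \<partial>lborel)"
    unfolding fourier_integral_wave
    by (intro Bochner_Integration.integral_cong refl integral_inner_right integrable_wave h)
  finally show ?thesis .
qed

subsection \<open>Plancherel's theorem\<close>

text \<open>The factor \<open>2 * pi * e\<close> is chosen so that the transform of the weight is
  the normal density of standard deviation \<open>e\<close>. As \<open>e\<close> tends to 0 the
  weight increases to 1.\<close>

definition gweight :: "real \<Rightarrow> real ^ 3 \<Rightarrow> real" where
  "gweight e \<xi> = exp (- (norm ((2 * pi * e) *\<^sub>R \<xi>))\<^sup>2 / 2)"

lemma gweight_gauss: "gweight e \<xi> = (sqrt (2 * pi))^3 * gauss ((2 * pi * e) *\<^sub>R \<xi>)"
  by (simp add: gweight_def gauss_eq power_divide)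

lemma borel_measurable_gweight [measurable]: "gweight e \<in> borel_measurable borel"
  unfolding gweight_gauss[abs_def] by measurable

lemma gweight_bounds: "0 \<le> gweight e \<xi>" "gweight e \<xi> \<le> 1"
  by (simp_all add: gweight_def)

lemma simil_qone: "simil r qone b x = (1/r) *\<^sub>R (x - b)"
  by (simp add: simil_def qinv_qone rot_qone)

lemma integrable_gweight: "e > 0 \<Longrightarrow> integrable lborel (gweight e)"
  using integrable_simil[of "1 / (2 * pi * e)" qone gauss 0] integrable_gauss
  by (simp add: gweight_gauss[abs_def] simil_qone qone_Spin3)

lemma integral_wave_gweight:
  assumes e: "e > 0"
  shows "(\<integral>\<xi>. wave (u \<bullet> \<xi>) * complex_of_real (gweight e \<xi>) \<partial>lborel) = of_real (gauss ((1/e) *\<^sub>R u) / e^3)"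
proof -
  let ?r = "1 / (2 * pi * e)" and ?F = "\<lambda>z. iexp (- ((1/e) *\<^sub>R u) \<bullet> z) * complex_of_real (gauss z)"
  have r: "?r > 0" using e by simp
  have "wave (u \<bullet> \<xi>) = iexp (- ((1/e) *\<^sub>R u) \<bullet> simil ?r qone 0 \<xi>)" for \<xi>
    using e by (simp add: wave_def simil_qone mult.commute)
  then have "wave (u \<bullet> \<xi>) * complex_of_real (gweight e \<xi>)
      = complex_of_real ((sqrt (2 * pi))^3) * ?F (simil ?r qone 0 \<xi>)" for \<xi>
    by (simp add: gweight_gauss simil_qone)
  then have "(\<integral>\<xi>. wave (u \<bullet> \<xi>) * complex_of_real (gweight e \<xi>) \<partial>lborel)
      = complex_of_real ((sqrt (2 * pi))^3) * (\<integral>\<xi>. ?F (simil ?r qone 0 \<xi>) \<partial>lborel)"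
    by (simp only: integral_mult_right_zero)
  also have "(\<integral>\<xi>. ?F (simil ?r qone 0 \<xi>) \<partial>lborel) = ?r^3 *\<^sub>R (\<integral>z. ?F z \<partial>lborel)"
    using integrable_iexp_gauss[of "- ((1/e) *\<^sub>R u)"]
    by (intro integral_simil r qone_Spin3) auto
  also have "(\<integral>z. ?F z \<partial>lborel) = of_real (exp (- (norm ((1/e) *\<^sub>R u))\<^sup>2 / 2))"
    by (subst integral_iexp_gauss) simp
  also have "exp (- (norm ((1/e) *\<^sub>R u))\<^sup>2 / 2) = (sqrt (2 * pi))^3 * gauss ((1/e) *\<^sub>R u)"
    by (simp add: gauss_eq power_divide)
  \<comment> \<open>One factor \<open>(sqrt (2 * pi))^3\<close> comes from the weight and one from
    the normal density; with the Jacobian of the substitution they leave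
    \<open>1 / e^3\<close>.\<close>
  also have "complex_of_real ((sqrt (2 * pi))^3) * (?r^3 *\<^sub>R of_real ((sqrt (2 * pi))^3 * gauss ((1/e) *\<^sub>R u)))
      = of_real (((sqrt (2 * pi) * sqrt (2 * pi)) * ?r)^3 * gauss ((1/e) *\<^sub>R u))"
    by (simp only: scaleR_conv_of_real of_real_mult[symmetric] power_mult_distrib mult_ac)
  also have "((sqrt (2 * pi) * sqrt (2 * pi)) * ?r) = 1 / e"
    using e by simp
  finally show ?thesis by (simp add: power_divide)
qed

text \<open>Translations belong to the group, so isometry and strong continuity of
  \<open>nat_rep\<close> apply to them.\<close>

lemma translate_class:
  assumes "sq_integrable f"
  shows "nat_rep (1, qone, - z) (L2_class f) = L2_class (\<lambda>x. f (x + z))"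
  using assms
  by (simp add: nat_rep_class qone_Spin3 nat_fun_def[abs_def] simil_qone qmult_one)

lemma sq_integrable_translate: "sq_integrable f \<Longrightarrow> sq_integrable (\<lambda>x. f (x + z))"
  for f :: "real ^ 3 \<Rightarrow> biquat"
  using sq_integrable_nat_fun[of 1 qone f "- z"]
  by (simp add: qone_Spin3 nat_fun_def[abs_def] simil_qone qmult_one)

text \<open>Inverting the weighted transform convolves \<open>f\<close> with the transform of the
  weight, a Gaussian of width \<open>e\<close>. The integrable weight justifies the exchange of
  integrals.\<close>

lemma fourier_integral_gweight:
  assumes f: "integrable lborel f" and e: "e > 0"
  shows "fourier_integral (\<lambda>\<xi>. gweight e \<xi> *\<^sub>R fourier_integral f \<xi>) (- x)
    = (\<integral>z. gauss z *\<^sub>R f (x + e *\<^sub>R z) \<partial>lborel)"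
proof -
  have [measurable]: "f \<in> borel_measurable borel" using f by auto
  have int: "integrable (lborel \<Otimes>\<^sub>M lborel) (\<lambda>(\<xi>, y). (wave ((y - x) \<bullet> \<xi>) * of_real (gweight e \<xi>)) *s f y)"
  proof (rule Bochner_Integration.integrable_bound[OF integrable_pair_mult[OF integrable_gweight[OF e] integrable_norm[OF f]]])
    show "AE p in lborel \<Otimes>\<^sub>M lborel. norm (case p of (\<xi>, y) \<Rightarrow> (wave ((y - x) \<bullet> \<xi>) * of_real (gweight e \<xi>)) *s f y)
        \<le> norm (case p of (\<xi>, y) \<Rightarrow> gweight e \<xi> * norm (f y))"
      by (rule AE_I2) (auto simp: norm_smult norm_mult gweight_bounds)
  qed measurable
  have "fourier_integral (\<lambda>\<xi>. gweight e \<xi> *\<^sub>R fourier_integral f \<xi>) (- x)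
      = (\<integral>\<xi>. (wave (\<xi> \<bullet> - x) * of_real (gweight e \<xi>)) *s (\<integral>y. wave (y \<bullet> \<xi>) *s f y \<partial>lborel) \<partial>lborel)"
    unfolding fourier_integral_wave by (simp add: scaleR_biquat vector_smult_assoc)
  also have "\<dots> = (\<integral>\<xi>. (\<integral>y. (wave ((y - x) \<bullet> \<xi>) * of_real (gweight e \<xi>)) *s f y \<partial>lborel) \<partial>lborel)"
  proof (intro Bochner_Integration.integral_cong refl)
    fix \<xi>
    have "(wave (\<xi> \<bullet> - x) * of_real (gweight e \<xi>)) *s (\<integral>y. wave (y \<bullet> \<xi>) *s f y \<partial>lborel)
        = (\<integral>y. (wave (\<xi> \<bullet> - x) * of_real (gweight e \<xi>)) *s (wave (y \<bullet> \<xi>) *s f y) \<partial>lborel)"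
      by (rule integral_bounded_linear[OF bounded_linear_smult integrable_wave[OF f], symmetric])
    also have "\<dots> = (\<integral>y. (wave ((y - x) \<bullet> \<xi>) * of_real (gweight e \<xi>)) *s f y \<partial>lborel)"
    proof -
      have "wave ((y - x) \<bullet> \<xi>) = wave (\<xi> \<bullet> - x) * wave (y \<bullet> \<xi>)" for y
        by (simp add: wave_add[symmetric] inner_diff_left inner_commute[of \<xi>])
      then show ?thesis
        by (simp add: vector_smult_assoc mult_ac)
    qed
    finally show "(wave (\<xi> \<bullet> - x) * of_real (gweight e \<xi>)) *s (\<integral>y. wave (y \<bullet> \<xi>) *s f y \<partial>lborel)
        = (\<integral>y. (wave ((y - x) \<bullet> \<xi>) * of_real (gweight e \<xi>)) *s f y \<partial>lborel)" .
  qed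
  also have "\<dots> = (\<integral>y. (\<integral>\<xi>. (wave ((y - x) \<bullet> \<xi>) * of_real (gweight e \<xi>)) *s f y \<partial>lborel) \<partial>lborel)"
    by (rule lborel_pair.Fubini_integral[OF int, symmetric])
  \<comment> \<open>The integrand is rewritten in \<open>z = (y - x)/e\<close>, that is
    \<open>simil e qone x y\<close>, whose Jacobian cancels \<open>1 / e^3\<close>.\<close>
  also have "\<dots> = (\<integral>y. (1 / e^3) *\<^sub>R (gauss (simil e qone x y) *\<^sub>R f (x + e *\<^sub>R simil e qone x y)) \<partial>lborel)"
  proof (intro Bochner_Integration.integral_cong refl)
    fix y
    have "integrable lborel (\<lambda>\<xi>. wave ((y - x) \<bullet> \<xi>) * complex_of_real (gweight e \<xi>))"
      by (rule Bochner_Integration.integrable_bound[OF integrable_gweight[OF e]]) (auto simp: norm_mult)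
    then have "(\<integral>\<xi>. (wave ((y - x) \<bullet> \<xi>) * of_real (gweight e \<xi>)) *s f y \<partial>lborel)
        = of_real (gauss ((1/e) *\<^sub>R (y - x)) / e^3) *s f y"
      using integral_bounded_linear[OF smult.bounded_linear_left, of lborel "\<lambda>\<xi>. wave ((y - x) \<bullet> \<xi>) * complex_of_real (gweight e \<xi>)" "f y"]
      by (simp only: integral_wave_gweight[OF e])
    then show "(\<integral>\<xi>. (wave ((y - x) \<bullet> \<xi>) * of_real (gweight e \<xi>)) *s f y \<partial>lborel)
      = (1 / e^3) *\<^sub>R (gauss (simil e qone x y) *\<^sub>R f (x + e *\<^sub>R simil e qone x y))"
      using e by (simp add: simil_qone scaleR_biquat vector_smult_assoc)
  qed
  also have "\<dots> = (1 / e^3) *\<^sub>R (\<integral>y. gauss (simil e qone x y) *\<^sub>R f (x + e *\<^sub>R simil e qone x y) \<partial>lborel)"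
    by (simp only: integral_scaleR_right)
  also have "(\<integral>y. gauss (simil e qone x y) *\<^sub>R f (x + e *\<^sub>R simil e qone x y) \<partial>lborel)
      = e^3 *\<^sub>R (\<integral>z. gauss z *\<^sub>R f (x + e *\<^sub>R z) \<partial>lborel)"
    by (rule integral_simil[OF e qone_Spin3, of "\<lambda>z. gauss z *\<^sub>R f (x + e *\<^sub>R z)"]) measurable
  finally show ?thesis using e by simp
qed

text \<open>The adjoint formula is applied to \<open>f\<close> and to its own weighted transform
  \<open>h\<close>; the transform of \<open>h\<close> is a Gaussian average of translates of
  \<open>f\<close>, and exchanging integrals produces their inner products with
  \<open>f\<close>.\<close>

lemma Plancherel_gweight:
  assumes f: "integrable lborel f" "sq_integrable f" and e: "e > 0"
  shows "integrable lborel (\<lambda>\<xi>. gweight e \<xi> * (norm (fourier_integral f \<xi>))\<^sup>2)"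
    and "(\<integral>\<xi>. gweight e \<xi> * (norm (fourier_integral f \<xi>))\<^sup>2 \<partial>lborel)
      = (\<integral>z. gauss z * (L2_class f \<bullet> nat_rep (1, qone, - (e *\<^sub>R z)) (L2_class f)) \<partial>lborel)"
proof -
  have [measurable]: "f \<in> borel_measurable borel" using f by auto
  note [measurable] = borel_measurable_fourier_integral[OF f(1)]
  define C where "C = (\<integral>x. norm (f x) \<partial>lborel)"
  have C: "norm (fourier_integral f \<xi>) \<le> C" for \<xi>
    unfolding C_def by (rule norm_fourier_integral[OF f(1)])
  have C0: "0 \<le> C" by (simp add: C_def)
  define h where "h \<xi> = gweight e \<xi> *\<^sub>R fourier_integral f \<xi>" for \<xi>
  have [measurable]: "h \<in> borel_measurable borel" unfolding h_def[abs_def] by measurable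
  have h: "integrable lborel h"
  proof (rule Bochner_Integration.integrable_bound)
    show "integrable lborel (\<lambda>\<xi>. C * gweight e \<xi>)"
      using integrable_gweight[OF e] by simp
    show "AE x in lborel. norm (h x) \<le> norm (C * gweight e x)"
    proof (rule AE_I2)
      fix x
      have "gweight e x * norm (fourier_integral f x) \<le> gweight e x * C"
        by (intro mult_left_mono C gweight_bounds)
      then show "norm (h x) \<le> norm (C * gweight e x)"
        using C0 by (simp add: h_def gweight_bounds mult.commute)
    qed
  qed simp
  have hf: "fourier_integral f \<xi> \<bullet> h \<xi> = gweight e \<xi> * (norm (fourier_integral f \<xi>))\<^sup>2" for \<xi>
    by (simp add: h_def power2_norm_eq_inner)
  show "integrable lborel (\<lambda>\<xi>. gweight e \<xi> * (norm (fourier_integral f \<xi>))\<^sup>2)"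
  proof (rule Bochner_Integration.integrable_bound)
    show "integrable lborel (\<lambda>\<xi>. C\<^sup>2 * gweight e \<xi>)"
      using integrable_gweight[OF e] by simp
    show "AE x in lborel. norm (gweight e x * (norm (fourier_integral f x))\<^sup>2) \<le> norm (C\<^sup>2 * gweight e x)"
    proof (rule AE_I2)
      fix x
      have "gweight e x * (norm (fourier_integral f x))\<^sup>2 \<le> gweight e x * C\<^sup>2"
        by (intro mult_left_mono power_mono C gweight_bounds) simp
      then show "norm (gweight e x * (norm (fourier_integral f x))\<^sup>2) \<le> norm (C\<^sup>2 * gweight e x)"
        by (simp add: gweight_bounds abs_mult mult.commute)
    qed
  qed simp
  let ?k = "\<lambda>z x. gauss z * (f x \<bullet> f (x + e *\<^sub>R z))"
  \<comment> \<open>Majorant from \<open>a * b \<le> a\<^sup>2 + b\<^sup>2\<close>. Its inner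
    integral is a constant multiple of \<open>gauss z\<close>, because translation preserves the
    integral of \<open>(norm (f x))\<^sup>2\<close>.\<close>
  let ?B = "\<lambda>z x. gauss z * ((norm (f x))\<^sup>2 + (norm (f (x + e *\<^sub>R z)))\<^sup>2)"
  have sq: "integrable lborel (\<lambda>x. (norm (f x))\<^sup>2)" "integrable lborel (\<lambda>x. (norm (f (x + z)))\<^sup>2)" for z
    using f(2) sq_integrable_translate[OF f(2), of z] by (simp_all add: sq_integrable_def)
  have trans: "(\<integral>x. (norm (f (x + z)))\<^sup>2 \<partial>lborel) = (\<integral>x. (norm (f x))\<^sup>2 \<partial>lborel)" for z
    using integral_simil[of 1 qone "\<lambda>x. (norm (f x))\<^sup>2" "- z"] by (simp add: qone_Spin3 simil_qone)
  have B: "integrable (lborel \<Otimes>\<^sub>M lborel) (\<lambda>(z, x). ?B z x)"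
  proof (rule lborel_pair.Fubini_integrable)
    have "(\<integral>x. norm (case (z, x) of (z, x) \<Rightarrow> ?B z x) \<partial>lborel) = gauss z * (2 * (\<integral>x. (norm (f x))\<^sup>2 \<partial>lborel))" for z
    proof -
      have "(\<integral>x. norm (case (z, x) of (z, x) \<Rightarrow> ?B z x) \<partial>lborel)
          = gauss z * (\<integral>x. (norm (f x))\<^sup>2 + (norm (f (x + e *\<^sub>R z)))\<^sup>2 \<partial>lborel)"
        by (simp add: gauss_nonneg abs_mult)
      also have "(\<integral>x. (norm (f x))\<^sup>2 + (norm (f (x + e *\<^sub>R z)))\<^sup>2 \<partial>lborel) = 2 * (\<integral>x. (norm (f x))\<^sup>2 \<partial>lborel)"
        by (subst Bochner_Integration.integral_add[OF sq(1) sq(2)]) (simp add: trans)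
      finally show ?thesis .
    qed
    then show "integrable lborel (\<lambda>z. \<integral>x. norm (case (z, x) of (z, x) \<Rightarrow> ?B z x) \<partial>lborel)"
      using integrable_gauss by simp
    show "AE z in lborel. integrable lborel (\<lambda>x. case (z, x) of (z, x) \<Rightarrow> ?B z x)"
      using sq by simp
  qed measurable
  have k: "integrable (lborel \<Otimes>\<^sub>M lborel) (\<lambda>(z, x). ?k z x)"
  proof (rule Bochner_Integration.integrable_bound[OF B])
    have "\<bar>?k z x\<bar> \<le> ?B z x" for z x
    proof -
      have "\<bar>f x \<bullet> f (x + e *\<^sub>R z)\<bar> \<le> norm (f x) * norm (f (x + e *\<^sub>R z))"
        by (rule Cauchy_Schwarz_ineq2)
      also have "\<dots> \<le> (norm (f x))\<^sup>2 + (norm (f (x + e *\<^sub>R z)))\<^sup>2"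
        using sum_squares_bound[of "norm (f x)" "norm (f (x + e *\<^sub>R z))"]
          mult_nonneg_nonneg[OF norm_ge_zero[of "f x"] norm_ge_zero[of "f (x + e *\<^sub>R z)"]] by linarith
      finally show ?thesis
        by (simp add: abs_mult gauss_nonneg mult_left_mono)
    qed
    then show "AE p in lborel \<Otimes>\<^sub>M lborel. norm (case p of (z, x) \<Rightarrow> ?k z x) \<le> norm (case p of (z, x) \<Rightarrow> ?B z x)"
      by (intro AE_I2) (auto simp: gauss_nonneg)
  qed measurable
  have "(\<integral>\<xi>. gweight e \<xi> * (norm (fourier_integral f \<xi>))\<^sup>2 \<partial>lborel) = (\<integral>x. f x \<bullet> fourier_integral h (- x) \<partial>lborel)"
    unfolding hf[symmetric] by (rule fourier_integral_adjoint[OF f(1) h])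
  also have "\<dots> = (\<integral>x. f x \<bullet> (\<integral>z. gauss z *\<^sub>R f (x + e *\<^sub>R z) \<partial>lborel) \<partial>lborel)"
    unfolding h_def by (simp add: fourier_integral_gweight[OF f(1) e])
  also have "\<dots> = (\<integral>x. (\<integral>z. ?k z x \<partial>lborel) \<partial>lborel)"
  proof (intro Bochner_Integration.integral_cong refl)
    fix x
    have "integrable lborel (\<lambda>z. gauss z *\<^sub>R f (x + e *\<^sub>R z))"
    proof (rule Bochner_Integration.integrable_bound)
      have s: "simil (1/e) qone (- ((1/e) *\<^sub>R x)) z = x + e *\<^sub>R z" for z
        using e by (simp add: simil_qone algebra_simps)
      have "integrable lborel (\<lambda>z. norm (f (x + e *\<^sub>R z)))"
        using integrable_simil[of "1/e" qone "\<lambda>z. norm (f z)" "- ((1/e) *\<^sub>R x)"] e f(1)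
        unfolding s by (simp add: qone_Spin3)
      then show "integrable lborel (\<lambda>z. gauss 0 * norm (f (x + e *\<^sub>R z)))"
        by simp
      \<comment> \<open>For fixed \<open>x\<close> the integrability in \<open>z\<close> comes from
        \<open>f\<close>; the Gaussian only enters as a bounded factor.\<close>
      have "gauss z \<le> gauss 0" for z
        by (simp add: gauss_eq)
      then show "AE z in lborel. norm (gauss z *\<^sub>R f (x + e *\<^sub>R z)) \<le> norm (gauss 0 * norm (f (x + e *\<^sub>R z)))"
        by (intro AE_I2) (auto simp: gauss_nonneg intro!: mult_right_mono)
    qed measurable
    then show "f x \<bullet> (\<integral>z. gauss z *\<^sub>R f (x + e *\<^sub>R z) \<partial>lborel) = (\<integral>z. ?k z x \<partial>lborel)"
      by (subst integral_inner_right[symmetric]) auto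
  qed
  also have "\<dots> = (\<integral>z. (\<integral>x. ?k z x \<partial>lborel) \<partial>lborel)"
    by (rule lborel_pair.Fubini_integral[OF k])
  also have "\<dots> = (\<integral>z. gauss z * (L2_class f \<bullet> nat_rep (1, qone, - (e *\<^sub>R z)) (L2_class f)) \<partial>lborel)"
    by (simp add: translate_class f inner_L2_class sq_integrable_translate)
  finally show "(\<integral>\<xi>. gweight e \<xi> * (norm (fourier_integral f \<xi>))\<^sup>2 \<partial>lborel)
      = (\<integral>z. gauss z * (L2_class f \<bullet> nat_rep (1, qone, - (e *\<^sub>R z)) (L2_class f)) \<partial>lborel)" .
qed

lemma Plancherel:
  assumes f: "integrable lborel f" "sq_integrable f"
  shows "sq_integrable (fourier_integral f)"
    and "(\<integral>\<xi>. (norm (fourier_integral f \<xi>))\<^sup>2 \<partial>lborel) = (\<integral>x. (norm (f x))\<^sup>2 \<partial>lborel)"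
proof -
  note [measurable] = borel_measurable_fourier_integral[OF f(1)]
  let ?u = "L2_class f"
  define e where "e n = 1 / real (Suc n)" for n
  have e: "e n > 0" for n by (simp add: e_def)
  have e0: "e \<longlonglongrightarrow> 0"
    using LIMSEQ_inverse_real_of_nat by (simp add: e_def[abs_def] inverse_eq_divide)
  define c where "c z = ?u \<bullet> nat_rep (1, qone, - z) ?u" for z
  have carr: "(1, qone, z) \<in> carrier G3" for z
    by (simp add: G3_def qone_Spin3)
  have "continuous_on UNIV (\<lambda>z. nat_rep (1, qone, - z) ?u)"
    by (rule continuous_on_compose2[OF continuous_nat_rep, where f = "\<lambda>z. (1, qone, - z)"])
      (auto intro!: continuous_intros carr)
  then have c: "continuous_on UNIV c"
    unfolding c_def by (intro continuous_intros)
  then have [measurable]: "c \<in> borel_measurable borel"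
    by (rule borel_measurable_continuous_onI)
  have c_bound: "\<bar>c z\<bar> \<le> (norm ?u)\<^sup>2" for z
    using Cauchy_Schwarz_ineq2[of ?u "nat_rep (1, qone, - z) ?u"] cisometryD(6)[OF cisometry_nat_rep_G3[OF carr]]
    by (simp add: c_def power2_eq_square)
  have c0: "c 0 = (norm ?u)\<^sup>2"
    using translate_class[OF f(2), of 0] by (simp add: c_def power2_norm_eq_inner)
  have lim: "(\<lambda>n. \<integral>z. gauss z * c (e n *\<^sub>R z) \<partial>lborel) \<longlonglongrightarrow> (\<integral>z. gauss z * c 0 \<partial>lborel)"
  proof (rule integral_dominated_convergence[where w = "\<lambda>z. (norm ?u)\<^sup>2 * gauss z"])
    show "AE z in lborel. (\<lambda>n. gauss z * c (e n *\<^sub>R z)) \<longlonglongrightarrow> gauss z * c 0"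
    proof (rule AE_I2, rule tendsto_mult_left)
      fix z :: "real ^ 3"
      have "(\<lambda>n. e n *\<^sub>R z) \<longlonglongrightarrow> 0 *\<^sub>R z"
        by (intro tendsto_intros e0)
      then show "(\<lambda>n. c (e n *\<^sub>R z)) \<longlonglongrightarrow> c 0"
        using c by (intro isCont_tendsto_compose[of _ c]) (simp_all add: continuous_on_eq_continuous_at)
    qed
    show "AE z in lborel. norm (gauss z * c (e n *\<^sub>R z)) \<le> (norm ?u)\<^sup>2 * gauss z" for n
    proof (rule AE_I2)
      fix z
      have "gauss z * \<bar>c (e n *\<^sub>R z)\<bar> \<le> gauss z * (norm ?u)\<^sup>2"
        by (intro mult_left_mono c_bound gauss_nonneg)
      then show "norm (gauss z * c (e n *\<^sub>R z)) \<le> (norm ?u)\<^sup>2 * gauss z"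
        by (simp add: abs_mult gauss_nonneg mult.commute)
    qed
  qed (use integrable_gauss in auto)
  \<comment> \<open>On the Fourier side integrability of the limit is still unknown, so monotone
    convergence is used; it delivers integrability and value together.\<close>
  have mono: "mono (\<lambda>n. gweight (e n) \<xi> * (norm (fourier_integral f \<xi>))\<^sup>2)" for \<xi>
  proof (rule monoI)
    fix m n :: nat assume "m \<le> n"
    then have "e n \<le> e m" by (simp add: e_def frac_le)
    then have "e n * norm \<xi> \<le> e m * norm \<xi>" by (rule mult_right_mono) simp
    then have "(e n * norm \<xi>)\<^sup>2 \<le> (e m * norm \<xi>)\<^sup>2" using e[of n] by (intro power_mono) auto
    then have "gweight (e m) \<xi> \<le> gweight (e n) \<xi>"
      by (simp add: gweight_def power_mult_distrib abs_mult mult_ac)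
    then show "gweight (e m) \<xi> * (norm (fourier_integral f \<xi>))\<^sup>2 \<le> gweight (e n) \<xi> * (norm (fourier_integral f \<xi>))\<^sup>2"
      by (rule mult_right_mono) simp
  qed
  have wlim: "(\<lambda>n. gweight (e n) \<xi> * (norm (fourier_integral f \<xi>))\<^sup>2) \<longlonglongrightarrow> (norm (fourier_integral f \<xi>))\<^sup>2" for \<xi>
  proof -
    have "(\<lambda>n. gweight (e n) \<xi> * (norm (fourier_integral f \<xi>))\<^sup>2)
        \<longlonglongrightarrow> exp (- (norm ((2 * pi * 0) *\<^sub>R \<xi>))\<^sup>2 / 2) * (norm (fourier_integral f \<xi>))\<^sup>2"
      unfolding gweight_def by (intro tendsto_intros e0) auto
    then show ?thesis by simp
  qed
  have ilim: "(\<lambda>n. \<integral>\<xi>. gweight (e n) \<xi> * (norm (fourier_integral f \<xi>))\<^sup>2 \<partial>lborel) \<longlonglongrightarrow> (norm ?u)\<^sup>2"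
    using lim unfolding Plancherel_gweight(2)[OF f e] c_def[symmetric]
    by (simp add: c0 integral_gauss)
  have *: "integrable lborel (\<lambda>\<xi>. (norm (fourier_integral f \<xi>))\<^sup>2)"
    "(\<integral>\<xi>. (norm (fourier_integral f \<xi>))\<^sup>2 \<partial>lborel) = (norm ?u)\<^sup>2"
    using integral_monotone_convergence_nonneg[OF Plancherel_gweight(1)[OF f e] AE_I2[OF mono] _ AE_I2[OF wlim] ilim]
    by (auto simp: gweight_bounds)
  then show "sq_integrable (fourier_integral f)"
    "(\<integral>\<xi>. (norm (fourier_integral f \<xi>))\<^sup>2 \<partial>lborel) = (\<integral>x. (norm (f x))\<^sup>2 \<partial>lborel)"
    using f by (simp_all add: sq_integrable_def norm_L2_class)
qed

section \<open>Extension of the Fourier integral to square-integrable classes\<close>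

lemma niceD: "nice f \<Longrightarrow> integrable lborel f" "nice f \<Longrightarrow> sq_integrable f"
  by (simp_all add: nice_def)

text \<open>The Fourier integral defines \<open>T0\<close> on the dense set \<open>D\<close> of
  classes with integrable representatives. Plancherel, applied to differences, makes
  \<open>T0\<close> isometric, so it extends to the closure, which is everything. Two continuous
  candidates agree on \<open>nice\<close> functions, hence the description denotes this
  extension.\<close>

lemma
  shows continuous_fourier: "continuous_on UNIV fourier"
    and fourier_class: "sq_integrable f \<Longrightarrow> integrable lborel f \<Longrightarrow> fourier (L2_class f) = L2_class (fourier_integral f)"
proof -
  define D where "D = {u :: L2q. integrable lborel (L2_fun u)}"
  define T0 where "T0 u = L2_class (fourier_integral (L2_fun u))" for u
  have class_D: "L2_class f \<in> D" "T0 (L2_class f) = L2_class (fourier_integral f)"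
    if f: "sq_integrable f" "integrable lborel f" for f
  proof -
    have ae: "AE x in lborel. L2_fun (L2_class f) x = f x"
      by (rule L2_fun_class[OF f(1)])
    have m: "L2_fun (L2_class f) \<in> borel_measurable borel" "f \<in> borel_measurable borel"
      using sq_integrable_L2_fun f(1) by (auto intro: sq_integrable_measurable)
    show "L2_class f \<in> D"
      unfolding D_def mem_Collect_eq
      by (subst integrable_cong_AE[OF _ _ ae]) (use m f in auto)
    show "T0 (L2_class f) = L2_class (fourier_integral f)"
      unfolding T0_def by (subst fourier_integral_cong_AE[OF m ae]) simp
  qed
  have D_closure: "closure D = UNIV"
  proof -
    have "{L2_class g | g. nice g} \<subseteq> D"
      using class_D(1) niceD by blast
    then show ?thesis
      using closure_mono closure_nice by blast
  qed
  have dist: "dist (T0 u) (T0 v) = dist u v" if uv: "u \<in> D" "v \<in> D" for u v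
  proof -
    let ?f = "L2_fun u" and ?g = "L2_fun v"
    have i: "integrable lborel ?f" "integrable lborel ?g"
      using uv by (auto simp: D_def)
    have fg: "integrable lborel (\<lambda>x. ?f x - ?g x)" "sq_integrable (\<lambda>x. ?f x - ?g x)"
      by (auto intro!: i sq_integrable_diff sq_integrable_L2_fun)
    have "fourier_integral (\<lambda>x. ?f x - ?g x) = (\<lambda>\<xi>. fourier_integral ?f \<xi> - fourier_integral ?g \<xi>)"
      by (intro ext fourier_integral_diff i)
    then have "T0 u - T0 v = L2_class (fourier_integral (\<lambda>x. ?f x - ?g x))"
      unfolding T0_def
      by (simp add: L2_class_diff Plancherel(1) i sq_integrable_L2_fun)
    then have "(norm (T0 u - T0 v))\<^sup>2 = (norm (L2_class (\<lambda>x. ?f x - ?g x)))\<^sup>2"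
      by (simp add: norm_L2_class Plancherel[OF fg] fg)
    also have "L2_class (\<lambda>x. ?f x - ?g x) = u - v"
      by (simp add: L2_class_diff[symmetric] sq_integrable_L2_fun L2_class_fun)
    finally show ?thesis
      by (simp add: dist_norm power2_eq_iff_nonneg)
  qed
  have "uniformly_continuous_on D T0"
    unfolding uniformly_continuous_on_def using dist by auto
  then obtain T where T: "uniformly_continuous_on (closure D) T" "\<And>u. u \<in> D \<Longrightarrow> T0 u = T u"
    by (rule uniformly_continuous_on_extension_on_closure) blast
  have cont: "continuous_on UNIV T"
    using T(1) by (simp add: D_closure uniformly_continuous_imp_continuous)
  have T_class: "T (L2_class f) = L2_class (fourier_integral f)" if "sq_integrable f" "integrable lborel f" for f
    using T(2) class_D[OF that] by metis
  have "fourier = T"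
    unfolding fourier_def
  proof (rule the_equality)
    show "continuous_on UNIV T \<and> (\<forall>f. sq_integrable f \<and> integrable lborel f \<longrightarrow>
        (AE \<xi> in lborel. L2_fun (T (L2_class f)) \<xi> = fourier_integral f \<xi>))"
      using cont by (auto simp: T_class intro!: L2_fun_class Plancherel)
  next
    fix T' assume T': "continuous_on UNIV T' \<and> (\<forall>f. sq_integrable f \<and> integrable lborel f \<longrightarrow>
        (AE \<xi> in lborel. L2_fun (T' (L2_class f)) \<xi> = fourier_integral f \<xi>))"
    show "T' = T"
    proof
      fix u
      show "T' u = T u"
      proof (induction u rule: L2_dense_induct)
        case closed
        show ?case using T' cont by (intro closed_Collect_eq) auto
      next
        case (nice g)
        have g: "sq_integrable g" "integrable lborel g"
          using nice by (simp_all add: niceD)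
        have ae: "AE \<xi> in lborel. L2_fun (T' (L2_class g)) \<xi> = fourier_integral g \<xi>"
          using T' g by blast
        have "T' (L2_class g) = L2_class (fourier_integral g)"
          using L2_class_eqI[OF sq_integrable_L2_fun Plancherel(1)[OF g(2,1)] ae] by (simp add: L2_class_fun)
        then show ?case by (simp add: T_class g)
      qed
    qed
  qed
  then show "continuous_on UNIV fourier"
    "sq_integrable f \<Longrightarrow> integrable lborel f \<Longrightarrow> fourier (L2_class f) = L2_class (fourier_integral f)"
    using cont T_class by auto
qed

lemma fourier_nice: "nice f \<Longrightarrow> fourier (L2_class f) = L2_class (fourier_integral f)"
  by (simp add: fourier_class niceD)

lemma continuous_on_L2_scale: "continuous_on UNIV (L2_scale c)"
proof -
  have "L2_scale c u - L2_scale c v = L2_scale c (u - v)" for u v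
    using L2_scale_add[of c "u - v" v] by simp
  then have "(cmod c)-lipschitz_on UNIV (L2_scale c)"
    by (intro lipschitz_onI) (auto simp: dist_norm norm_L2_scale)
  then show ?thesis by (rule lipschitz_on_continuous_on)
qed

lemma cisometry_fourier: "cisometry fourier"
proof -
  have cont: "continuous_on A (\<lambda>x. fourier (p x))" if "continuous_on A p" for p :: "L2q \<Rightarrow> L2q" and A
    using continuous_on_compose2[OF continuous_fourier that] by simp
  have add: "fourier (u + v) = fourier u + fourier v" for u v
  proof (induction u rule: L2_dense_induct)
    case closed
    show ?case by (intro closed_Collect_eq continuous_intros cont)
  next
    case (nice f)
    show ?case
    proof (induction v rule: L2_dense_induct)
      case closed
      show ?case by (intro closed_Collect_eq continuous_intros cont)
    next
      case (nice g)
      then have "fourier_integral (\<lambda>x. f x + g x) = (\<lambda>\<xi>. fourier_integral f \<xi> + fourier_integral g \<xi>)"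
        using \<open>nice f\<close> by (intro ext fourier_integral_add niceD)
      then show ?case
        using \<open>nice f\<close> \<open>nice g\<close>
        by (simp add: fourier_nice L2_class_add niceD Plancherel(1) fourier_class sq_integrable_add)
    qed
  qed
  have scale: "fourier (L2_scale c u) = L2_scale c (fourier u)" for c u
  proof (induction u rule: L2_dense_induct)
    case closed
    show ?case
      by (intro closed_Collect_eq cont continuous_on_L2_scale
          continuous_on_compose2[OF continuous_on_L2_scale continuous_fourier]) auto
  next
    case (nice f)
    have "integrable lborel (\<lambda>x. c *s f x)"
      by (intro integrable_bounded_linear[OF bounded_linear_smult] niceD nice)
    moreover have "fourier_integral (\<lambda>x. c *s f x) = (\<lambda>\<xi>. c *s fourier_integral f \<xi>)"
      by (intro ext fourier_integral_linear niceD nice bounded_linear_smult)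
        (simp add: vector_smult_assoc mult.commute)
    ultimately show ?case
      using nice by (simp add: fourier_nice L2_scale_class niceD Plancherel(1) fourier_class sq_integrable_smult)
  qed
  have norm: "norm (fourier u) = norm u" for u
  proof (induction u rule: L2_dense_induct)
    case closed
    show ?case by (intro closed_Collect_eq continuous_intros cont)
  next
    case (nice f)
    then have "(norm (fourier (L2_class f)))\<^sup>2 = (norm (L2_class f))\<^sup>2"
      by (simp add: fourier_nice norm_L2_class niceD Plancherel)
    then show ?case by (simp add: power2_eq_iff_nonneg)
  qed
  \<comment> \<open>Polarisation: the inner product is a combination of norms, and
    \<open>fourier\<close> is additive.\<close>
  have "fourier u \<bullet> fourier v = u \<bullet> v" for u v
    by (simp add: dot_norm norm add[symmetric])
  then show ?thesis
    using add scale by (auto simp: cisometry_def)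
qed

text \<open>An isometry reflects Cauchy sequences: if the images converge, completeness provides a
  limit of the preimages.\<close>

lemma cisometry_range_closed:
  assumes U: "cisometry U" and A: "closed A"
  shows "closed (U ` A)"
  unfolding closed_sequential_limits
proof (intro allI impI, elim conjE)
  fix y l assume y: "\<forall>n. y n \<in> U ` A" and l: "y \<longlonglongrightarrow> l"
  then have "\<forall>n. \<exists>x. x \<in> A \<and> y n = U x" by blast
  then obtain x where x: "\<And>n. x n \<in> A" "\<And>n. y n = U (x n)" by metis
  have "Cauchy y" using l by (rule LIMSEQ_imp_Cauchy)
  then have "Cauchy x"
    by (simp add: Cauchy_def x(2) cisometryD(7)[OF U])
  then obtain a where a: "x \<longlonglongrightarrow> a"
    using Cauchy_convergent convergent_def by blast
  then have "(\<lambda>n. U (x n)) \<longlonglongrightarrow> U a"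
    by (intro isCont_tendsto_compose[of _ U])
      (use cisometryD(8)[OF U, of UNIV] in \<open>simp add: continuous_on_eq_continuous_at\<close>)
  then have "U a = l"
    using LIMSEQ_unique l x(2) by (metis (no_types, lifting) ext)
  moreover have "a \<in> A"
    using closed_sequentially[OF A x(1) a] .
  ultimately show "l \<in> U ` A" by blast
qed

text \<open>
  For nice \<open>g\<close> with reflected transform \<open>u(x) = g^(- x)\<close>, the adjoint formula gives
  \<open>\<langle>F w, g\<rangle> = \<langle>w, u\<rangle>\<close> for all \<open>w\<close>; since \<open>F\<close> is isometric, \<open>w = u\<close> yields \<open>F u = g\<close>.
\<close>

lemma surj_fourier: "surj fourier"
proof -
  have "v \<in> range fourier" for v
  proof (induction v rule: L2_dense_induct)
    \<comment> \<open>The range of an isometry is closed, so it is enough to reach the dense set of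
      \<open>nice\<close> classes.\<close>
    case closed
    show ?case
      using cisometry_range_closed[OF cisometry_fourier closed_UNIV] by simp
  next
    case (nice g)
    then have g: "integrable lborel g" "sq_integrable g" by (simp_all add: niceD)
    note [measurable] = borel_measurable_fourier_integral[OF g(1)]
    let ?p = "\<lambda>x. (norm (fourier_integral g x))\<^sup>2"
    have refl: "distr lborel borel (\<lambda>x. - x) = (lborel :: (real ^ 3) measure)"
      using lborel_affine[of "-1" "0 :: real ^ 3"] by (simp add: density_1)
    have int: "integrable lborel ?p"
      using Plancherel(1)[OF g] by (simp add: sq_integrable_def)
    have "integrable (distr lborel borel (\<lambda>x. - x)) ?p"
      using int by (simp only: refl)
    then have "integrable lborel (\<lambda>x. ?p (- x))"
      by (subst (asm) integrable_distr_eq) auto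
    then have sq: "sq_integrable (\<lambda>x. fourier_integral g (- x))"
      by (simp add: sq_integrable_def)
    define u where "u = L2_class (\<lambda>x. fourier_integral g (- x))"
    have "(\<integral>x. ?p (- x) \<partial>lborel) = (\<integral>x. ?p x \<partial>distr lborel borel (\<lambda>x. - x))"
      by (subst integral_distr) auto
    then have "(norm u)\<^sup>2 = (\<integral>x. ?p x \<partial>lborel)"
      by (simp add: u_def norm_L2_class sq refl)
    then have nu: "u \<bullet> u = L2_class g \<bullet> L2_class g"
      by (simp add: power2_norm_eq_inner[symmetric] norm_L2_class g Plancherel(2)[OF g])
    have adj: "fourier w \<bullet> L2_class g = w \<bullet> u" for w
    proof (induction w rule: L2_dense_induct)
      case closed
      show ?case by (intro closed_Collect_eq continuous_intros continuous_fourier)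
    next
      case (nice f)
      then show ?case
        by (simp add: fourier_nice inner_L2_class Plancherel(1) niceD g u_def sq fourier_integral_adjoint)
    qed
    have "fourier u \<bullet> L2_class g = L2_class g \<bullet> L2_class g"
      by (simp only: adj nu)
    moreover have "fourier u \<bullet> fourier u = L2_class g \<bullet> L2_class g"
      by (simp only: cisometryD(3)[OF cisometry_fourier] nu)
    ultimately have "(fourier u - L2_class g) \<bullet> (fourier u - L2_class g) = 0"
      by (simp only: inner_diff_left inner_diff_right inner_commute[of "L2_class g" "fourier u"])
    then have "L2_class g = fourier u" by simp
    then show ?case by (rule range_eqI)
  qed
  then show ?thesis by blast
qed

subsection \<open>The Fourier transformation intertwines the two representations\<close>

definition tilde_fun :: "real \<Rightarrow> biquat \<Rightarrow> real ^ 3 \<Rightarrow> (real ^ 3 \<Rightarrow> biquat) \<Rightarrow> real ^ 3 \<Rightarrow> biquat" where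
  "tilde_fun r s b f y = wave (- (b \<bullet> y)) *s (r powr (3/2) *\<^sub>R (s \<star> f (simil (1/r) s 0 y)))"

text \<open>A phase of modulus 1 times an action already studied: integrability and norms are
  inherited.\<close>

lemma tilde_fun_nat_fun:
  "r > 0 \<Longrightarrow> tilde_fun r s b f y = wave (- (b \<bullet> y)) *s nat_fun (1/r) s 0 f y"
  by (simp add: tilde_fun_def nat_fun_def powr_divide powr_minus_divide)

context
  fixes r s assumes r: "r > (0::real)" and s: "s \<in> Spin3"
begin

lemma norm_tilde_fun: "norm (tilde_fun r s b f y) = norm (nat_fun (1/r) s 0 f y)"
  using r by (simp add: tilde_fun_nat_fun norm_smult)

lemma borel_measurable_tilde_fun:
  assumes "f \<in> borel_measurable borel"
  shows "tilde_fun r s b f \<in> borel_measurable borel"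
proof -
  have [measurable]: "nat_fun (1/r) s 0 f \<in> borel_measurable borel"
    using r s assms by (intro borel_measurable_nat_fun) auto
  show ?thesis
    unfolding tilde_fun_nat_fun[OF r, abs_def] by measurable
qed

lemma integrable_tilde_fun:
  assumes "integrable lborel f"
  shows "integrable lborel (tilde_fun r s b f)"
proof (rule Bochner_Integration.integrable_bound)
  show "integrable lborel (nat_fun (1/r) s 0 f)"
    using r s assms by (intro integrable_nat_fun) auto
  show "tilde_fun r s b f \<in> borel_measurable lborel"
    using borel_measurable_tilde_fun[of f b] assms by auto
qed (simp add: norm_tilde_fun)

lemma sq_integrable_tilde_fun:
  assumes "sq_integrable f"
  shows "sq_integrable (tilde_fun r s b f)"
proof (rule sq_integrable_bound[where C = 1])
  show "sq_integrable (nat_fun (1/r) s 0 f)"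
    using r s assms by (intro sq_integrable_nat_fun) auto
qed (use borel_measurable_tilde_fun[OF sq_integrable_measurable[OF assms]] in \<open>auto simp: norm_tilde_fun\<close>)

lemma tilde_rep_class:
  assumes f: "sq_integrable f"
  shows "tilde_rep (r, s, b) (L2_class f) = L2_class (tilde_fun r s b f)"
proof -
  have "tilde_rep (r, s, b) (L2_class f) = L2_class (tilde_fun r s b (L2_fun (L2_class f)))"
    by (simp add: tilde_rep_def tilde_fun_def[abs_def] simil_def wave_def)
  also have "\<dots> = L2_class (tilde_fun r s b f)"
  proof (rule L2_class_eqI)
    have "AE y in lborel. L2_fun (L2_class f) (simil (1/r) s 0 y) = f (simil (1/r) s 0 y)"
      using r by (intro AE_simil s L2_fun_class f) auto
    then show "AE y in lborel. tilde_fun r s b (L2_fun (L2_class f)) y = tilde_fun r s b f y"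
      by eventually_elim (simp add: tilde_fun_def)
  qed (intro sq_integrable_tilde_fun sq_integrable_L2_fun f)+
  finally show ?thesis .
qed

lemma norm_tilde_rep: "norm (tilde_rep (r, s, b) u) = norm u"
proof -
  obtain f where f: "sq_integrable f" "u = L2_class f" by (rule L2_cases)
  have "(norm (tilde_rep (r, s, b) u))\<^sup>2 = (norm (nat_rep (1/r, s, 0) u))\<^sup>2"
    using r s by (simp add: f tilde_rep_class nat_rep_class norm_L2_class sq_integrable_tilde_fun
        sq_integrable_nat_fun norm_tilde_fun)
  also have "\<dots> = (norm u)\<^sup>2"
    using r s by (simp add: cisometryD(6)[OF cisometry_nat_rep])
  finally show ?thesis by (simp add: power2_eq_iff_nonneg)
qed

lemma tilde_rep_diff: "tilde_rep (r, s, b) (u - v) = tilde_rep (r, s, b) u - tilde_rep (r, s, b) v"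
proof -
  obtain f where f: "sq_integrable f" "u = L2_class f" by (rule L2_cases)
  obtain g where g: "sq_integrable g" "v = L2_class g" by (rule L2_cases)
  have "tilde_fun r s b (\<lambda>x. f x - g x) = (\<lambda>x. tilde_fun r s b f x - tilde_fun r s b g x)"
    by (simp add: tilde_fun_def[abs_def] qmult.diff_right scaleR_diff_right smult.diff_right)
  then show ?thesis
    by (simp add: f g L2_class_diff tilde_rep_class sq_integrable_diff sq_integrable_tilde_fun)
qed

lemma continuous_tilde_rep: "continuous_on UNIV (tilde_rep (r, s, b))"
  by (auto simp: continuous_on_iff dist_norm tilde_rep_diff[symmetric] norm_tilde_rep)

text \<open>Substitute \<open>z = simil (1/r) s 0 x\<close>. Since rotations preserve inner
  products, the phase \<open>x \<bullet> \<xi> - b \<bullet> x\<close> becomes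
  \<open>z \<bullet> simil r s b \<xi>\<close>: modulation turns into translation and the dilation
  is inverted. The Jacobian \<open>(1/r)^3\<close> changes the exponent 3/2 into -3/2.\<close>

lemma fourier_integral_tilde_fun:
  assumes f: "integrable lborel f"
  shows "fourier_integral (tilde_fun r s b f) \<xi> = nat_fun r s b (fourier_integral f) \<xi>"
proof -
  define T where "T q = r powr (3/2) *\<^sub>R (s \<star> q)" for q
  have T: "bounded_linear T" "T (c *s q) = c *s T q" for c q
    unfolding T_def
    by (intro bounded_linear_compose[OF bounded_linear_scaleR_right qmult.bounded_linear_right])
      (simp add: qmult_bilinear scaleR_biquat vector_smult_assoc mult.commute)
  have Tf: "integrable lborel (\<lambda>x. T (f x))"
    by (rule integrable_bounded_linear[OF T(1) f])
  define F where "F z = wave (z \<bullet> simil r s b \<xi>) *s T (f z)" for z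
  have "x \<bullet> \<xi> + - (b \<bullet> x) = simil (1/r) s 0 x \<bullet> simil r s b \<xi>" for x
    using r s
    by (simp add: simil_def inner_rot qinv_in_Spin3 inner_diff_right inner_commute)
  then have "wave (x \<bullet> \<xi>) *s tilde_fun r s b f x = F (simil (1/r) s 0 x)" for x
    by (simp add: tilde_fun_def F_def T_def vector_smult_assoc flip: wave_add)
  then have "fourier_integral (tilde_fun r s b f) \<xi> = (\<integral>x. F (simil (1/r) s 0 x) \<partial>lborel)"
    by (simp add: fourier_integral_wave)
  also have "\<dots> = (1/r)^3 *\<^sub>R (\<integral>z. F z \<partial>lborel)"
    using integrable_wave[OF Tf] r s unfolding F_def by (intro integral_simil) auto
  also have "(\<integral>z. F z \<partial>lborel) = T (fourier_integral f (simil r s b \<xi>))"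
    unfolding F_def fourier_integral_wave[symmetric] by (rule fourier_integral_linear[OF f T])
  also have "(1/r)^3 *\<^sub>R T (fourier_integral f (simil r s b \<xi>)) = nat_fun r s b (fourier_integral f) \<xi>"
  proof -
    have "(1/r)^3 * r powr (3/2) = r powr (- 3) * r powr (3/2)"
      using r by (simp add: powr_minus powr_numeral power_divide divide_simps)
    also have "\<dots> = r powr (- (3/2))"
      by (simp add: powr_add[symmetric])
    finally show ?thesis by (simp add: T_def nat_fun_def)
  qed
  finally show ?thesis .
qed

lemma fourier_tilde_rep: "fourier (tilde_rep (r, s, b) u) = nat_rep (r, s, b) (fourier u)"
proof (induction u rule: L2_dense_induct)
  case closed
  show ?case
    by (intro closed_Collect_eq continuous_on_compose2[OF continuous_fourier continuous_tilde_rep]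
        continuous_on_compose2[OF cisometryD(8)[OF cisometry_nat_rep[OF r s]] continuous_fourier]) auto
next
  case (nice f)
  then have "fourier_integral (tilde_fun r s b f) = nat_fun r s b (fourier_integral f)"
    by (intro ext fourier_integral_tilde_fun niceD)
  then show ?case
    using nice r s
    by (simp add: tilde_rep_class fourier_nice niceD fourier_class sq_integrable_tilde_fun
        integrable_tilde_fun nat_rep_class Plancherel(1))
qed

end

subsection \<open>The left ideal\<close>

lemma S2_iff: "q \<in> S2 \<longleftrightarrow> q$2 = \<i> * q$1 \<and> q$3 = - \<i> * q$0"
proof
  assume "q \<in> S2"
  then show "q$2 = \<i> * q$1 \<and> q$3 = - \<i> * q$0"
    by (auto simp: S2_def)
next
  assume "q$2 = \<i> * q$1 \<and> q$3 = - \<i> * q$0"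
  then have "q = q$0 *s (qone - \<i> *s e3) + q$1 *s (e1 + \<i> *s e2)"
    by (simp add: biquat_eq_iff)
  then show "q \<in> S2"
    unfolding S2_def by blast
qed

text \<open>\<open>(1 - i e\<^sub>3)/2\<close> is an idempotent generating \<open>S\<^sub>2\<close>.\<close>

lemma S2_iff_qmult: "q \<in> S2 \<longleftrightarrow> q \<star> (qone - \<i> *s e3) = 2 *s q"
  unfolding S2_iff biquat_eq_iff by (auto simp: complex_eq_iff)

lemma S2_qmult: "q \<in> S2 \<Longrightarrow> p \<star> q \<in> S2"
  by (simp add: S2_iff_qmult qmult_assoc qmult_bilinear)

lemma S2_add: "p \<in> S2 \<Longrightarrow> q \<in> S2 \<Longrightarrow> p + q \<in> S2"
  by (simp add: S2_iff algebra_simps)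

lemma S2_smult: "q \<in> S2 \<Longrightarrow> c *s q \<in> S2"
  by (simp add: S2_iff)

lemma S2_scaleR: "q \<in> S2 \<Longrightarrow> c *\<^sub>R q \<in> S2"
  by (simp add: scaleR_biquat S2_smult)

lemma S2_0: "0 \<in> S2"
  by (simp add: S2_iff)

lemma closed_S2: "closed S2"
proof -
  have *: "S2 = {q. q$2 = \<i> * q$1 \<and> q$3 = - \<i> * q$0}"
    using S2_iff by blast
  show ?thesis
    unfolding * by (intro closed_Collect_conj closed_Collect_eq continuous_intros)
qed

lemma closed_csubspace_AE:
  fixes E :: "real ^ 3 \<Rightarrow> biquat set"
  assumes "\<And>x. closed (E x)" "\<And>x. 0 \<in> E x" "\<And>x p q. p \<in> E x \<Longrightarrow> q \<in> E x \<Longrightarrow> p + q \<in> E x"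
    and "\<And>x c q. q \<in> E x \<Longrightarrow> c *s q \<in> E x"
  shows "closed_csubspace {u. AE x in lborel. L2_fun u x \<in> E x}"
  unfolding closed_csubspace_def
proof (intro conjI ballI allI)
  show "closed {u. AE x in lborel. L2_fun u x \<in> E x}"
    by (rule closed_AE_L2) (rule assms)
  have "AE x in lborel. L2_fun 0 x \<in> E x"
    using L2_fun_zero[where 'a = "real ^ 3" and 'b = biquat] by eventually_elim (simp add: assms)
  then show "0 \<in> {u. AE x in lborel. L2_fun u x \<in> E x}" by simp
next
  fix u v :: L2q assume "u \<in> {u. AE x in lborel. L2_fun u x \<in> E x}" "v \<in> {u. AE x in lborel. L2_fun u x \<in> E x}"
  then have "AE x in lborel. L2_fun u x \<in> E x" "AE x in lborel. L2_fun v x \<in> E x" by simp_all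
  then have "AE x in lborel. L2_fun (u + v) x \<in> E x"
    using L2_fun_add[of u v] by eventually_elim (simp add: assms)
  then show "u + v \<in> {u. AE x in lborel. L2_fun u x \<in> E x}" by simp
next
  fix c and u :: L2q assume "u \<in> {u. AE x in lborel. L2_fun u x \<in> E x}"
  then have "AE x in lborel. L2_fun u x \<in> E x" by simp
  then have "AE x in lborel. L2_fun (L2_scale c u) x \<in> E x"
    using L2_fun_scale[of c u] by eventually_elim (simp add: assms)
  then show "L2_scale c u \<in> {u. AE x in lborel. L2_fun u x \<in> E x}" by simp
qed

lemma closed_csubspace_L2_S2: "closed_csubspace L2_S2"
  unfolding L2_S2_def
  by (rule closed_csubspace_AE) (auto intro: closed_S2 S2_0 S2_add S2_smult)

text \<open>Expresses membership in \<open>L2_S2\<close> as the operator equation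
  \<open>right_S2 u = L2_scale 2 u\<close>. Right multiplication by a constant commutes with the
  Fourier transformation, so the equation survives it.\<close>

definition right_S2 :: "L2q \<Rightarrow> L2q" where
  "right_S2 u = L2_class (\<lambda>x. L2_fun u x \<star> (qone - \<i> *s e3))"

lemma norm_L2_class_le:
  assumes "sq_integrable f" "sq_integrable g" "0 \<le> C" "\<And>x. norm (f x) \<le> C * norm (g x)"
  shows "norm (L2_class f) \<le> C * norm (L2_class g)"
proof -
  have "(norm (L2_class f))\<^sup>2 \<le> (\<integral>x. C\<^sup>2 * (norm (g x))\<^sup>2 \<partial>lborel)"
    unfolding norm_L2_class[OF assms(1)]
  proof (rule integral_mono)
    show "(norm (f x))\<^sup>2 \<le> C\<^sup>2 * (norm (g x))\<^sup>2" for x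
      using power_mono[OF assms(4)[of x], of 2] by (simp add: power_mult_distrib)
  qed (use assms in \<open>simp_all add: sq_integrable_integrable\<close>)
  also have "\<dots> = (C * norm (L2_class g))\<^sup>2"
    using assms by (simp add: norm_L2_class power_mult_distrib)
  finally show ?thesis
    using assms(3) by (simp add: power2_le_iff_abs_le)
qed

lemma
  shows sq_integrable_right_S2: "sq_integrable f \<Longrightarrow> sq_integrable (\<lambda>x. f x \<star> (qone - \<i> *s e3))"
    and continuous_right_S2: "continuous_on UNIV right_S2"
    and right_S2_class: "sq_integrable f \<Longrightarrow> right_S2 (L2_class f) = L2_class (\<lambda>x. f x \<star> (qone - \<i> *s e3))"
proof -
  let ?p = "qone - \<i> *s e3"
  obtain C where C: "C > 0" "\<And>q. norm (q \<star> ?p) \<le> norm q * C"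
    using bounded_linear.pos_bounded[OF qmult.bounded_linear_left] by blast
  show sq: "sq_integrable (\<lambda>x. f x \<star> ?p)" if "sq_integrable f" for f :: "real ^ 3 \<Rightarrow> biquat"
    using that C(2) sq_integrable_measurable[OF that]
    by (intro sq_integrable_bound[OF that, where C = C]) (auto simp: mult.commute)
  show cl: "right_S2 (L2_class f) = L2_class (\<lambda>x. f x \<star> ?p)" if f: "sq_integrable f" for f
    unfolding right_S2_def
  proof (rule L2_class_eqI)
    show "AE x in lborel. L2_fun (L2_class f) x \<star> ?p = f x \<star> ?p"
      using L2_fun_class[OF f] by eventually_elim simp
  qed (intro sq sq_integrable_L2_fun f)+
  have "norm (right_S2 u - right_S2 v) \<le> C * norm (u - v)" for u v
  proof -
    obtain f where f: "sq_integrable f" "u = L2_class f" by (rule L2_cases)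
    obtain g where g: "sq_integrable g" "v = L2_class g" by (rule L2_cases)
    have "right_S2 u - right_S2 v = L2_class (\<lambda>x. (f x - g x) \<star> ?p)"
      by (simp add: f g cl L2_class_diff sq qmult.diff_left)
    also have "norm \<dots> \<le> C * norm (L2_class (\<lambda>x. f x - g x))"
      using C by (intro norm_L2_class_le sq sq_integrable_diff f g) (auto simp: mult.commute)
    finally show ?thesis by (simp add: f g L2_class_diff)
  qed
  then have "C-lipschitz_on UNIV right_S2"
    using C(1) by (intro lipschitz_onI) (auto simp: dist_norm)
  then show "continuous_on UNIV right_S2"
    by (rule lipschitz_on_continuous_on)
qed

lemma fourier_right_S2: "fourier (right_S2 u) = right_S2 (fourier u)"
proof (induction u rule: L2_dense_induct)
  case closed
  show ?case
    by (intro closed_Collect_eq continuous_on_compose2[OF continuous_fourier continuous_right_S2]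
        continuous_on_compose2[OF continuous_right_S2 continuous_fourier]) auto
next
  case (nice f)
  let ?p = "qone - \<i> *s e3"
  have "fourier_integral (\<lambda>x. f x \<star> ?p) = (\<lambda>\<xi>. fourier_integral f \<xi> \<star> ?p)"
    by (intro ext fourier_integral_linear[where T = "\<lambda>q. q \<star> ?p"] niceD nice qmult.bounded_linear_left)
      (simp add: qmult_bilinear)
  moreover have "integrable lborel (\<lambda>x. f x \<star> ?p)"
    by (intro integrable_bounded_linear[OF qmult.bounded_linear_left] niceD nice)
  ultimately show ?case
    using nice
    by (simp add: right_S2_class niceD fourier_nice fourier_class sq_integrable_right_S2 Plancherel(1))
qed

lemma L2_S2_iff: "u \<in> L2_S2 \<longleftrightarrow> right_S2 u = L2_scale 2 u"
proof -
  have R: "AE x in lborel. L2_fun (right_S2 u) x = L2_fun u x \<star> (qone - \<i> *s e3)"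
    unfolding right_S2_def by (intro L2_fun_class sq_integrable_right_S2 sq_integrable_L2_fun)
  show ?thesis
  proof
    assume "u \<in> L2_S2"
    then have "AE x in lborel. L2_fun u x \<in> S2" by (simp add: L2_S2_def)
    then have "AE x in lborel. L2_fun (right_S2 u) x = L2_fun (L2_scale 2 u) x"
      using R L2_fun_scale[of 2 u] by eventually_elim (simp add: S2_iff_qmult)
    then show "right_S2 u = L2_scale 2 u" by (rule L2_eqI)
  next
    assume eq: "right_S2 u = L2_scale 2 u"
    have "AE x in lborel. L2_fun u x \<in> S2"
      using R L2_fun_scale[of 2 u] unfolding eq by eventually_elim (simp add: S2_iff_qmult)
    then show "u \<in> L2_S2" by (simp add: L2_S2_def)
  qed
qed

text \<open>\<open>fourier\<close> commutes with both sides of the equation characterising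
  \<open>L2_S2\<close>; injectivity gives the equivalence of membership, and surjectivity of
  \<open>fourier\<close> makes the image the whole space.\<close>

lemma fourier_L2_S2: "fourier ` L2_S2 = L2_S2"
proof -
  have iff: "fourier u \<in> L2_S2 \<longleftrightarrow> u \<in> L2_S2" for u
    unfolding L2_S2_iff fourier_right_S2[symmetric] cisometryD(2)[OF cisometry_fourier, symmetric]
    by (rule inj_eq[OF cisometryD(9)[OF cisometry_fourier]])
  show ?thesis
  proof
    show "fourier ` L2_S2 \<subseteq> L2_S2"
      using iff by blast
    show "L2_S2 \<subseteq> fourier ` L2_S2"
    proof
      fix v assume "v \<in> L2_S2"
      moreover obtain u where "v = fourier u"
        using surj_fourier by (rule surjE)
      ultimately show "v \<in> fourier ` L2_S2"
        using iff[of u] by blast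
    qed
  qed
qed

subsection \<open>The eigenspaces of multiplication by the direction\<close>

text \<open>Division by zero makes \<open>dirq 0 = 0\<close>, which is not a unit; this point is
  removed by \<open>AE_nonzero\<close>.\<close>

definition dirq :: "real ^ 3 \<Rightarrow> biquat" where
  "dirq y = qvec (y /\<^sub>R norm y)"

text \<open>
  \<open>H_tilde_minus \<gamma>\<close> and \<open>H_tilde_plus \<gamma>\<close> are the eigenspaces in \<open>L\<^sup>2(\<real>\<^sup>3, S\<^sub>2)\<close> of left multiplication
  by \<open>y/\<bar>y\<bar> = \<gamma> e\<^sub>3 \<gamma>\<^sup>-\<^sup>1\<close> for the eigenvalues \<open>i\<close> and \<open>-i\<close>, and so do not depend on \<open>\<gamma>\<close>.
\<close>

definition dir_eigen :: "complex \<Rightarrow> real ^ 3 \<Rightarrow> biquat set" where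
  "dir_eigen \<sigma> y = {q \<in> S2. dirq y \<star> q = \<sigma> *s q}"

definition H_eigen :: "complex \<Rightarrow> L2q set" where
  "H_eigen \<sigma> = {u. AE y in lborel. L2_fun u y \<in> dir_eigen \<sigma> y}"

lemma closed_csubspace_H_eigen: "closed_csubspace (H_eigen \<sigma>)"
  unfolding H_eigen_def
proof (rule closed_csubspace_AE)
  show "closed (dir_eigen \<sigma> x)" for x
  proof -
    have "dir_eigen \<sigma> x = S2 \<inter> {q. dirq x \<star> q = \<sigma> *s q}"
      by (auto simp: dir_eigen_def)
    moreover have "closed {q. dirq x \<star> q = \<sigma> *s q}"
      by (intro closed_Collect_eq qmult.continuous_on smult.continuous_on continuous_intros)
    ultimately show ?thesis
      by (simp add: closed_S2 closed_Int)
  qed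
qed (auto simp: dir_eigen_def S2_0 S2_add S2_smult qmult.add_right vector_add_ldistrib qmult_bilinear
    vector_smult_assoc mult.commute qmult.zero_right)

lemma AE_nonzero: "AE y in lborel. (y :: real ^ 3) \<noteq> 0"
  by (rule AE_lborel_singleton)

lemma dirq_Spin3: "y \<noteq> 0 \<Longrightarrow> dirq y \<in> Spin3"
  unfolding Spin3_iff all_index4 by (simp add: dirq_def norm_qvec)

lemma qvec_square: "qvec x \<star> qvec x = of_real (- (x \<bullet> x)) *s qone"
  by (simp add: biquat_eq_iff inner_vec_def sum_3)

lemma dirq_square: "y \<noteq> 0 \<Longrightarrow> dirq y \<star> (dirq y \<star> q) = - q"
proof -
  assume "y \<noteq> 0"
  then have "(y /\<^sub>R norm y) \<bullet> (y /\<^sub>R norm y) = 1"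
    by (simp add: power2_norm_eq_inner[symmetric])
  then have "dirq y \<star> dirq y = (- 1) *s qone"
    by (simp only: dirq_def qvec_square of_real_minus of_real_1)
  then have "dirq y \<star> (dirq y \<star> q) = ((- 1) *s qone) \<star> q"
    by (simp only: qmult_assoc[symmetric])
  also have "\<dots> = - q"
    by (simp add: biquat_eq_iff)
  finally show ?thesis .
qed

text \<open>Pointwise, left multiplication by the unit \<open>dirq y\<close> is isometric, so
  \<open>p \<bullet> q\<close> equals \<open>((- \<i>) *s p) \<bullet> (\<i> *s q)\<close>, which is
  \<open>- (p \<bullet> q)\<close>.\<close>

lemma inner_H_eigen:
  assumes u: "u \<in> H_eigen (- \<i>)" and v: "v \<in> H_eigen \<i>"
  shows "u \<bullet> v = 0"
proof -
  have "AE y in lborel. L2_fun u y \<in> dir_eigen (- \<i>) y" "AE y in lborel. L2_fun v y \<in> dir_eigen \<i> y"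
    using u v by (simp_all add: H_eigen_def)
  then have "AE y in lborel. L2_fun u y \<bullet> L2_fun v y = 0"
    using AE_nonzero
  proof eventually_elim
    case (elim y)
    let ?p = "L2_fun u y" and ?q = "L2_fun v y"
    have "?p \<bullet> ?q = (dirq y \<star> ?p) \<bullet> (dirq y \<star> ?q)"
      using inner_Spin3_left[OF dirq_Spin3[OF elim(3)]] by simp
    also have "\<dots> = ((- \<i>) *s ?p) \<bullet> (\<i> *s ?q)"
      using elim by (simp add: dir_eigen_def)
    also have "\<dots> = - (?p \<bullet> ?q)"
      unfolding inner_smult vector_smult_assoc by (simp flip: vector_sneg_minus1)
    finally show ?case by simp
  qed
  then have "(\<integral>y. L2_fun u y \<bullet> L2_fun v y \<partial>lborel) = 0"
    by (rule integral_eq_zero_AE)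
  then show ?thesis by (simp add: inner_L2_fun)
qed

lemma borel_measurable_dirq [measurable]: "dirq \<in> borel_measurable borel"
proof -
  have "qvec \<in> borel_measurable borel"
    by (intro borel_measurable_continuous_onI linear_continuous_on qvec_bounded_linear)
  then show ?thesis
    unfolding dirq_def[abs_def] by measurable
qed

lemma L2_S2_decomposition:
  assumes u: "u \<in> L2_S2"
  obtains v w where "v \<in> H_eigen (- \<i>)" "w \<in> H_eigen \<i>" "u = v + w"
proof -
  define f where "f = L2_fun u"
  have f: "sq_integrable f" "u = L2_class f"
    by (simp_all add: f_def sq_integrable_L2_fun L2_class_fun)
  have S2: "AE y in lborel. f y \<in> S2"
    using u by (simp add: f_def L2_S2_def)
  have [measurable]: "f \<in> borel_measurable borel"
    using f(1) by (rule sq_integrable_measurable)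
  \<comment> \<open>The spectral projection \<open>(1 - \<sigma> D)/2\<close> for left
    multiplication \<open>D\<close> by \<open>dirq y\<close>: from \<open>D\<^sup>2 = - 1\<close>
    and \<open>\<sigma>\<^sup>2 = - 1\<close> follows \<open>D P = \<sigma> P\<close>, and the
    projections for the two signs add up to the identity.\<close>
  define P where "P \<sigma> y = (1/2) *s (f y - \<sigma> *s (dirq y \<star> f y))" for \<sigma> y
  have P: "sq_integrable (P \<sigma>)" "L2_class (P \<sigma>) \<in> H_eigen \<sigma>" if \<sigma>: "\<sigma> * \<sigma> = - 1" "cmod \<sigma> = 1" for \<sigma>
  proof -
    show sq: "sq_integrable (P \<sigma>)"
    proof (rule sq_integrable_bound[OF f(1), where C = 1])
      show "P \<sigma> \<in> borel_measurable borel"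
        unfolding P_def[abs_def] by measurable
      show "AE y in lborel. norm (P \<sigma> y) \<le> 1 * norm (f y)"
        using AE_nonzero
      proof eventually_elim
        case (elim y)
        have "norm (f y - \<sigma> *s (dirq y \<star> f y)) \<le> norm (f y) + norm (\<sigma> *s (dirq y \<star> f y))"
          by (rule norm_triangle_ineq4)
        also have "\<dots> = 2 * norm (f y)"
          using \<sigma> elim by (simp add: norm_smult norm_Spin3_left dirq_Spin3)
        finally show ?case unfolding P_def norm_smult by simp
      qed
    qed
    have "AE y in lborel. L2_fun (L2_class (P \<sigma>)) y \<in> dir_eigen \<sigma> y"
      using L2_fun_class[OF sq] S2 AE_nonzero
    proof eventually_elim
      case (elim y)
      have P_eq: "P \<sigma> y = (1/2) *s (f y + (- \<sigma>) *s (dirq y \<star> f y))"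
        by (simp add: P_def biquat_eq_iff)
      have "P \<sigma> y \<in> S2"
        unfolding P_eq by (intro S2_smult S2_add S2_qmult elim(2))
      moreover have "dirq y \<star> P \<sigma> y = \<sigma> *s P \<sigma> y"
      proof -
        have "dirq y \<star> P \<sigma> y = (1/2) *s (dirq y \<star> f y + \<sigma> *s f y)"
          using elim by (simp add: P_def qmult_bilinear qmult.diff_right dirq_square smult.minus_right)
        also have "\<dots> = \<sigma> *s P \<sigma> y"
          using \<sigma>(1) by (simp add: P_def smult.diff_right vector_add_ldistrib vector_smult_assoc mult_ac
              biquat_eq_iff algebra_simps)
        finally show ?thesis .
      qed
      ultimately show ?case
        using elim by (simp add: dir_eigen_def)
    qed
    then show "L2_class (P \<sigma>) \<in> H_eigen \<sigma>" by (simp add: H_eigen_def)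
  qed
  have "P (- \<i>) y + P \<i> y = f y" for y
    by (simp add: P_def biquat_eq_iff algebra_simps)
  then have "u = L2_class (P (- \<i>)) + L2_class (P \<i>)"
    by (simp add: f(2) L2_class_add P)
  with P show ?thesis
    by (intro that[of "L2_class (P (- \<i>))" "L2_class (P \<i>)"]) simp_all
qed

text \<open>\<gamma> is measurable only on the sphere, so measurability is obtained off the origin,
  where normalisation lands in the sphere, and extended by the constant \<open>\<gamma> 0\<close> at
  the single remaining point.\<close>

lemma spin_choice_measurable:
  assumes "spin_choice \<gamma>"
  shows "(\<lambda>y. \<gamma> (y /\<^sub>R norm y)) \<in> borel_measurable borel"
proof -
  have n: "(\<lambda>y :: real ^ 3. y /\<^sub>R norm y) \<in> measurable (restrict_space borel (- {0})) (restrict_space borel (sphere 0 1))"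
    by (intro measurable_restrict_space3) auto
  have "(\<lambda>y. \<gamma> (y /\<^sub>R norm y)) \<in> measurable (restrict_space borel (- {0})) borel"
    using assms by (intro measurable_compose[OF n]) (simp add: spin_choice_def)
  then have "(\<lambda>y. if y \<in> - {0} then \<gamma> (y /\<^sub>R norm y) else \<gamma> 0) \<in> borel_measurable borel"
    by (subst (asm) measurable_restrict_space_iff[where c = "\<gamma> 0"]) auto
  also have "(\<lambda>y. if y \<in> - {0} then \<gamma> (y /\<^sub>R norm y) else \<gamma> 0) = (\<lambda>y. \<gamma> (y /\<^sub>R norm y))"
    by auto
  finally show ?thesis .
qed

text \<open>Conjugation by \<open>g y\<close> carries \<open>e3\<close> to \<open>dirq y\<close>, so
  left multiplication by \<open>g y\<close> carries the \<sigma>-eigenspace of \<open>e3\<close> in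
  \<open>S2\<close> onto that of \<open>dirq y\<close>. The former is the line spanned by
  \<open>v\<close>, normalised so that coordinate \<open>k\<close> reads off the
  coefficient.\<close>

lemma H_tilde_eq_H_eigen:
  fixes v :: biquat
  assumes \<gamma>: "spin_choice \<gamma>"
    and v: "\<And>q. q \<in> S2 \<and> e3 \<star> q = \<sigma> *s q \<longleftrightarrow> q = q$k *s v" "v$k = 1"
  shows "{L2_class (\<lambda>y. \<gamma> (y /\<^sub>R norm y) \<star> (\<alpha> y *s v)) | \<alpha>. sq_integrable (\<alpha> :: real ^ 3 \<Rightarrow> complex)} = H_eigen \<sigma>"
proof -
  define g where "g y = \<gamma> (y /\<^sub>R norm y)" for y
  have [measurable]: "g \<in> borel_measurable borel"
    unfolding g_def[abs_def] using \<gamma> by (rule spin_choice_measurable)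
  have g: "g y \<in> Spin3" "g y \<star> e3 \<star> qinv (g y) = dirq y" if "y \<noteq> 0" for y
    using \<gamma> that by (auto simp: spin_choice_def g_def dirq_def)
  have v_eigen: "a *s v \<in> S2" "e3 \<star> (a *s v) = \<sigma> *s (a *s v)" for a
    using v(1)[of "a *s v"] v(2) by simp_all
  have "L2_class (\<lambda>y. g y \<star> (\<alpha> y *s v)) \<in> H_eigen \<sigma>" if \<alpha>: "sq_integrable \<alpha>" for \<alpha>
  proof -
    have [measurable]: "\<alpha> \<in> borel_measurable borel"
      using \<alpha> by (rule sq_integrable_measurable)
    have sq: "sq_integrable (\<lambda>y. g y \<star> (\<alpha> y *s v))"
    proof (rule sq_integrable_bound[OF \<alpha>, where C = "norm v"])
      show "AE y in lborel. norm (g y \<star> (\<alpha> y *s v)) \<le> norm v * norm (\<alpha> y)"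
        using AE_nonzero by eventually_elim (simp add: norm_Spin3_left g norm_smult mult.commute)
    qed measurable
    have "AE y in lborel. L2_fun (L2_class (\<lambda>y. g y \<star> (\<alpha> y *s v))) y \<in> dir_eigen \<sigma> y"
      using L2_fun_class[OF sq] AE_nonzero
    proof eventually_elim
      case (elim y)
      have "dirq y \<star> (g y \<star> (\<alpha> y *s v)) = g y \<star> (e3 \<star> (\<alpha> y *s v))"
        by (simp only: g(2)[OF elim(2), symmetric] qmult_assoc qinv_cancel(1)[OF g(1)[OF elim(2)]])
      also have "\<dots> = \<sigma> *s (g y \<star> (\<alpha> y *s v))"
        unfolding v_eigen(2) by (rule qmult_bilinear(4))
      finally show ?case
        unfolding elim(1) dir_eigen_def using S2_qmult[OF v_eigen(1)] by blast
    qed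
    then show ?thesis by (simp add: H_eigen_def)
  qed
  moreover have "\<exists>\<alpha>. u = L2_class (\<lambda>y. g y \<star> (\<alpha> y *s v)) \<and> sq_integrable (\<alpha> :: real ^ 3 \<Rightarrow> complex)"
    if u: "u \<in> H_eigen \<sigma>" for u
  proof -
    define f where "f = L2_fun u"
    have f: "sq_integrable f" "u = L2_class f"
      by (simp_all add: f_def sq_integrable_L2_fun L2_class_fun)
    have [measurable]: "f \<in> borel_measurable borel"
      using f(1) by (rule sq_integrable_measurable)
    have eig: "AE y in lborel. f y \<in> dir_eigen \<sigma> y"
      using u by (simp add: f_def H_eigen_def)
    \<comment> \<open>The coefficient of \<open>qinv (g y) \<star> f y\<close> along
      \<open>v\<close>, written with \<open>qconj\<close> so that measurability is immediate. Being
      a coordinate after an isometry, it is bounded by \<open>norm (f y)\<close> away from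
      0.\<close>
    define \<alpha> where "\<alpha> y = (qconj (g y) \<star> f y) $ k" for y
    have "continuous_on UNIV qconj"
      unfolding qconj_def by (intro continuous_intros smult.continuous_on)
    then have [measurable]: "qconj \<in> borel_measurable borel"
      by (rule borel_measurable_continuous_onI)
    have [measurable]: "(\<lambda>q :: biquat. q $ k) \<in> borel_measurable borel"
      by (intro borel_measurable_continuous_onI continuous_intros)
    have \<alpha>: "sq_integrable \<alpha>"
    proof (rule sq_integrable_bound[OF f(1), where C = 1])
      show "\<alpha> \<in> borel_measurable borel"
        unfolding \<alpha>_def[abs_def] by measurable
      show "AE y in lborel. norm (\<alpha> y) \<le> 1 * norm (f y)"
        using AE_nonzero
      proof eventually_elim
        case (elim y)
        have "norm (\<alpha> y) \<le> norm (qinv (g y) \<star> f y)"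
          using Finite_Cartesian_Product.norm_nth_le[of "qinv (g y) \<star> f y" k] by (simp add: \<alpha>_def qinv_Spin3 g elim)
        then show ?case
          by (simp add: norm_Spin3_left qinv_in_Spin3 g elim)
      qed
    qed
    have ae: "AE y in lborel. f y = g y \<star> (\<alpha> y *s v)"
      using eig AE_nonzero
    proof eventually_elim
      case (elim y)
      let ?q = "qinv (g y) \<star> f y"
      have "e3 \<star> ?q = qinv (g y) \<star> (dirq y \<star> f y)"
        by (simp add: g(2)[OF elim(2), symmetric] qmult_assoc qinv_cancel g elim)
      also have "\<dots> = \<sigma> *s ?q"
        using elim by (simp add: dir_eigen_def qmult_bilinear)
      finally have "?q = ?q $ k *s v"
        using v(1)[of ?q] elim by (simp add: dir_eigen_def S2_qmult)
      then have "?q = \<alpha> y *s v"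
        by (simp add: \<alpha>_def qinv_Spin3 g elim)
      then show ?case
        using qinv_cancel(2)[OF g(1)[OF elim(2)], of "f y"] by simp
    qed
    have "sq_integrable (\<lambda>y. g y \<star> (\<alpha> y *s v))"
    proof (rule sq_integrable_bound[OF f(1), where C = 1])
      have [measurable]: "\<alpha> \<in> borel_measurable borel"
        using \<alpha> by (rule sq_integrable_measurable)
      show "(\<lambda>y. g y \<star> (\<alpha> y *s v)) \<in> borel_measurable borel"
        by measurable
    qed (use ae in auto)
    then have "u = L2_class (\<lambda>y. g y \<star> (\<alpha> y *s v))"
      unfolding f(2) using f(1) ae by (intro L2_class_eqI)
    with \<alpha> show ?thesis by blast
  qed
  ultimately show ?thesis
    unfolding g_def by blast
qed

text \<open>The eigenvalue comes from \<open>e3 \<star> e3 = - qone\<close>: multiplying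
  \<open>1 - i e3\<close> by \<open>e3\<close> gives \<open>e3 + i\<close>, which is
  \<open>i (1 - i e3)\<close>.\<close>

lemma S2_eigen_minus: "q \<in> S2 \<and> e3 \<star> q = \<i> *s q \<longleftrightarrow> q = q$0 *s (qone - \<i> *s e3)"
proof
  assume q: "q \<in> S2 \<and> e3 \<star> q = \<i> *s q"
  have "q$2 = \<i> * q$1" "q$3 = - \<i> * q$0"
    using q by (simp_all add: S2_iff)
  moreover have "(e3 \<star> q)$1 = (\<i> *s q)$1"
    using q by simp
  ultimately have "q$1 = 0" "q$2 = 0" "q$3 = - \<i> * q$0"
    by simp_all
  then show "q = q$0 *s (qone - \<i> *s e3)"
    by (simp add: biquat_eq_iff)
next
  assume "q = q$0 *s (qone - \<i> *s e3)"
  then obtain a where q: "q = a *s (qone - \<i> *s e3)" by blast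
  show "q \<in> S2 \<and> e3 \<star> q = \<i> *s q"
    unfolding q by (simp add: S2_iff biquat_eq_iff complex_eq_iff)
qed

text \<open>Here \<open>e3 (e1 + i e2) = e2 - i e1 = - i (e1 + i e2)\<close>.\<close>

lemma S2_eigen_plus: "q \<in> S2 \<and> e3 \<star> q = (- \<i>) *s q \<longleftrightarrow> q = q$1 *s (e1 + \<i> *s e2)"
proof
  assume q: "q \<in> S2 \<and> e3 \<star> q = (- \<i>) *s q"
  have "q$2 = \<i> * q$1" "q$3 = - \<i> * q$0"
    using q by (simp_all add: S2_iff)
  moreover have "(e3 \<star> q)$0 = ((- \<i>) *s q)$0"
    using q by simp
  ultimately have "q$0 = 0" "q$3 = 0" "q$2 = \<i> * q$1"
    by simp_all
  then show "q = q$1 *s (e1 + \<i> *s e2)"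
    by (simp add: biquat_eq_iff)
next
  assume "q = q$1 *s (e1 + \<i> *s e2)"
  then obtain a where q: "q = a *s (e1 + \<i> *s e2)" by blast
  show "q \<in> S2 \<and> e3 \<star> q = (- \<i>) *s q"
    unfolding q by (simp add: S2_iff biquat_eq_iff complex_eq_iff)
qed

lemma H_tilde_minus_eq: "spin_choice \<gamma> \<Longrightarrow> H_tilde_minus \<gamma> = H_eigen \<i>"
  unfolding H_tilde_minus_def
  by (erule H_tilde_eq_H_eigen[OF _ S2_eigen_minus]) simp

lemma H_tilde_plus_eq: "spin_choice \<gamma> \<Longrightarrow> H_tilde_plus \<gamma> = H_eigen (- \<i>)"
  unfolding H_tilde_plus_def
  by (erule H_tilde_eq_H_eigen[OF _ S2_eigen_plus]) simp

text \<open>At the transformed point \<open>z\<close> the direction is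
  \<open>qinv s \<star> dirq y \<star> s\<close>, since dilation does not change it. Hence
  \<open>dirq y \<star> s = s \<star> dirq z\<close>, and the eigenvalue equation at
  \<open>z\<close> moves to \<open>y\<close>; scalar factors commute with everything.\<close>

lemma tilde_rep_H_eigen:
  assumes r: "r > 0" and s: "s \<in> Spin3" and u: "u \<in> H_eigen \<sigma>"
  shows "tilde_rep (r, s, b) u \<in> H_eigen \<sigma>"
proof -
  define f where "f = L2_fun u"
  have f: "sq_integrable f" "u = L2_class f"
    by (simp_all add: f_def sq_integrable_L2_fun L2_class_fun)
  have "AE y in lborel. f y \<in> dir_eigen \<sigma> y"
    using u by (simp add: f_def H_eigen_def)
  then have "AE y in lborel. f (simil (1/r) s 0 y) \<in> dir_eigen \<sigma> (simil (1/r) s 0 y)"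
    using r by (intro AE_simil s) auto
  then have "AE y in lborel. L2_fun (L2_class (tilde_fun r s b f)) y \<in> dir_eigen \<sigma> y"
    using L2_fun_class[OF sq_integrable_tilde_fun[OF r s f(1), of b]]
  proof eventually_elim
    case (elim y)
    let ?z = "simil (1/r) s 0 y"
    have "?z /\<^sub>R norm ?z = rot (qinv s) (y /\<^sub>R norm y)"
      using r s by (simp add: simil_def norm_rot qinv_in_Spin3 rot_linear)
    then have "dirq ?z = qinv s \<star> dirq y \<star> s"
      using qvec_rot[OF qinv_in_Spin3[OF s]] by (simp add: dirq_def qinv_qinv s)
    then have "dirq y \<star> (s \<star> f ?z) = s \<star> (dirq ?z \<star> f ?z)"
      by (simp add: qmult_assoc qinv_cancel s)
    also have "\<dots> = \<sigma> *s (s \<star> f ?z)"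
      using elim by (simp add: dir_eigen_def qmult_bilinear)
    finally have "dirq y \<star> (s \<star> f ?z) = \<sigma> *s (s \<star> f ?z)" .
    moreover have "s \<star> f ?z \<in> S2"
      using elim by (simp add: dir_eigen_def S2_qmult)
    ultimately show ?case
      unfolding elim(2) tilde_fun_def dir_eigen_def
      by (simp add: S2_smult S2_scaleR scaleR_biquat qmult_bilinear vector_smult_assoc mult_ac)
  qed
  then show ?thesis
    by (simp add: H_eigen_def f tilde_rep_class[OF r s])
qed

subsection \<open>Sub-representations\<close>

text \<open>Isometry, multiplicativity and continuity hold on the whole space; only surjectivity on
  \<open>K\<close> needs an argument, and it follows from invariance under the inverse
  element.\<close>

lemma unitary_rep_nat_rep:
  assumes K: "closed_csubspace K" and inv: "\<And>g u. g \<in> carrier G3 \<Longrightarrow> u \<in> K \<Longrightarrow> nat_rep g u \<in> K"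
  shows "unitary_rep G3 K nat_rep"
  unfolding unitary_rep_def
proof (intro conjI ballI allI group_G3 K)
  fix g assume g: "g \<in> carrier G3"
  have "u \<in> nat_rep g ` K" if "u \<in> K" for u
    using nat_rep_inv[OF g, of u] inv[OF group.inv_closed[OF group_G3 g] that] by (metis image_eqI)
  then show "nat_rep g ` K = K"
    using inv[OF g] by blast
qed (auto simp: cisometryD[OF cisometry_nat_rep_G3] nat_rep_mult_G3 continuous_nat_rep)

text \<open>For \<open>rep_plus\<close> and \<open>rep_minus\<close>, which involve
  \<open>inv_into\<close> and are compared with \<open>nat_rep\<close> only on their own
  subspaces.\<close>

lemma unitary_rep_cong:
  assumes \<rho>: "unitary_rep G K \<rho>" and eq: "\<And>g u. g \<in> carrier G \<Longrightarrow> u \<in> K \<Longrightarrow> \<sigma> g u = \<rho> g u"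
  shows "unitary_rep G K \<sigma>"
proof -
  have K: "u + v \<in> K" "L2_scale c u \<in> K" if "u \<in> K" "v \<in> K" for u v c
    using \<rho> that by (auto simp: unitary_rep_def closed_csubspace_def)
  have "group G" using \<rho> by (simp add: unitary_rep_def)
  then have m: "g \<otimes>\<^bsub>G\<^esub> h \<in> carrier G" if "g \<in> carrier G" "h \<in> carrier G" for g h
    using that by (simp add: group.is_monoid monoid.m_closed)
  have \<rho>K: "\<rho> g u \<in> K" if "g \<in> carrier G" "u \<in> K" for g u
    using \<rho> that unfolding unitary_rep_def by blast
  have im: "\<sigma> g ` K = \<rho> g ` K" if "g \<in> carrier G" for g
    using eq[OF that] by (intro image_cong) auto
  have "continuous_on (carrier G) (\<lambda>g. \<sigma> g u) \<longleftrightarrow> continuous_on (carrier G) (\<lambda>g. \<rho> g u)" if "u \<in> K" for u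
    using eq that by (intro continuous_on_cong) auto
  then show ?thesis
    using \<rho> unfolding unitary_rep_def by (simp add: eq K m \<rho>K im)
qed

lemma nat_rep_L2_S2:
  assumes g: "g \<in> carrier G3" and u: "u \<in> L2_S2"
  shows "nat_rep g u \<in> L2_S2"
proof -
  obtain r s b where rsb: "g = (r, s, b)" "r > 0" "s \<in> Spin3"
    using g by (auto simp: G3_def)
  define f where "f = L2_fun u"
  have f: "sq_integrable f" "u = L2_class f"
    by (simp_all add: f_def sq_integrable_L2_fun L2_class_fun)
  have "AE x in lborel. f x \<in> S2"
    using u by (simp add: f_def L2_S2_def)
  then have "AE x in lborel. f (simil r s b x) \<in> S2"
    by (intro AE_simil rsb)
  then have "AE x in lborel. L2_fun (L2_class (nat_fun r s b f)) x \<in> S2"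
    using L2_fun_class[OF sq_integrable_nat_fun[OF rsb(2,3) f(1), of b]]
    by eventually_elim (simp add: nat_fun_def S2_scaleR S2_qmult)
  then show ?thesis
    by (simp add: rsb f nat_rep_class L2_S2_def)
qed

lemma closed_csubspace_fourier_image:
  assumes "closed_csubspace H"
  shows "closed_csubspace (fourier ` H)"
  using assms cisometry_range_closed[OF cisometry_fourier, of H]
  unfolding closed_csubspace_def
  by (auto simp: cisometryD(1,2)[OF cisometry_fourier, symmetric]
      intro: image_eqI[of _ _ 0] simp: cisometryD(10)[OF cisometry_fourier])

text \<open>\<open>L\<close> is closed under multiplication by \<i>, so the imaginary part
  \<open>u \<bullet> L2_scale \<i> v\<close> vanishes as well.\<close>

lemma L2_hinner_orthogonal:
  assumes "closed_csubspace L" "\<And>u v. u \<in> K \<Longrightarrow> v \<in> L \<Longrightarrow> u \<bullet> v = 0" "u \<in> K" "v \<in> L"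
  shows "L2_hinner u v = 0"
  using assms by (simp add: L2_hinner_eq closed_csubspace_def complex_eq_iff)

lemma H_eigen_subset: "H_eigen \<sigma> \<subseteq> L2_S2"
  by (auto simp: H_eigen_def L2_S2_def dir_eigen_def elim: eventually_mono)

lemma fourier_tilde_rep_G3: "g \<in> carrier G3 \<Longrightarrow> fourier (tilde_rep g u) = nat_rep g (fourier u)"
  by (auto simp: G3_def fourier_tilde_rep)

text \<open>On the image the chosen preimage is a true one, so the intertwining relation turns the
  transported operator into \<open>nat_rep g\<close> itself. Invariance of the image is invariance
  of \<open>H_eigen c\<close> under \<open>tilde_rep\<close>, transported in the same way.\<close>

lemma subrep_fourier_H_eigen:
  assumes eq: "\<And>g u. \<sigma> g u = fourier (tilde_rep g (inv_into (H_eigen c) fourier u))"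
  shows "subrep G3 (fourier ` H_eigen c) \<sigma> L2_S2 nat_rep"
    and "\<And>g u. g \<in> carrier G3 \<Longrightarrow> u \<in> fourier ` H_eigen c \<Longrightarrow> \<sigma> g u = nat_rep g u"
proof -
  let ?K = "fourier ` H_eigen c"
  have inv: "nat_rep g u \<in> ?K" if g: "g \<in> carrier G3" and u: "u \<in> ?K" for g u
  proof -
    obtain w where w: "w \<in> H_eigen c" "u = fourier w"
      using u by blast
    have "tilde_rep g w \<in> H_eigen c"
      using g w(1) by (auto simp: G3_def tilde_rep_H_eigen)
    then show ?thesis
      unfolding w(2) fourier_tilde_rep_G3[OF g, symmetric] by (rule imageI)
  qed
  show eq': "\<sigma> g u = nat_rep g u" if g: "g \<in> carrier G3" and u: "u \<in> ?K" for g u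
    unfolding eq fourier_tilde_rep_G3[OF g] f_inv_into_f[OF u] ..
  have "unitary_rep G3 ?K nat_rep"
    by (intro unitary_rep_nat_rep closed_csubspace_fourier_image closed_csubspace_H_eigen inv)
  then have "unitary_rep G3 ?K \<sigma>"
    by (rule unitary_rep_cong) (rule eq')
  moreover have "unitary_rep G3 L2_S2 nat_rep"
    by (intro unitary_rep_nat_rep closed_csubspace_L2_S2 nat_rep_L2_S2)
  moreover have "?K \<subseteq> L2_S2"
    using H_eigen_subset fourier_L2_S2 by blast
  ultimately show "subrep G3 ?K \<sigma> L2_S2 nat_rep"
    using eq' by (simp add: subrep_def)
qed

theorem theorem5p7:
  fixes \<gamma> :: "real ^ 3 \<Rightarrow> biquat"
  assumes "spin_choice \<gamma>"
  shows "unitary_rep G3 L2_S2 nat_rep \<and>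
    direct_sum_rep G3 L2_S2 nat_rep (qH_plus \<gamma>) (rep_plus \<gamma>) (qH_minus \<gamma>) (rep_minus \<gamma>)"
proof -
  let ?K = "fourier ` H_eigen (- \<i>)" and ?L = "fourier ` H_eigen \<i>"
  have KL: "qH_plus \<gamma> = ?K" "qH_minus \<gamma> = ?L"
    using assms by (simp_all add: qH_plus_def qH_minus_def H_tilde_plus_eq H_tilde_minus_eq)
  have "rep_plus \<gamma> g u = fourier (tilde_rep g (inv_into (H_eigen (- \<i>)) fourier u))" for g u
    using assms by (simp add: rep_plus_def H_tilde_plus_eq)
  note plus = subrep_fourier_H_eigen[where \<sigma> = "rep_plus \<gamma>", OF this]
  have "rep_minus \<gamma> g u = fourier (tilde_rep g (inv_into (H_eigen \<i>) fourier u))" for g u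
    using assms by (simp add: rep_minus_def H_tilde_minus_eq)
  note minus = subrep_fourier_H_eigen[where \<sigma> = "rep_minus \<gamma>", OF this]
  have rep: "unitary_rep G3 L2_S2 nat_rep"
    using plus(1) by (simp add: subrep_def)
  have "u \<bullet> v = 0" if "u \<in> ?K" "v \<in> ?L" for u v
    using that inner_H_eigen by (auto simp: cisometryD(3)[OF cisometry_fourier])
  then have orth: "L2_hinner u v = 0" if "u \<in> ?K" "v \<in> ?L" for u v
    using that L2_hinner_orthogonal[OF closed_csubspace_fourier_image[OF closed_csubspace_H_eigen]] by blast
  have sum: "L2_S2 = {u + v | u v. u \<in> ?K \<and> v \<in> ?L}"
  proof
    show "{u + v | u v. u \<in> ?K \<and> v \<in> ?L} \<subseteq> L2_S2"
      using plus(1) minus(1) closed_csubspace_L2_S2 unfolding subrep_def closed_csubspace_def by blast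
    show "L2_S2 \<subseteq> {u + v | u v. u \<in> ?K \<and> v \<in> ?L}"
    proof
      fix u assume "u \<in> L2_S2"
      \<comment> \<open>The splitting is pointwise before the transform, so it is applied to the
        preimage, which lies in \<open>L2_S2\<close> because \<open>fourier\<close> maps this space
        onto itself.\<close>
      then obtain w where w: "w \<in> L2_S2" "u = fourier w"
        using fourier_L2_S2 by blast
      from w(1) obtain x y where "x \<in> H_eigen (- \<i>)" "y \<in> H_eigen \<i>" "w = x + y"
        by (rule L2_S2_decomposition)
      then show "u \<in> {u + v | u v. u \<in> ?K \<and> v \<in> ?L}"
        using w(2) cisometryD(1)[OF cisometry_fourier] by blast
    qed
  qed
  have "nat_rep g (u + v) = rep_plus \<gamma> g u + rep_minus \<gamma> g v"
    if "g \<in> carrier G3" "u \<in> ?K" "v \<in> ?L" for g u v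
    using that by (simp add: plus(2) minus(2) cisometryD(1)[OF cisometry_nat_rep_G3])
  then show ?thesis
    unfolding direct_sum_rep_def KL using rep plus(1) minus(1) orth sum by blast
qed

end
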